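(* Let $D\subset\mathbb{R}^d$ be an open set. For all $x,y\in\mathbb{R}^d$ and $t>0$, $$\hat p_D(t,x,y)=\hat p_D(t,y,x).$$
   Context: $d\ge 1$, $0<\alpha<2$. $X=(X_t)_{t\ge 0}$ is the standard isotropic $\alpha$-stable Lévy process in $\mathbb{R}^d$ with càdlàg paths; $\mathbb{P}_x,\mathbb{E}_x$ are its law and expectation when started from $x$, so $\mathbb{E}_0e^{i\xi\cdot X_t}=e^{-t|\xi|^\alpha}$. Its transition density is $p(t,x,y)=p_t(y-x)$, where $p_t(x)=(2\pi)^{-d}\int_{\mathbb{R}^d}e^{-ix\cdot\xi}e^{-t|\xi|^\alpha}\,d\xi$, $t>0$. $[v,w]$ is the line segment between $v$ and $w$, $X_{0-}=X_0$, and the shot-down time is $\sigma_D=\inf\{t>0:[X_{t^-},X_t]\cap D^c\ne\emptyset\}$. Notation $\mathbb{E}[A;F]=\int_A F\,d\mathbb{P}$. The heat kernel of the shot-down process is defined pointwise by $$\hat p_D(t,x,y)=p(t,x,y)-\mathbb{E}_x[\sigma_D<t;\ p(t-\sigma_D,X_{\sigma_D},y)],\quad t>0,\ x,y\in\mathbb{R}^d.$$ *)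

theory Defs
  imports "HOL-Probability.Probability"
begin

text \<open>
  Processes are indexed by \<open>real\<close>; only times \<open>t \<ge> 0\<close> are meaningful, and nothing below
  constrains or uses the values at negative times. The state space \<open>\<real>\<^sup>d\<close>, \<open>d \<ge> 1\<close>, is an
  arbitrary Euclidean space \<open>'a\<close> with \<open>d = DIM('a)\<close>.
\<close>

definition cadlag :: "(real \<Rightarrow> 'a::euclidean_space) \<Rightarrow> bool" where
  "cadlag f \<longleftrightarrow>
     (\<forall>t\<ge>0. continuous (at_right t) f) \<and> (\<forall>t>0. \<exists>l. (f \<longlongrightarrow> l) (at_left t))"

definition left_limit :: "(real \<Rightarrow> 'a::euclidean_space) \<Rightarrow> real \<Rightarrow> 'a" where
  "left_limit f t = (if t = 0 then f 0 else Lim (at_left t) f)"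

text \<open>
  The paths are required to be cadlag for every \<open>\<omega>\<close>, not just almost every one, because the
  probability space is not assumed to be complete.
\<close>

locale levy_process = prob_space M for M :: "'w measure" +
  fixes X :: "real \<Rightarrow> 'w \<Rightarrow> 'a::euclidean_space"
  assumes measurable_process: "\<And>t. 0 \<le> t \<Longrightarrow> random_variable borel (X t)"
    and start_zero: "AE \<omega> in M. X 0 \<omega> = 0"
    and independent_increments:
      "\<And>(t :: nat \<Rightarrow> real) n. 0 \<le> t 0 \<Longrightarrow> mono_on {..n} t \<Longrightarrow>
         indep_vars (\<lambda>_. borel) (\<lambda>i \<omega>. X (t (Suc i)) \<omega> - X (t i) \<omega>) {..<n}"
    and stationary_increments:
      "\<And>s h. 0 \<le> s \<Longrightarrow> 0 \<le> h \<Longrightarrow>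
         distr M borel (\<lambda>\<omega>. X (s + h) \<omega> - X s \<omega>) = distr M borel (X h)"
    and cadlag_paths: "\<And>\<omega>. \<omega> \<in> space M \<Longrightarrow> cadlag (\<lambda>t. X t \<omega>)"

locale isotropic_stable_process = levy_process M X
  for M :: "'w measure" and X :: "real \<Rightarrow> 'w \<Rightarrow> 'a::euclidean_space" +
  fixes \<alpha> :: real
  assumes characteristic_function:
    "\<And>t \<xi>. 0 \<le> t \<Longrightarrow>
       (\<integral>\<omega>. cis (\<xi> \<bullet> X t \<omega>) \<partial>M) = complex_of_real (exp (- t * norm \<xi> powr \<alpha>))"

text \<open>
  The Fourier integral is real, as its integrand is conjugated by \<open>\<xi> \<mapsto> - \<xi>\<close>;
  \<open>Re\<close> only changes the type.
\<close>

definition stable_density :: "real \<Rightarrow> real \<Rightarrow> 'a::euclidean_space \<Rightarrow> real" where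
  "stable_density \<alpha> t x =
     Re ((\<integral>\<xi>. cis (- (x \<bullet> \<xi>)) * complex_of_real (exp (- t * norm \<xi> powr \<alpha>)) \<partial>lborel)
         / (2 * pi) ^ DIM('a))"

definition transition_density ::
    "real \<Rightarrow> real \<Rightarrow> 'a::euclidean_space \<Rightarrow> 'a \<Rightarrow> real" where
  "transition_density \<alpha> t x y = stable_density \<alpha> t (y - x)"

text \<open>\<open>Inf\<close> is taken in \<^typ>\<open>ereal\<close>, so that a path that is never shot down gets the value \<open>\<infinity>\<close>.\<close>

definition shot_down_time :: "'a::euclidean_space set \<Rightarrow> (real \<Rightarrow> 'a) \<Rightarrow> ereal" where
  "shot_down_time D f =
     Inf (ereal ` {t. 0 < t \<and> closed_segment (left_limit f t) (f t) \<inter> - D \<noteq> {}})"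

text \<open>
  If \<open>X\<close> is a Levy process under \<open>M\<close> (so \<open>X\<close> starts from \<open>0\<close>), then the law \<open>P\<^sub>x\<close> of the
  process started from \<open>x\<close> is the law of \<open>x + X\<close> under \<open>M\<close>.
\<close>

definition started_from :: "'a::euclidean_space \<Rightarrow> (real \<Rightarrow> 'w \<Rightarrow> 'a) \<Rightarrow> real \<Rightarrow> 'w \<Rightarrow> 'a" where
  "started_from x X t \<omega> = x + X t \<omega>"

definition shot_down_kernel ::
    "'w measure \<Rightarrow> (real \<Rightarrow> 'w \<Rightarrow> 'a) \<Rightarrow> real \<Rightarrow> 'a::euclidean_space set
      \<Rightarrow> real \<Rightarrow> 'a \<Rightarrow> 'a \<Rightarrow> real" where
  "shot_down_kernel M X \<alpha> D t x y =
     (let Y = started_from x X;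
          \<sigma> = (\<lambda>\<omega>. shot_down_time D (\<lambda>s. Y s \<omega>))
      in transition_density \<alpha> t x y
         - (LINT \<omega>:{\<omega> \<in> space M. \<sigma> \<omega> < ereal t}|M.
              transition_density \<alpha> (t - real_of_ereal (\<sigma> \<omega>)) (Y (real_of_ereal (\<sigma> \<omega>)) \<omega>) y))"

end

theory Submission
  imports Defs
begin

text \<open>
  Optional stopping of the martingale \<open>p\<^bsub>t - s\<^esub>(X\<^sub>s, y)\<close> identifies the killed kernel with the
  limit, as \<open>a \<rightarrow> 0\<close> and \<open>b \<rightarrow> t\<close>, of \<open>E\<^sub>x[p\<^bsub>t - b\<^esub>(X\<^sub>b, y); no shot in [a, b]]\<close>. That no shot
  occurs in \<open>[a, b]\<close> means that the polylines through \<open>X\<close> at equidistant times of \<open>[a, b]\<close>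
  eventually keep a positive distance from \<open>- D\<close>. The corresponding expectations for polylines have
  the form \<open>\<integral> p\<^sub>a(x, z) Q\<^sup>n[p\<^bsub>t - b\<^esub>(\<cdot>, y)](z) dz\<close> with an operator \<open>Q\<close> that is symmetric in
  \<open>L\<^sup>2(dz)\<close>, since the increments of \<open>X\<close> are symmetric and polylines do not depend on the direction
  in which they are traversed. Exchanging \<open>x\<close> and \<open>y\<close> therefore replaces \<open>[a, b]\<close> by
  \<open>[t - b, t - a]\<close>, which does not change the limit. The identity
  is pointwise in \<open>x\<close> and \<open>y\<close>, because the first step, up to time \<open>a\<close>, and the last one, from
  time \<open>b\<close>, are both described by the density \<open>p\<close>.
\<close>

section \<open>Fourier inversion\<close>

text \<open>The shot-down condition couples both one-sided limits at uncountably many times, the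
  probability space need not be complete, and a reversed cadlag path is not cadlag. Polylines meet
  all three obstacles: they involve finitely many times, and their reversal is an exact identity of
  numbers for every width \<open>1 / Suc k\<close> and every grid. Width and grid are separate
  parameters because for a fixed width the polylines need not settle: a path with a hit comes near
  \<open>- D\<close> for every width, a path without one stays away only for some width. Hence the
  form \<open>SUP k. liminf n\<close>. Windows start after 0 because only positive times count and
  \<open>X 0\<close> has no density; they end before \<open>t\<close> because
  \<open>p (t - s)\<close> degenerates there. The kernel turns out to be the infimum of the window
  expectations, so no joint limit in \<open>a\<close> and \<open>b\<close> has to be taken. Fourier
  inversion enters because the process is given by characteristic functions and the kernel by a
  Fourier integral; that this integral is nonnegative and is the density of \<open>X t\<close> has
  to be derived.\<close>

lemma
  fixes f :: "'a::euclidean_space \<Rightarrow> real \<Rightarrow> 'b::{real_normed_field,banach,second_countable_topology}"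
  assumes "\<And>b. b \<in> Basis \<Longrightarrow> integrable lborel (f b)"
  shows integrable_lborel_prod: "integrable lborel (\<lambda>x. \<Prod>b\<in>Basis. f b (x \<bullet> b))"
    and integral_lborel_prod:
      "(\<integral>x. (\<Prod>b\<in>Basis. f b (x \<bullet> b)) \<partial>lborel) = (\<Prod>b\<in>Basis. \<integral>x. f b x \<partial>lborel)"
proof -
  interpret product_sigma_finite "\<lambda>_::'a. lborel :: real measure"
    by standard
  have fm [measurable]: "f b \<in> borel_measurable borel" if "b \<in> Basis" for b
    using assms[OF that] by (simp add: borel_measurable_integrable)
  have [measurable]: "(\<lambda>x. \<Prod>b\<in>Basis. f b (x \<bullet> b)) \<in> borel_measurable borel"
    by (rule borel_measurable_prod) measurable
  have eq: "(\<lambda>x. \<Prod>b\<in>Basis. f b ((\<Sum>b\<in>Basis. x b *\<^sub>R b) \<bullet> b)) = (\<lambda>x. \<Prod>b\<in>Basis. f b (x b))"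
    by (intro ext prod.cong) auto
  show "integrable lborel (\<lambda>x. \<Prod>b\<in>Basis. f b (x \<bullet> b))"
    unfolding lborel_eq[where 'a = 'a]
    by (subst integrable_distr_eq) (auto simp: eq intro!: product_integrable_prod assms)
  show "(\<integral>x. (\<Prod>b\<in>Basis. f b (x \<bullet> b)) \<partial>lborel) = (\<Prod>b\<in>Basis. \<integral>x. f b x \<partial>lborel)"
    unfolding lborel_eq[where 'a = 'a]
    by (subst integral_distr) (auto simp: eq intro!: product_integral_prod assms)
qed

section \<open>Integrability of the stable characteristic function\<close>

lemma power_le_fact_mult_exp:
  fixes y :: real
  assumes "0 \<le> y"
  shows "y ^ m \<le> fact m * exp y"
proof -
  have s: "(\<lambda>n. inverse (fact n) * y ^ n) sums exp y"
    using exp_converges[of y] by (simp add: scaleR_conv_of_real)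
  have "(\<Sum>n\<in>{m}. inverse (fact n) * y ^ n) \<le> exp y"
    unfolding sums_unique[OF s]
    by (rule sum_le_suminf) (use s assms in \<open>auto simp: sums_iff\<close>)
  then show ?thesis
    by (simp add: field_simps)
qed

lemma integrable_exp_abs_powr:
  fixes c \<alpha> :: real
  assumes "0 < c" "0 < \<alpha>"
  shows "integrable lborel (\<lambda>u. exp (- c * \<bar>u\<bar> powr \<alpha>))"
proof -
  \<comment> \<open>This choice makes \<open>\<alpha> * m \<ge> 2\<close>, so
    \<open>u\<^sup>2 \<le> (\<bar>u\<bar> powr \<alpha>) ^ m\<close> for
    \<open>\<bar>u\<bar> > 1\<close>, a power that the exponential beats.\<close>
  define m where "m = nat \<lceil>2 / \<alpha>\<rceil>"
  have "2 / \<alpha> \<le> real m"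
    unfolding m_def using assms by (auto simp: of_nat_nat le_of_int_ceiling)
  then have m: "2 \<le> \<alpha> * real m"
    using assms by (simp add: field_simps)
  \<comment> \<open>The summand 2 covers \<open>\<bar>u\<bar> \<le> 1\<close>, where
    \<open>1 + u\<^sup>2 \<le> 2\<close>. The other one covers larger \<open>u\<close> through
    \<open>y ^ m \<le> fact m * exp y\<close> at
    \<open>y = c * \<bar>u\<bar> powr \<alpha>\<close>.\<close>
  define C where "C = 2 + 2 * fact m / c ^ m"
  have C: "exp (- c * \<bar>u\<bar> powr \<alpha>) \<le> C * inverse (1 + u\<^sup>2)" for u
  proof -
    have "(1 + u\<^sup>2) * exp (- c * \<bar>u\<bar> powr \<alpha>) \<le> C"
    proof (cases "\<bar>u\<bar> \<le> 1")
      case True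
      then have "(1 + u\<^sup>2) * exp (- c * \<bar>u\<bar> powr \<alpha>) \<le> 2 * 1"
        using assms by (intro mult_mono) (auto simp: abs_square_le_1)
      also have "\<dots> \<le> C"
        using assms by (simp add: C_def)
      finally show ?thesis .
    next
      case False
      then have u: "1 < \<bar>u\<bar>" by simp
      have "u\<^sup>2 = \<bar>u\<bar> powr 2"
        using u by (simp add: powr_realpow[symmetric])
      also have "\<dots> \<le> \<bar>u\<bar> powr (\<alpha> * real m)"
        using u m by (intro powr_mono) auto
      also have "\<dots> = (\<bar>u\<bar> powr \<alpha>) ^ m"
        using u by (simp add: powr_powr[symmetric] powr_realpow)
      finally have 1: "u\<^sup>2 \<le> (\<bar>u\<bar> powr \<alpha>) ^ m" .
      have "1 \<le> u\<^sup>2"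
        using u by (metis abs_square_less_1 less_eq_real_def linorder_not_less)
      with 1 have 2: "1 + u\<^sup>2 \<le> 2 * (\<bar>u\<bar> powr \<alpha>) ^ m"
        by simp
      have "(c * \<bar>u\<bar> powr \<alpha>) ^ m \<le> fact m * exp (c * \<bar>u\<bar> powr \<alpha>)"
        using assms by (intro power_le_fact_mult_exp) auto
      then have "(\<bar>u\<bar> powr \<alpha>) ^ m \<le> fact m / c ^ m * exp (c * \<bar>u\<bar> powr \<alpha>)"
        using assms by (simp add: power_mult_distrib field_simps)
      with 2 have "1 + u\<^sup>2 \<le> 2 * fact m / c ^ m * exp (c * \<bar>u\<bar> powr \<alpha>)"
        by simp
      then have "(1 + u\<^sup>2) * exp (- c * \<bar>u\<bar> powr \<alpha>) \<le>
          2 * fact m / c ^ m * exp (c * \<bar>u\<bar> powr \<alpha>) * exp (- c * \<bar>u\<bar> powr \<alpha>)"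
        by (intro mult_right_mono) auto
      also have "\<dots> \<le> C"
        by (simp add: C_def exp_minus field_simps)
      finally show ?thesis .
    qed
    then show ?thesis
      by (simp add: field_simps add_pos_nonneg)
  qed
  have "integrable lborel (\<lambda>u::real. C * inverse (1 + u\<^sup>2))"
    using integrable_inverse_1_plus_square by (simp add: set_integrable_def)
  then show ?thesis
    by (rule Bochner_Integration.integrable_bound) (use C in \<open>auto intro: order_trans abs_ge_self\<close>)
qed

lemma integrable_exp_norm_powr:
  fixes t \<alpha> :: real
  assumes "0 < t" "0 < \<alpha>"
  shows "integrable lborel (\<lambda>\<xi>::'a::euclidean_space. exp (- t * norm \<xi> powr \<alpha>))"
proof -
  \<comment> \<open>Every coordinate is at most the norm, so splitting \<open>t\<close> evenly over
    the coordinates bounds the integrand by a product of one-dimensional integrands.\<close>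
  let ?c = "t / DIM('a)"
  have "integrable lborel (\<lambda>\<xi>::'a. \<Prod>b\<in>Basis. exp (- ?c * \<bar>\<xi> \<bullet> b\<bar> powr \<alpha>))"
    using assms by (intro integrable_lborel_prod integrable_exp_abs_powr) auto
  then show ?thesis
  proof (rule Bochner_Integration.integrable_bound)
    show "AE \<xi>::'a in lborel. norm (exp (- t * norm \<xi> powr \<alpha>))
        \<le> norm (\<Prod>b\<in>Basis. exp (- ?c * \<bar>\<xi> \<bullet> b\<bar> powr \<alpha>))"
    proof (rule AE_I2)
      fix \<xi> :: 'a
      have "(\<Sum>b\<in>(Basis::'a set). ?c * \<bar>\<xi> \<bullet> b\<bar> powr \<alpha>) \<le> (\<Sum>b\<in>(Basis::'a set). ?c * norm \<xi> powr \<alpha>)"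
        using assms by (intro sum_mono mult_left_mono powr_mono2) (auto simp: Basis_le_norm)
      also have "\<dots> = t * norm \<xi> powr \<alpha>"
        by simp
      finally show "norm (exp (- t * norm \<xi> powr \<alpha>))
        \<le> norm (\<Prod>b\<in>(Basis::'a set). exp (- ?c * \<bar>\<xi> \<bullet> b\<bar> powr \<alpha>))"
        by (simp add: exp_sum[symmetric] sum_negf prod_nonneg)
    qed
  qed simp
qed

section \<open>Gaussian densities and their Fourier transforms\<close>

definition gauss :: "'a::euclidean_space \<Rightarrow> real" where
  "gauss x = (\<Prod>b\<in>Basis. std_normal_density (x \<bullet> b))"

lemma gauss_nonneg: "0 \<le> gauss x"
  by (simp add: gauss_def prod_nonneg)

lemma gauss_measurable [measurable]: "gauss \<in> borel_measurable borel"
  unfolding gauss_def [abs_def] by measurable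

lemma nn_integral_gauss: "(\<integral>\<^sup>+x. ennreal (gauss x) \<partial>lborel) = 1"
proof -
  have "(\<integral>\<^sup>+x. ennreal (std_normal_density x) \<partial>lborel) = 1"
    using prob_space.emeasure_space_1[OF prob_space_normal_density[of 1 0]]
    by (simp add: emeasure_density)
  then show ?thesis
    using nn_integral_lborel_prod[of "\<lambda>b::'a. \<lambda>x. ennreal (std_normal_density x)"]
    by (simp add: gauss_def prod_ennreal)
qed

text \<open>The substitution \<open>x = \<epsilon> * v\<close> in the characteristic function of the
  standard normal law: a Gaussian is its own Fourier transform up to scaling.\<close>

lemma
  fixes \<epsilon> u :: real
  assumes "0 < \<epsilon>"
  shows integrable_cis_gauss_real:
      "integrable lborel (\<lambda>v. cis (- (u * v)) * complex_of_real (exp (- (\<epsilon> * v)\<^sup>2 / 2)))" (is ?A)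
    and integral_cis_gauss_real:
      "(\<integral>v. cis (- (u * v)) * complex_of_real (exp (- (\<epsilon> * v)\<^sup>2 / 2)) \<partial>lborel)
        = complex_of_real (2 * pi / \<epsilon> * std_normal_density (u / \<epsilon>))" (is ?B)
proof -
  have A: "has_bochner_integral lborel (\<lambda>x. std_normal_density x *\<^sub>R iexp (u' * x))
      (complex_of_real (exp (- (u'\<^sup>2) / 2)))" for u' :: real
  proof -
    have i: "integrable lborel (\<lambda>x. std_normal_density x *\<^sub>R iexp (u' * x))"
      by (rule Bochner_Integration.integrable_bound[OF integrable_normal_density[of 1 0]])
        (auto simp: normal_density_nonneg)
    have "(\<integral>x. std_normal_density x *\<^sub>R iexp (u' * x) \<partial>lborel) = char std_normal_distribution u'"
      unfolding char_def
      by (subst integral_density) (auto simp: normal_density_nonneg)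
    also have "\<dots> = complex_of_real (exp (- (u'\<^sup>2) / 2))"
      by (simp add: char_std_normal_distribution)
    finally show ?thesis
      using i by (simp add: has_bochner_integral_iff)
  qed
  let ?u = "- u / \<epsilon>"
  have "has_bochner_integral lborel
      (\<lambda>v. std_normal_density (0 + \<epsilon> * v) *\<^sub>R iexp (?u * (0 + \<epsilon> * v)))
      (complex_of_real (exp (- (?u\<^sup>2) / 2)) /\<^sub>R \<bar>\<epsilon>\<bar>)"
    using A[of ?u] assms by (subst (asm) lborel_has_bochner_integral_real_affine_iff[of \<epsilon> _ _ 0]) auto
  then have "has_bochner_integral lborel
      (\<lambda>v. complex_of_real (sqrt (2 * pi)) * (std_normal_density (\<epsilon> * v) *\<^sub>R iexp (?u * (\<epsilon> * v))))
      (complex_of_real (sqrt (2 * pi)) * (complex_of_real (exp (- (?u\<^sup>2) / 2)) /\<^sub>R \<bar>\<epsilon>\<bar>))"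
    by (intro has_bochner_integral_mult_right) simp
  also have "(\<lambda>v. complex_of_real (sqrt (2 * pi)) * (std_normal_density (\<epsilon> * v) *\<^sub>R iexp (?u * (\<epsilon> * v))))
      = (\<lambda>v. cis (- (u * v)) * complex_of_real (exp (- (\<epsilon> * v)\<^sup>2 / 2)))"
    using assms by (auto simp: normal_density_def cis_conv_exp scaleR_conv_of_real field_simps)
  also have "complex_of_real (sqrt (2 * pi)) * (complex_of_real (exp (- (?u\<^sup>2) / 2)) /\<^sub>R \<bar>\<epsilon>\<bar>)
      = complex_of_real (sqrt (2 * pi) * exp (- (?u\<^sup>2) / 2) / \<epsilon>)"
    using assms by (simp add: scaleR_conv_of_real field_simps)
  also have "sqrt (2 * pi) * exp (- (?u\<^sup>2) / 2) / \<epsilon> = 2 * pi / \<epsilon> * std_normal_density (u / \<epsilon>)"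
  proof -
    have "2 * pi = sqrt (2 * pi) * sqrt (2 * pi)"
      by simp
    then show ?thesis
      using assms unfolding normal_density_def
      by (simp add: field_simps)
  qed
  finally show ?A ?B
    by (simp_all add: has_bochner_integral_iff)
qed

lemma cis_sum: "finite A \<Longrightarrow> cis (\<Sum>i\<in>A. f i) = (\<Prod>i\<in>A. cis (f i))"
  by (induction A rule: finite_induct) (auto simp: cis_mult[symmetric])

lemma
  fixes \<epsilon> :: real and u :: "'a::euclidean_space"
  assumes "0 < \<epsilon>"
  shows integrable_cis_gauss:
      "integrable lborel (\<lambda>\<xi>. cis (- (u \<bullet> \<xi>)) * complex_of_real (exp (- (\<epsilon> * norm \<xi>)\<^sup>2 / 2)))"
    and integral_cis_gauss:
      "(\<integral>\<xi>. cis (- (u \<bullet> \<xi>)) * complex_of_real (exp (- (\<epsilon> * norm \<xi>)\<^sup>2 / 2)) \<partial>lborel)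
        = complex_of_real ((2 * pi) ^ DIM('a) / \<epsilon> ^ DIM('a) * gauss (u /\<^sub>R \<epsilon>))"
proof -
  have eq: "cis (- (u \<bullet> \<xi>)) * complex_of_real (exp (- (\<epsilon> * norm \<xi>)\<^sup>2 / 2)) =
    (\<Prod>b\<in>Basis. cis (- ((u \<bullet> b) * (\<xi> \<bullet> b))) * complex_of_real (exp (- (\<epsilon> * (\<xi> \<bullet> b))\<^sup>2 / 2)))" for \<xi> :: 'a
  proof -
    have "- (u \<bullet> \<xi>) = (\<Sum>b\<in>Basis. - ((u \<bullet> b) * (\<xi> \<bullet> b)))"
      by (subst euclidean_inner) (simp add: sum_negf)
    moreover have "- (\<epsilon> * norm \<xi>)\<^sup>2 / 2 = (\<Sum>b\<in>Basis. - (\<epsilon> * (\<xi> \<bullet> b))\<^sup>2 / 2)"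
      unfolding power_mult_distrib power2_norm_eq_inner
      by (subst euclidean_inner) (simp add: sum_negf sum_divide_distrib sum_distrib_left power2_eq_square)
    ultimately show ?thesis
      by (simp add: cis_sum exp_sum prod.distrib)
  qed
  show "integrable lborel (\<lambda>\<xi>. cis (- (u \<bullet> \<xi>)) * complex_of_real (exp (- (\<epsilon> * norm \<xi>)\<^sup>2 / 2)))"
    unfolding eq by (intro integrable_lborel_prod integrable_cis_gauss_real assms)
  have "(\<integral>\<xi>. cis (- (u \<bullet> \<xi>)) * complex_of_real (exp (- (\<epsilon> * norm \<xi>)\<^sup>2 / 2)) \<partial>lborel)
    = (\<Prod>b\<in>(Basis::'a set). complex_of_real (2 * pi / \<epsilon> * std_normal_density ((u \<bullet> b) / \<epsilon>)))"
    unfolding eq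
    by (subst integral_lborel_prod)
      (intro integrable_cis_gauss_real assms prod.cong integral_cis_gauss_real refl)+
  also have "\<dots> = complex_of_real (\<Prod>b\<in>(Basis::'a set). (2 * pi / \<epsilon>) * std_normal_density ((u \<bullet> b) / \<epsilon>))"
    by simp
  also have "(\<Prod>b\<in>(Basis::'a set). (2 * pi / \<epsilon>) * std_normal_density ((u \<bullet> b) / \<epsilon>))
     = (2 * pi) ^ DIM('a) / \<epsilon> ^ DIM('a) * gauss (u /\<^sub>R \<epsilon>)"
    unfolding gauss_def prod.distrib by (simp add: divide_inverse power_mult_distrib power_inverse mult_ac)
  finally show "(\<integral>\<xi>. cis (- (u \<bullet> \<xi>)) * complex_of_real (exp (- (\<epsilon> * norm \<xi>)\<^sup>2 / 2)) \<partial>lborel)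
        = complex_of_real ((2 * pi) ^ DIM('a) / \<epsilon> ^ DIM('a) * gauss (u /\<^sub>R \<epsilon>))" .
qed

lemma cis_measurable [measurable]: "cis \<in> borel_measurable borel"
  by (intro borel_measurable_continuous_onI continuous_intros)

lemma lborel_distr_uminus_euclidean: "distr lborel borel uminus = (lborel :: 'a::euclidean_space measure)"
  by (subst lborel_affine[of "-1" "0::'a"]) (auto simp: density_1 one_ennreal_def[symmetric])

lemma nn_integral_lborel_shift:
  fixes c :: "'a::euclidean_space"
  assumes [measurable]: "f \<in> borel_measurable borel"
  shows "(\<integral>\<^sup>+z. f (z + c) \<partial>lborel) = (\<integral>\<^sup>+z. f z \<partial>lborel)"
proof -
  have "(\<integral>\<^sup>+z. f z \<partial>lborel) = (\<integral>\<^sup>+z. f z \<partial>distr lborel borel ((+) c))"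
    by (simp add: lborel_distr_plus)
  also have "\<dots> = (\<integral>\<^sup>+z. f (z + c) \<partial>lborel)"
    by (subst nn_integral_distr) (auto simp: add.commute)
  finally show ?thesis ..
qed

lemma nn_integral_lborel_scale:
  fixes t :: "'a::euclidean_space"
  assumes [measurable]: "f \<in> borel_measurable borel" and "0 < c"
  shows "(\<integral>\<^sup>+z. f z \<partial>lborel) = ennreal (c ^ DIM('a)) * (\<integral>\<^sup>+z. f (t + c *\<^sub>R z) \<partial>lborel)"
  using assms(2)
  by (subst lborel_affine[of c t])
    (auto simp: nn_integral_density nn_integral_distr nn_integral_cmult ennreal_power)

definition fourier_inversion :: "('a::euclidean_space \<Rightarrow> complex) \<Rightarrow> 'a \<Rightarrow> real" where
  "fourier_inversion \<phi> x = Re ((\<integral>\<xi>. cis (- (x \<bullet> \<xi>)) * \<phi> \<xi> \<partial>lborel) / (2 * pi) ^ DIM('a))"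

section \<open>Inversion for a random vector with integrable characteristic function\<close>

context prob_space
begin

context
  fixes Z :: "'a \<Rightarrow> 'b::euclidean_space" and \<phi> :: "'b \<Rightarrow> complex"
  assumes Z [measurable]: "random_variable borel Z"
    and \<phi>: "\<And>\<xi>. (\<integral>\<omega>. cis (\<xi> \<bullet> Z \<omega>) \<partial>M) = \<phi> \<xi>"
    and int_\<phi>: "integrable lborel \<phi>"
begin

text \<open>\<open>\<phi>\<close> is itself an expectation, and exchanging it with the integral over
  \<open>\<xi>\<close> requires absolute convergence on the product space. The unimodular
  \<open>cis\<close> does not provide it; the Gaussian factor does.\<close>

lemma integral_char_gauss:
  fixes x :: 'b and \<epsilon> :: real
  assumes "0 < \<epsilon>"
  shows "(\<integral>\<xi>. cis (- (x \<bullet> \<xi>)) * \<phi> \<xi> * complex_of_real (exp (- (\<epsilon> * norm \<xi>)\<^sup>2 / 2)) \<partial>lborel)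
    = complex_of_real ((2 * pi) ^ DIM('b) / \<epsilon> ^ DIM('b) * (\<integral>\<omega>. gauss ((x - Z \<omega>) /\<^sub>R \<epsilon>) \<partial>M))"
proof -
  interpret P: pair_sigma_finite lborel M ..
  let ?e = "\<lambda>\<xi>::'b. complex_of_real (exp (- (\<epsilon> * norm \<xi>)\<^sup>2 / 2))"
  let ?F = "\<lambda>\<xi> \<omega>. cis (- ((x - Z \<omega>) \<bullet> \<xi>)) * ?e \<xi>"
  have int_e: "integrable lborel (\<lambda>\<xi>::'b. exp (- (\<epsilon> * norm \<xi>)\<^sup>2 / 2))"
    using integrable_cis_gauss[OF assms, of "0::'b"] by (simp add: complex_of_real_integrable_eq)
  have F: "integrable (lborel \<Otimes>\<^sub>M M) (case_prod ?F)"
  proof (rule P.Fubini_integrable)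
    show "integrable lborel (\<lambda>\<xi>. \<integral>\<omega>. norm (case (\<xi>, \<omega>) of (\<xi>, \<omega>) \<Rightarrow> ?F \<xi> \<omega>) \<partial>M)"
      using int_e by (simp add: norm_mult prob_space)
    show "AE \<xi> in lborel. integrable M (\<lambda>\<omega>. case (\<xi>, \<omega>) of (\<xi>, \<omega>) \<Rightarrow> ?F \<xi> \<omega>)"
      by (intro AE_I2 integrable_const_bound[of _ 1]) (auto simp: norm_mult)
  qed measurable
  have "(\<integral>\<xi>. cis (- (x \<bullet> \<xi>)) * \<phi> \<xi> * ?e \<xi> \<partial>lborel) = (\<integral>\<xi>. \<integral>\<omega>. ?F \<xi> \<omega> \<partial>M \<partial>lborel)"
  proof (rule Bochner_Integration.integral_cong[OF refl])
    fix \<xi>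
    have "cis (- ((x - Z \<omega>) \<bullet> \<xi>)) * ?e \<xi> = (cis (- (x \<bullet> \<xi>)) * ?e \<xi>) * cis (\<xi> \<bullet> Z \<omega>)" for \<omega>
      by (simp add: cis_mult inner_diff_left inner_commute algebra_simps)
    then show "cis (- (x \<bullet> \<xi>)) * \<phi> \<xi> * ?e \<xi> = (\<integral>\<omega>. ?F \<xi> \<omega> \<partial>M)"
      by (simp add: \<phi> mult_ac)
  qed
  also have "\<dots> = (\<integral>\<omega>. \<integral>\<xi>. ?F \<xi> \<omega> \<partial>lborel \<partial>M)"
    by (rule P.Fubini_integral[OF F, symmetric])
  also have "\<dots> = (\<integral>\<omega>. complex_of_real ((2 * pi) ^ DIM('b) / \<epsilon> ^ DIM('b) * gauss ((x - Z \<omega>) /\<^sub>R \<epsilon>)) \<partial>M)"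
    by (intro Bochner_Integration.integral_cong refl integral_cis_gauss assms)
  finally show ?thesis
    by simp
qed

abbreviation "inversion \<equiv> fourier_inversion \<phi>"

text \<open>The density of \<open>Z + N / Suc n\<close> for a standard normal \<open>N\<close>
  independent of \<open>Z\<close>, written without introducing such an \<open>N\<close>.\<close>

definition smoothed :: "nat \<Rightarrow> 'b \<Rightarrow> real" where
  "smoothed n x = Suc n ^ DIM('b) * (\<integral>\<omega>. gauss (Suc n *\<^sub>R (x - Z \<omega>)) \<partial>M)"

lemma gauss_le_1: "gauss (x::'b) \<le> 1"
  unfolding gauss_def
proof (intro prod_le_1 conjI)
  fix b :: 'b
  have "1 / sqrt (2 * pi) \<le> 1"
    using pi_ge_two by (simp add: field_simps)
  then have "1 / sqrt (2 * pi) * exp (- ((x \<bullet> b)\<^sup>2) / 2) \<le> 1 * 1"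
    by (intro mult_mono) auto
  then show "std_normal_density (x \<bullet> b) \<le> 1"
    by (simp add: std_normal_density_def)
qed auto

lemma smoothed_eq:
  "complex_of_real (smoothed n x) = (\<integral>\<xi>. cis (- (x \<bullet> \<xi>)) * \<phi> \<xi> *
      complex_of_real (exp (- (1 / Suc n * norm \<xi>)\<^sup>2 / 2)) \<partial>lborel) / (2 * pi) ^ DIM('b)"
  by (subst integral_char_gauss) (simp_all add: smoothed_def field_simps del: of_nat_Suc)

lemma smoothed_nonneg: "0 \<le> smoothed n x"
  by (simp add: smoothed_def gauss_nonneg integral_nonneg)

lemma \<phi>_measurable [measurable]: "\<phi> \<in> borel_measurable borel"
  using int_\<phi> by (simp add: borel_measurable_integrable)

lemma smoothed_tendsto: "(\<lambda>n. smoothed n x) \<longlonglongrightarrow> inversion x"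
proof -
  have "(\<lambda>n. \<integral>\<xi>. cis (- (x \<bullet> \<xi>)) * \<phi> \<xi> *
      complex_of_real (exp (- (1 / Suc n * norm \<xi>)\<^sup>2 / 2)) \<partial>lborel)
      \<longlonglongrightarrow> (\<integral>\<xi>. cis (- (x \<bullet> \<xi>)) * \<phi> \<xi> \<partial>lborel)"
  proof (rule integral_dominated_convergence[where w = "\<lambda>\<xi>. norm (\<phi> \<xi>)"])
    show "AE \<xi> in lborel. (\<lambda>n. cis (- (x \<bullet> \<xi>)) * \<phi> \<xi> * complex_of_real (exp (- (1 / Suc n * norm \<xi>)\<^sup>2 / 2)))
        \<longlonglongrightarrow> cis (- (x \<bullet> \<xi>)) * \<phi> \<xi>"
    proof (rule AE_I2)
      fix \<xi> :: 'b
      have "(\<lambda>n. 1 / real (Suc n)) \<longlonglongrightarrow> 0"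
        by (rule LIMSEQ_Suc[OF lim_const_over_n])
      then have "(\<lambda>n. cis (- (x \<bullet> \<xi>)) * \<phi> \<xi> * complex_of_real (exp (- (1 / Suc n * norm \<xi>)\<^sup>2 / 2)))
        \<longlonglongrightarrow> cis (- (x \<bullet> \<xi>)) * \<phi> \<xi> * complex_of_real (exp (- (0 * norm \<xi>)\<^sup>2 / 2))"
        by (intro tendsto_intros) auto
      then show "(\<lambda>n. cis (- (x \<bullet> \<xi>)) * \<phi> \<xi> * complex_of_real (exp (- (1 / Suc n * norm \<xi>)\<^sup>2 / 2)))
        \<longlonglongrightarrow> cis (- (x \<bullet> \<xi>)) * \<phi> \<xi>"
        by simp
    qed
    show "AE \<xi> in lborel. norm (cis (- (x \<bullet> \<xi>)) * \<phi> \<xi> * complex_of_real (exp (- (1 / Suc n * norm \<xi>)\<^sup>2 / 2)))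
        \<le> norm (\<phi> \<xi>)" for n
      by (auto simp: norm_mult intro!: mult_left_le)
  qed (use int_\<phi> in simp_all)
  then have "(\<lambda>n. Re (complex_of_real (smoothed n x))) \<longlonglongrightarrow> inversion x"
    unfolding smoothed_eq fourier_inversion_def by (intro tendsto_intros) auto
  then show ?thesis
    by simp
qed

text \<open>Positivity is not visible in the Fourier integral; it is inherited from the smoothed
  densities.\<close>

lemma inversion_nonneg: "0 \<le> inversion x"
  by (rule LIMSEQ_le_const[OF smoothed_tendsto]) (use smoothed_nonneg in blast)

definition inversion_bound :: real where
  "inversion_bound = (\<integral>\<xi>. norm (\<phi> \<xi>) \<partial>lborel) / (2 * pi) ^ DIM('b)"

lemma smoothed_le: "smoothed n x \<le> inversion_bound"
proof -
  have "norm (complex_of_real (smoothed n x)) \<le> (\<integral>\<xi>. norm (\<phi> \<xi>) \<partial>lborel) / (2 * pi) ^ DIM('b)"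
    unfolding smoothed_eq norm_divide
  proof (rule frac_le)
    show "norm (\<integral>\<xi>. cis (- (x \<bullet> \<xi>)) * \<phi> \<xi> * complex_of_real (exp (- (1 / Suc n * norm \<xi>)\<^sup>2 / 2)) \<partial>lborel)
      \<le> (\<integral>\<xi>. norm (\<phi> \<xi>) \<partial>lborel)"
      by (rule order_trans[OF integral_norm_bound integral_mono'])
        (use int_\<phi> in \<open>auto simp: norm_mult intro!: mult_left_le\<close>)
  qed (auto simp: norm_power norm_mult)
  then show ?thesis
    by (simp add: inversion_bound_def)
qed

lemma smoothed_measurable [measurable]: "smoothed n \<in> borel_measurable borel"
  unfolding smoothed_def by measurable

lemma inversion_measurable [measurable]: "inversion \<in> borel_measurable borel"
  using smoothed_tendsto by (rule borel_measurable_LIMSEQ_real) simp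

lemma inversion_le: "inversion x \<le> inversion_bound"
  by (rule LIMSEQ_le_const2[OF smoothed_tendsto]) (use smoothed_le in blast)

text \<open>Both sides are the expectation of \<open>f (Z + N / Suc n)\<close> for an independent
  standard normal \<open>N\<close>: substituting \<open>x = Z \<omega> + w / Suc n\<close> makes the
  Jacobian cancel the normalising power of \<open>Suc n\<close>.\<close>

lemma nn_integral_smoothed:
  fixes f :: "'b \<Rightarrow> ennreal"
  assumes [measurable]: "f \<in> borel_measurable borel"
  shows "(\<integral>\<^sup>+x. f x * smoothed n x \<partial>lborel)
     = (\<integral>\<^sup>+\<omega>. \<integral>\<^sup>+w. f (Z \<omega> + (1 / Suc n) *\<^sub>R w) * gauss w \<partial>lborel \<partial>M)"
proof -
  interpret P: pair_sigma_finite lborel M ..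
  let ?c = "real (Suc n) ^ DIM('b)"
  have c: "ennreal ((1 / Suc n) ^ DIM('b)) * ennreal ?c = 1"
    by (subst ennreal_mult[symmetric]) (auto simp: power_divide simp del: of_nat_Suc)
  have 1: "ennreal (smoothed n x) = (\<integral>\<^sup>+\<omega>. ?c * ennreal (gauss (Suc n *\<^sub>R (x - Z \<omega>))) \<partial>M)" for x
  proof -
    have "integrable M (\<lambda>\<omega>. gauss (Suc n *\<^sub>R (x - Z \<omega>)))"
      by (rule integrable_const_bound[of _ 1]) (auto simp: gauss_nonneg gauss_le_1)
    then show ?thesis
      by (simp add: smoothed_def nn_integral_cmult nn_integral_eq_integral gauss_nonneg ennreal_mult
        integral_nonneg del: of_nat_Suc)
  qed
  have "(\<integral>\<^sup>+x. f x * smoothed n x \<partial>lborel)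
      = (\<integral>\<^sup>+x. \<integral>\<^sup>+\<omega>. f x * (?c * ennreal (gauss (Suc n *\<^sub>R (x - Z \<omega>)))) \<partial>M \<partial>lborel)"
    unfolding 1 by (intro nn_integral_cong nn_integral_cmult[symmetric]) measurable
  also have "\<dots> = (\<integral>\<^sup>+\<omega>. \<integral>\<^sup>+x. f x * (?c * ennreal (gauss (Suc n *\<^sub>R (x - Z \<omega>)))) \<partial>lborel \<partial>M)"
    by (rule P.Fubini'[symmetric]) measurable
  also have "\<dots> = (\<integral>\<^sup>+\<omega>. \<integral>\<^sup>+w. f (Z \<omega> + (1 / Suc n) *\<^sub>R w) * gauss w \<partial>lborel \<partial>M)"
  proof (rule nn_integral_cong)
    fix \<omega>
    have "(\<integral>\<^sup>+x. f x * (?c * ennreal (gauss (Suc n *\<^sub>R (x - Z \<omega>)))) \<partial>lborel)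
      = ennreal ((1 / Suc n) ^ DIM('b)) * (\<integral>\<^sup>+w. f (Z \<omega> + (1 / Suc n) *\<^sub>R w) * (?c * ennreal (gauss w)) \<partial>lborel)"
      by (subst nn_integral_lborel_scale[where c = "1 / Suc n" and t = "Z \<omega>"]) (auto simp del: of_nat_Suc)
    also have "(\<integral>\<^sup>+w. f (Z \<omega> + (1 / Suc n) *\<^sub>R w) * (?c * ennreal (gauss w)) \<partial>lborel)
      = ?c * (\<integral>\<^sup>+w. f (Z \<omega> + (1 / Suc n) *\<^sub>R w) * gauss w \<partial>lborel)"
      by (subst nn_integral_cmult[symmetric]) (auto simp: mult_ac)
    finally show "(\<integral>\<^sup>+x. f x * (?c * ennreal (gauss (Suc n *\<^sub>R (x - Z \<omega>)))) \<partial>lborel)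
      = (\<integral>\<^sup>+w. f (Z \<omega> + (1 / Suc n) *\<^sub>R w) * gauss w \<partial>lborel)"
      by (simp only: mult.assoc[symmetric] c mult_1)
  qed
  finally show ?thesis .
qed

text \<open>The two sides of \<open>nn_integral_smoothed\<close> pass to the limit separately, the
  left one by convergence of the densities and the right one by continuity of \<open>f\<close>.
  Boundedness of \<open>U\<close> turns the constant \<open>inversion_bound\<close> into an
  integrable majorant for the former.\<close>

lemma nn_integral_inversion_bounded_support:
  fixes f :: "'b \<Rightarrow> real"
  assumes f: "continuous_on UNIV f" "\<And>x. 0 \<le> f x" "\<And>x. f x \<le> 1"
    and U: "bounded U" "U \<in> sets borel" "\<And>x. x \<notin> U \<Longrightarrow> f x = 0"
  shows "(\<integral>\<^sup>+\<omega>. f (Z \<omega>) \<partial>M) = (\<integral>\<^sup>+x. f x * inversion x \<partial>lborel)"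
proof -
  have [measurable]: "f \<in> borel_measurable borel" "U \<in> sets borel"
    using f(1) U by (auto intro: borel_measurable_continuous_onI)
  have fin: "emeasure lborel U < \<infinity>"
    using U(1) by (rule emeasure_bounded_finite)
  have 1: "(\<lambda>n. \<integral>\<^sup>+x. ennreal (f x) * smoothed n x \<partial>lborel) \<longlonglongrightarrow> (\<integral>\<^sup>+x. ennreal (f x) * inversion x \<partial>lborel)"
  proof (rule nn_integral_dominated_convergence[where w = "\<lambda>x. ennreal inversion_bound * indicator U x"])
    show "AE x in lborel. ennreal (f x) * smoothed n x \<le> ennreal inversion_bound * indicator U x" for n
    proof (rule AE_I2)
      fix x
      show "ennreal (f x) * smoothed n x \<le> ennreal inversion_bound * indicator U x"
      proof (cases "x \<in> U")
        case True
        have "f x * smoothed n x \<le> 1 * inversion_bound"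
          using f smoothed_le smoothed_nonneg by (intro mult_mono) auto
        then show ?thesis
          using True f by (simp add: ennreal_mult[symmetric] smoothed_nonneg ennreal_leI)
      next
        case False
        then show ?thesis
          by (simp add: U(3))
      qed
    qed
    show "(\<integral>\<^sup>+x. ennreal inversion_bound * indicator U x \<partial>lborel) < \<infinity>"
      using fin by (simp add: nn_integral_cmult ennreal_mult_less_top)
    show "AE x in lborel. (\<lambda>n. ennreal (f x) * smoothed n x) \<longlonglongrightarrow> ennreal (f x) * inversion x"
      using f smoothed_nonneg inversion_nonneg smoothed_tendsto
      by (auto simp: ennreal_mult[symmetric] intro!: tendsto_ennrealI tendsto_mult)
  qed measurable
  have 2: "(\<lambda>n. \<integral>\<^sup>+\<omega>. \<integral>\<^sup>+w. ennreal (f (Z \<omega> + (1 / Suc n) *\<^sub>R w)) * gauss w \<partial>lborel \<partial>M)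
      \<longlonglongrightarrow> (\<integral>\<^sup>+\<omega>. ennreal (f (Z \<omega>)) \<partial>M)"
  proof (rule nn_integral_dominated_convergence[where w = "\<lambda>_. 1"])
    have bd: "ennreal (f y) * gauss w \<le> gauss w" for y w :: 'b
      using f gauss_nonneg[of w] by (simp add: ennreal_mult[symmetric] ennreal_leI mult_left_le_one_le)
    show "AE \<omega> in M. (\<integral>\<^sup>+w. ennreal (f (Z \<omega> + (1 / Suc n) *\<^sub>R w)) * gauss w \<partial>lborel) \<le> 1" for n
      by (intro AE_I2 order_trans[OF nn_integral_mono[OF bd]]) (simp add: nn_integral_gauss)
    show "AE \<omega> in M. (\<lambda>n. \<integral>\<^sup>+w. ennreal (f (Z \<omega> + (1 / Suc n) *\<^sub>R w)) * gauss w \<partial>lborel) \<longlonglongrightarrow> ennreal (f (Z \<omega>))"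
    proof (rule AE_I2)
      fix \<omega>
      have "(\<lambda>n. \<integral>\<^sup>+w. ennreal (f (Z \<omega> + (1 / Suc n) *\<^sub>R w)) * gauss w \<partial>lborel)
        \<longlonglongrightarrow> (\<integral>\<^sup>+w. ennreal (f (Z \<omega>)) * gauss w \<partial>(lborel :: 'b measure))"
      proof (rule nn_integral_dominated_convergence[where w = "\<lambda>w. gauss w"])
        show "AE w in lborel. (\<lambda>n. ennreal (f (Z \<omega> + (1 / Suc n) *\<^sub>R w)) * gauss w) \<longlonglongrightarrow> ennreal (f (Z \<omega>)) * gauss w"
        proof (rule AE_I2)
          fix w :: 'b
          have "(\<lambda>n. 1 / real (Suc n)) \<longlonglongrightarrow> 0"
            by (rule LIMSEQ_Suc[OF lim_const_over_n])
          then have "(\<lambda>n. Z \<omega> + (1 / Suc n) *\<^sub>R w) \<longlonglongrightarrow> Z \<omega> + 0 *\<^sub>R w"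
            by (intro tendsto_intros)
          then have "(\<lambda>n. f (Z \<omega> + (1 / Suc n) *\<^sub>R w)) \<longlonglongrightarrow> f (Z \<omega> + 0 *\<^sub>R w)"
            using f(1) by (intro continuous_on_tendsto_compose[of UNIV f]) auto
          then show "(\<lambda>n. ennreal (f (Z \<omega> + (1 / Suc n) *\<^sub>R w)) * gauss w) \<longlonglongrightarrow> ennreal (f (Z \<omega>)) * gauss w"
            using f gauss_nonneg[of w]
            by (auto simp: ennreal_mult[symmetric] intro!: tendsto_ennrealI tendsto_mult)
        qed
      qed (use bd in \<open>auto simp: nn_integral_gauss\<close>)
      then show "(\<lambda>n. \<integral>\<^sup>+w. ennreal (f (Z \<omega> + (1 / Suc n) *\<^sub>R w)) * gauss w \<partial>lborel) \<longlonglongrightarrow> ennreal (f (Z \<omega>))"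
        by (simp add: nn_integral_cmult nn_integral_gauss)
    qed
    show "(\<integral>\<^sup>+\<omega>. 1 \<partial>M) < \<infinity>"
      by (simp add: emeasure_space_1)
  qed measurable
  have "(\<integral>\<^sup>+\<omega>. ennreal (f (Z \<omega>)) \<partial>M) = (\<integral>\<^sup>+x. ennreal (f x) * inversion x \<partial>lborel)"
    using 2 by (intro LIMSEQ_unique[OF _ 1]) (simp add: nn_integral_smoothed)
  also have "\<dots> = (\<integral>\<^sup>+x. f x * inversion x \<partial>lborel)"
    using f inversion_nonneg by (simp add: ennreal_mult)
  finally show ?thesis .
qed

text \<open>Open boxes form an intersection-stable generator, and each is bounded, so its indicator
  is a limit of continuous functions to which the preceding lemma applies.\<close>

theorem distr_eq_density_inversion: "distr M borel Z = density lborel inversion"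
proof (rule measure_eqI_generator_eq)
  let ?E = "range (\<lambda>(a, b). box a b :: 'b set)"
  show "Int_stable ?E"
    by (auto simp: Int_stable_def box_Int_box)
  show "?E \<subseteq> Pow UNIV" "sets (distr M borel Z) = sigma_sets UNIV ?E"
      "sets (density lborel inversion) = sigma_sets UNIV ?E"
    by (simp_all add: borel_eq_box)
  let ?A = "\<lambda>n::nat. box (- (real n *\<^sub>R One)) (real n *\<^sub>R One) :: 'b set"
  show "range ?A \<subseteq> ?E" "(\<Union>i. ?A i) = UNIV"
    unfolding UN_box_eq_UNIV by auto
  show "emeasure (distr M borel Z) (?A i) \<noteq> \<infinity>" for i
    using emeasure_distr[OF Z, of "?A i"] by simp
  show "emeasure (distr M borel Z) U = emeasure (density lborel inversion) U" if U_in: "U \<in> ?E" for U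
  proof -
    obtain a b where U_eq: "U = box a b"
      using U_in by auto
    have U: "open U" "bounded U"
      by (auto simp: U_eq)
    \<comment> \<open>\<open>infdist\<close> to the empty set is 0 by convention, so the functions
      \<open>f k\<close> below call for a nonempty complement.\<close>
    have ne: "- U \<noteq> {}"
      using U(2) not_bounded_UNIV by (metis Compl_empty_eq double_compl)
    have [measurable]: "U \<in> sets borel"
      using U by simp
    \<comment> \<open>\<open>infdist x (- U)\<close> is positive exactly on the open set
      \<open>U\<close>, so at each point of \<open>U\<close> the value of \<open>f k\<close> is 1
      once \<open>k\<close> is large, while it is 0 outside.\<close>
    define f where "f k x = min 1 (real k * infdist x (- U))" for k x
    have f: "continuous_on UNIV (f k)" "\<And>x. 0 \<le> f k x" "\<And>x. f k x \<le> 1" "\<And>x. x \<notin> U \<Longrightarrow> f k x = 0" for k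
      by (auto simp: f_def infdist_nonneg intro!: continuous_intros)
    have [measurable]: "f k \<in> borel_measurable borel" for k
      using f(1) by (rule borel_measurable_continuous_onI)
    have lim: "(\<lambda>k. f k x) \<longlonglongrightarrow> indicator U x" for x
    proof (cases "x \<in> U")
      case True
      have "infdist x (- U) \<noteq> 0"
        using in_closed_iff_infdist_zero[of "- U" x] ne U True by (auto simp: closed_Compl)
      then have pos: "0 < infdist x (- U)"
        using infdist_nonneg[of x "- U"] by simp
      obtain N :: nat where N: "1 / infdist x (- U) < N"
        using reals_Archimedean2 by blast
      have "f k x = 1" if "N \<le> k" for k
      proof -
        have "1 < real N * infdist x (- U)"
          using N pos by (simp add: field_simps)
        also have "\<dots> \<le> real k * infdist x (- U)"
          using that pos by (intro mult_right_mono) auto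
        finally show ?thesis
          by (simp add: f_def)
      qed
      then show ?thesis
        using True by (intro tendsto_eventually) (auto simp: eventually_sequentially)
    qed (simp add: f)
    have ind: "f k x \<le> indicator U x" for k x
      using f by (auto split: split_indicator)
    have 1: "(\<lambda>k. \<integral>\<^sup>+\<omega>. ennreal (f k (Z \<omega>)) \<partial>M) \<longlonglongrightarrow> (\<integral>\<^sup>+\<omega>. ennreal (indicator U (Z \<omega>)) \<partial>M)"
      by (rule nn_integral_dominated_convergence[where w = "\<lambda>_. 1"])
        (use f lim in \<open>auto simp: emeasure_space_1 intro!: tendsto_ennrealI\<close>)
    have 2: "(\<lambda>k. \<integral>\<^sup>+x. ennreal (f k x * inversion x) \<partial>lborel)
      \<longlonglongrightarrow> (\<integral>\<^sup>+x. ennreal (indicator U x * inversion x) \<partial>lborel)"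
    proof (rule nn_integral_dominated_convergence[where w = "\<lambda>x. ennreal (inversion_bound) * indicator U x"])
      show "AE x in lborel. ennreal (f k x * inversion x) \<le> ennreal inversion_bound * indicator U x" for k
      proof (rule AE_I2)
        fix x
        have "f k x * inversion x \<le> 1 * inversion_bound"
          using f inversion_le inversion_nonneg by (intro mult_mono) auto
        then show "ennreal (f k x * inversion x) \<le> ennreal inversion_bound * indicator U x"
          using f by (auto split: split_indicator intro: ennreal_leI)
      qed
      show "(\<integral>\<^sup>+x. ennreal inversion_bound * indicator U x \<partial>lborel) < \<infinity>"
        using emeasure_bounded_finite[OF U(2)] by (simp add: nn_integral_cmult ennreal_mult_less_top)
      show "AE x in lborel. (\<lambda>k. ennreal (f k x * inversion x)) \<longlonglongrightarrow> ennreal (indicator U x * inversion x)"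
        using lim by (auto intro!: tendsto_ennrealI tendsto_mult)
    qed measurable
    have "(\<integral>\<^sup>+\<omega>. ennreal (indicator U (Z \<omega>)) \<partial>M) = (\<integral>\<^sup>+x. ennreal (indicator U x * inversion x) \<partial>lborel)"
      using nn_integral_inversion_bounded_support[OF f(1,2,3) U(2) _ f(4)] 1
      by (intro LIMSEQ_unique[OF _ 2]) simp
    moreover have "emeasure (distr M borel Z) U = (\<integral>\<^sup>+\<omega>. ennreal (indicator U (Z \<omega>)) \<partial>M)"
    proof -
      have "emeasure (distr M borel Z) U = (\<integral>\<^sup>+z. indicator U z \<partial>distr M borel Z)"
        by simp
      also have "\<dots> = (\<integral>\<^sup>+\<omega>. indicator U (Z \<omega>) \<partial>M)"
        by (rule nn_integral_distr) auto
      finally show ?thesis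
        by (simp add: ennreal_indicator)
    qed
    moreover have "emeasure (density lborel inversion) U = (\<integral>\<^sup>+x. ennreal (indicator U x * inversion x) \<partial>lborel)"
      by (simp add: emeasure_density ennreal_mult ennreal_indicator mult.commute inversion_nonneg)
    ultimately show ?thesis
      by simp
  qed
qed

end

end

section \<open>Shot-down paths and polylines\<close>

text \<open>An open neighbourhood of \<open>- D\<close> stands in for \<open>- D\<close> itself: the
  condition is then open in \<open>(v, w)\<close>, hence measurable, and it holds for every segment
  close enough to one that touches \<open>- D\<close>.\<close>

definition polyline_near :: "'a::euclidean_space set \<Rightarrow> real \<Rightarrow> 'a \<Rightarrow> 'a \<Rightarrow> bool" where
  "polyline_near D \<epsilon> v w \<longleftrightarrow> closed_segment v w \<inter> (\<Union>c\<in>-D. ball c \<epsilon>) \<noteq> {}"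

text \<open>The left limit at \<open>a\<close> itself is left out, as the path on \<open>[a, b]\<close> does not determine it.\<close>

definition hits :: "'a::euclidean_space set \<Rightarrow> (real \<Rightarrow> 'a) \<Rightarrow> real \<Rightarrow> real \<Rightarrow> bool" where
  "hits D f a b \<longleftrightarrow> f a \<notin> D \<or> (\<exists>s\<in>{a<..b}. closed_segment (left_limit f s) (f s) \<inter> - D \<noteq> {})"

lemma polyline_near_commute: "polyline_near D \<epsilon> v w \<longleftrightarrow> polyline_near D \<epsilon> w v"
  by (simp add: polyline_near_def closed_segment_commute)

lemma polyline_near_iff:
  "polyline_near D \<epsilon> v w \<longleftrightarrow> (\<exists>u\<in>{0..1}. (1 - u) *\<^sub>R v + u *\<^sub>R w \<in> (\<Union>c\<in>-D. ball c \<epsilon>))"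
proof -
  have "f ` A \<inter> U \<noteq> {} \<longleftrightarrow> (\<exists>u\<in>A. f u \<in> U)" for f :: "real \<Rightarrow> 'a" and A U
    by blast
  then show ?thesis
    unfolding polyline_near_def closed_segment_image_interval .
qed

lemma polyline_near_mono:
  assumes "polyline_near D \<epsilon> v w" "\<epsilon> \<le> \<epsilon>'"
  shows "polyline_near D \<epsilon>' v w"
proof -
  have "(\<Union>c\<in>-D. ball c \<epsilon>) \<subseteq> (\<Union>c\<in>-D. ball c \<epsilon>')"
    using assms(2) by (intro UN_mono subset_ball order_refl)
  then show ?thesis
    using assms(1) unfolding polyline_near_def by fast
qed

lemma polyline_near_measurable [measurable]:
  "Measurable.pred (borel \<Otimes>\<^sub>M borel) (\<lambda>(v, w). polyline_near D \<epsilon> v w)"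
proof -
  have "open (\<Union>u\<in>{0..1}. (\<lambda>z. (1 - u) *\<^sub>R fst z + u *\<^sub>R snd z) -` (\<Union>c\<in>-D. ball c \<epsilon>))"
    by (intro open_UN ballI open_vimage open_ball continuous_intros)
  also have "(\<Union>u\<in>{0..1}. (\<lambda>z. (1 - u) *\<^sub>R fst z + u *\<^sub>R snd z) -` (\<Union>c\<in>-D. ball c \<epsilon>))
      = {z. case z of (v, w) \<Rightarrow> polyline_near D \<epsilon> v w}"
    by (intro set_eqI) (simp only: UN_iff vimage_eq mem_Collect_eq case_prod_unfold polyline_near_iff)
  finally have "{z. case z of (v, w) \<Rightarrow> polyline_near D \<epsilon> v w} \<in> sets borel"
    by (rule borel_open)
  then show ?thesis
    unfolding borel_prod
    by (intro pred_def[THEN iffD2]) (simp only: space_borel UNIV_I simp_thms)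
qed

text \<open>The point \<open>f a\<close> is an end point of the jump segment at \<open>a\<close>. A
  start outside \<open>D\<close> is therefore a hit at time \<open>a\<close> in every window that
  begins earlier.\<close>

lemma hits_mono:
  assumes "hits D f a b" "a' \<le> a" "a \<le> b" "b \<le> b'"
  shows "hits D f a' b'"
proof (cases "f a \<in> D")
  case True
  then obtain s where "s \<in> {a<..b}" "closed_segment (left_limit f s) (f s) \<inter> - D \<noteq> {}"
    using assms(1) unfolding hits_def by blast
  then show ?thesis
    using assms unfolding hits_def by (intro disjI2 bexI[of _ s]) auto
next
  case False
  then have fa: "closed_segment (left_limit f a) (f a) \<inter> - D \<noteq> {}"
    by auto
  show ?thesis
  proof (cases "a' = a")
    case True
    with False show ?thesis
      by (simp add: hits_def)
  next
    case neq: False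
    then show ?thesis
      using assms fa unfolding hits_def by (intro disjI2 bexI[of _ a]) auto
  qed
qed

text \<open>Windows start after 0, as only positive times count for the shot-down time. The strict
  inequality leaves room: a shot at \<open>s < b\<close> is seen by the window from
  \<open>s / 2\<close> to \<open>s\<close>.\<close>

lemma shot_down_time_less_iff:
  "shot_down_time D f < ereal b \<longleftrightarrow> (\<exists>a c. 0 < a \<and> a < c \<and> c < b \<and> hits D f a c)"
proof
  assume "shot_down_time D f < ereal b"
  then obtain s where "0 < s" "s < b" "closed_segment (left_limit f s) (f s) \<inter> - D \<noteq> {}"
    unfolding shot_down_time_def Inf_less_iff by auto
  then show "\<exists>a c. 0 < a \<and> a < c \<and> c < b \<and> hits D f a c"
    by (intro exI[of _ "s / 2"] exI[of _ s]) (auto simp: hits_def)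
next
  assume "\<exists>a c. 0 < a \<and> a < c \<and> c < b \<and> hits D f a c"
  then obtain a c where ac: "0 < a" "a < c" "c < b" "hits D f a c"
    by auto
  have "\<exists>s>0. s < b \<and> closed_segment (left_limit f s) (f s) \<inter> - D \<noteq> {}"
  proof (cases "f a \<in> D")
    case True
    then obtain s where "s \<in> {a<..c}" "closed_segment (left_limit f s) (f s) \<inter> - D \<noteq> {}"
      using ac(4) unfolding hits_def by blast
    then show ?thesis
      using ac by (intro exI[of _ s]) auto
  next
    case False
    then show ?thesis
      using ac by (intro exI[of _ a]) auto
  qed
  then show "shot_down_time D f < ereal b"
    unfolding shot_down_time_def Inf_less_iff by auto
qed

lemma shot_down_time_nonneg: "0 \<le> shot_down_time D f"
  unfolding shot_down_time_def by (rule Inf_greatest) auto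

text \<open>Every window strictly between 0 and \<open>b\<close> fits into one of these, and
  enlarging preserves hits; the gain is countability. The summand 3 keeps each start before its end,
  as \<open>b / 3 < b - b / 3\<close>.\<close>

lemma shot_down_time_less_iff_seq:
  assumes "0 < b"
  shows "shot_down_time D f < ereal b \<longleftrightarrow> (\<exists>m::nat. hits D f (b / (real m + 3)) (b - b / (real m + 3)))"
proof
  assume "shot_down_time D f < ereal b"
  then obtain a c where ac: "0 < a" "a < c" "c < b" "hits D f a c"
    unfolding shot_down_time_less_iff by auto
  \<comment> \<open>\<open>e\<close> is the room left on both sides of the window.\<close>
  obtain e where e: "0 < e" "e \<le> a" "e \<le> b - c"
    using ac by (intro that[of "min a (b - c)"]) auto
  obtain m :: nat where m: "b / e < real m"
    using reals_Archimedean2 by blast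
  have "b < real m * e"
    using m e by (simp add: field_simps)
  also have "\<dots> \<le> e * (real m + 3)"
    using e by (simp add: algebra_simps)
  finally have "b / (real m + 3) \<le> e"
    by (simp add: pos_divide_le_eq)
  then show "\<exists>m::nat. hits D f (b / (real m + 3)) (b - b / (real m + 3))"
    using ac e by (intro exI[of _ m] hits_mono[OF ac(4)]) auto
next
  assume "\<exists>m::nat. hits D f (b / (real m + 3)) (b - b / (real m + 3))"
  then obtain m :: nat where m: "hits D f (b / (real m + 3)) (b - b / (real m + 3))"
    by auto
  have "b / (real m + 3) \<le> b / 3"
    using assms by (intro divide_left_mono) auto
  then have "b / (real m + 3) < b - b / (real m + 3)"
    using assms by simp
  then show "shot_down_time D f < ereal b"
    using m assms unfolding shot_down_time_less_iff
    by (intro exI[of _ "b / (real m + 3)"] exI[of _ "b - b / (real m + 3)"]) auto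
qed

section \<open>Cadlag paths along equidistant grids\<close>

lemma cadlag_at_right: "cadlag f \<Longrightarrow> 0 \<le> t \<Longrightarrow> (f \<longlongrightarrow> f t) (at_right t)"
  by (auto simp: cadlag_def continuous_within)

lemma cadlag_left_limit: "cadlag f \<Longrightarrow> 0 < t \<Longrightarrow> (f \<longlongrightarrow> left_limit f t) (at_left t)"
  by (auto simp: cadlag_def left_limit_def tendsto_Lim)

text \<open>With \<open>Suc n\<close> steps the mesh makes sense for \<open>n = 0\<close> too; the
  grid points are those with index up to \<open>Suc n\<close>.\<close>

definition grid :: "real \<Rightarrow> real \<Rightarrow> nat \<Rightarrow> nat \<Rightarrow> real" where
  "grid a b n i = a + i * ((b - a) / Suc n)"

lemma grid_0 [simp]: "grid a b n 0 = a"
  by (simp add: grid_def)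

lemma grid_last [simp]: "grid a b n (Suc n) = b"
  by (simp add: grid_def del: of_nat_Suc)

lemma grid_Suc: "grid a b n (Suc i) = grid a b n i + (b - a) / Suc n"
  unfolding grid_def of_nat_Suc[of i] by (simp only: distrib_right mult_1 add_ac)

lemma grid_mono: "a \<le> b \<Longrightarrow> i \<le> j \<Longrightarrow> grid a b n i \<le> grid a b n j"
  unfolding grid_def by (intro add_left_mono mult_right_mono) auto

lemma grid_bounds: "a \<le> b \<Longrightarrow> i \<le> Suc n \<Longrightarrow> a \<le> grid a b n i \<and> grid a b n i \<le> b"
  using grid_mono[of a b 0 i n] grid_mono[of a b i "Suc n" n] by simp

lemma cadlag_seq_left:
  assumes "cadlag f" "0 < s" "r \<longlonglongrightarrow> s" "\<And>n. r n < s"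
  shows "(\<lambda>n. f (r n)) \<longlonglongrightarrow> left_limit f s"
  by (rule filterlim_compose[OF cadlag_left_limit[OF assms(1,2)]])
    (use assms in \<open>auto simp: filterlim_at less_imp_neq\<close>)

lemma cadlag_seq_right:
  assumes "cadlag f" "0 \<le> s" "r \<longlonglongrightarrow> s" "\<And>n. s \<le> r n"
  shows "(\<lambda>n. f (r n)) \<longlonglongrightarrow> f s"
proof -
  have "(f \<longlongrightarrow> f s) (at s within {s..})"
    using cadlag_at_right[OF assms(1,2)] by (simp add: at_within_Ici_at_right)
  then have "continuous (at s within {s..}) f"
    by (simp add: continuous_within)
  then show ?thesis
    unfolding continuous_within_sequentially comp_def using assms(3,4) by auto
qed

text \<open>Either infinitely many terms lie strictly before \<open>s\<close>, and along these the
  values tend to the left limit, or almost all lie at or after \<open>s\<close>, where right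
  continuity applies.\<close>

lemma cadlag_seq_cluster:
  assumes f: "cadlag f" and s: "0 < s" and r: "r \<longlonglongrightarrow> s"
  shows "\<exists>\<rho> v. strict_mono \<rho> \<and> v \<in> {left_limit f s, f s} \<and> (\<lambda>n. f (r (\<rho> n))) \<longlonglongrightarrow> v"
proof (cases "\<exists>\<^sub>F n in sequentially. r n < s")
  case True
  then have "infinite {n. r n < s}"
    by (simp add: frequently_cofinite[symmetric] cofinite_eq_sequentially)
  then obtain \<rho> :: "nat \<Rightarrow> nat" where \<rho>: "strict_mono \<rho>" "\<And>n. r (\<rho> n) < s"
    using infinite_enumerate[of "{n. r n < s}"] by auto
  have "(\<lambda>n. r (\<rho> n)) \<longlonglongrightarrow> s"
    using LIMSEQ_subseq_LIMSEQ[OF r \<rho>(1)] by (simp add: comp_def)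
  from cadlag_seq_left[OF f s this \<rho>(2)] \<rho>(1) show ?thesis
    by blast
next
  case False
  then obtain N where N: "\<And>n. n \<ge> N \<Longrightarrow> s \<le> r n"
    by (auto simp: frequently_def eventually_sequentially not_less)
  have "(\<lambda>n. f (r (n + N))) \<longlonglongrightarrow> f s"
    by (rule cadlag_seq_right[OF f]) (use s N LIMSEQ_ignore_initial_segment[OF r] in auto)
  then show ?thesis
    by (intro exI[of _ "\<lambda>n. n + N"] exI[of _ "f s"]) (auto simp: strict_mono_def)
qed

text \<open>Limits of polyline segments with both end points tending to \<open>s\<close> lie on the jump segment
  at \<open>s\<close>: each end point clusters at \<open>f s\<close> or at the left limit.\<close>

lemma eventually_not_polyline_near:
  assumes f: "cadlag f" and D: "open D" and ab: "0 < a" "a < b" and nh: "\<not> hits D f a b"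
  shows "\<exists>k. \<forall>\<^sub>F n in sequentially. \<forall>i\<le>n.
    \<not> polyline_near D (1 / Suc k) (f (grid a b n i)) (f (grid a b n (Suc i)))"
proof (rule ccontr)
  assume "\<not> ?thesis"
  then have fr: "\<exists>n\<ge>N. \<exists>i\<le>n. polyline_near D (1 / Suc k) (f (grid a b n i)) (f (grid a b n (Suc i)))" for k N
    by (auto simp: eventually_sequentially)
  \<comment> \<open>Taking \<open>n \<ge> k\<close> makes the mesh tend to 0 together with the
    width.\<close>
  have "\<forall>k. \<exists>n i u c. n \<ge> k \<and> i \<le> n \<and> u \<in> {0..1} \<and> c \<in> -D \<and>
     dist c ((1 - u) *\<^sub>R f (grid a b n i) + u *\<^sub>R f (grid a b n (Suc i))) < 1 / Suc k"
  proof
    fix k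
    obtain n i where 1: "n \<ge> k" "i \<le> n" "polyline_near D (1 / Suc k) (f (grid a b n i)) (f (grid a b n (Suc i)))"
      using fr[of k k] by auto
    then obtain u c where 2: "u \<in> {0..1}" "c \<in> - D"
      "(1 - u) *\<^sub>R f (grid a b n i) + u *\<^sub>R f (grid a b n (Suc i)) \<in> ball c (1 / Suc k)"
      unfolding polyline_near_iff UN_iff by blast
    show "\<exists>n i u c. n \<ge> k \<and> i \<le> n \<and> u \<in> {0..1} \<and> c \<in> -D \<and>
     dist c ((1 - u) *\<^sub>R f (grid a b n i) + u *\<^sub>R f (grid a b n (Suc i))) < 1 / Suc k"
      using 1(1,2) 2 by (intro exI[of _ n] exI[of _ i] exI[of _ u] exI[of _ c]) (simp add: mem_ball)
  qed
  then obtain n i :: "nat \<Rightarrow> nat" and u c where *: "\<forall>k. n k \<ge> k \<and> i k \<le> n k \<and> u k \<in> {0..1::real} \<and> c k \<in> - D \<and>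
     dist (c k) ((1 - u k) *\<^sub>R f (grid a b (n k) (i k)) + u k *\<^sub>R f (grid a b (n k) (Suc (i k)))) < 1 / Suc k"
    unfolding choice_iff by blast
  have n: "n k \<ge> k" and i: "i k \<le> n k" and u: "u k \<in> {0..1::real}" and c: "c k \<in> - D"
    and d: "dist (c k) ((1 - u k) *\<^sub>R f (grid a b (n k) (i k)) + u k *\<^sub>R f (grid a b (n k) (Suc (i k)))) < 1 / Suc k" for k
    using * by blast+
  let ?r = "\<lambda>k. grid a b (n k) (i k)" and ?r' = "\<lambda>k. grid a b (n k) (Suc (i k))"
  have rb: "a \<le> ?r k" "?r k \<le> b" "a \<le> ?r' k" "?r' k \<le> b" for k
    using grid_bounds[of a b "i k" "n k"] grid_bounds[of a b "Suc (i k)" "n k"] i[of k] ab by auto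
  \<comment> \<open>One subsequence makes the grid time and the parameter on its segment converge
    together.\<close>
  have "compact ({a..b} \<times> {0..1::real})"
    by (intro compact_Times) auto
  moreover have "\<forall>k. (?r k, u k) \<in> {a..b} \<times> {0..1}"
    using rb u by auto
  ultimately obtain l \<rho> where l: "l \<in> {a..b} \<times> {0..1::real}" and \<rho>: "strict_mono \<rho>"
    and lim: "((\<lambda>k. (?r k, u k)) \<circ> \<rho>) \<longlonglongrightarrow> l"
    by (rule seq_compactE[OF compact_imp_seq_compact])
  obtain s u0 where lsu: "l = (s, u0)" by (cases l)
  have s: "a \<le> s" "s \<le> b" and u0: "u0 \<in> {0..1}"
    using l lsu by auto
  have r_lim: "(\<lambda>k. ?r (\<rho> k)) \<longlonglongrightarrow> s" and u_lim: "(\<lambda>k. u (\<rho> k)) \<longlonglongrightarrow> u0"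
    using tendsto_fst[OF lim] tendsto_snd[OF lim] lsu by (simp_all add: comp_def)
  have gap: "(\<lambda>k. (b - a) / Suc (n (\<rho> k))) \<longlonglongrightarrow> 0"
  proof (rule tendsto_sandwich[of "\<lambda>_. 0"])
    have "(b - a) / Suc (n (\<rho> k)) \<le> (b - a) / Suc k" for k
      using ab n[of "\<rho> k"] seq_suble[OF \<rho>, of k] by (intro divide_left_mono) auto
    then show "\<forall>\<^sub>F k in sequentially. (b - a) / Suc (n (\<rho> k)) \<le> (b - a) / Suc k"
      by simp
    show "(\<lambda>k. (b - a) / Suc k) \<longlonglongrightarrow> 0"
      by (rule LIMSEQ_Suc[OF lim_const_over_n])
  qed (use ab in auto)
  have r'_lim: "(\<lambda>k. ?r' (\<rho> k)) \<longlonglongrightarrow> s"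
    unfolding grid_Suc using tendsto_add[OF r_lim gap] by simp
  have main: "\<exists>\<rho>' v w. strict_mono \<rho>' \<and> (\<lambda>k. f (?r (\<rho>' k))) \<longlonglongrightarrow> v \<and> (\<lambda>k. f (?r' (\<rho>' k))) \<longlonglongrightarrow> w
      \<and> (\<lambda>k. u (\<rho>' k)) \<longlonglongrightarrow> u0 \<and> closed_segment v w \<subseteq> D"
  proof (cases "s = a")
    \<comment> \<open>Grid points never lie before \<open>a\<close>, so right continuity alone gives
      the limit of both end points.\<close>
    case True
    have "(\<lambda>k. f (?r (\<rho> k))) \<longlonglongrightarrow> f a" "(\<lambda>k. f (?r' (\<rho> k))) \<longlonglongrightarrow> f a"
      using r_lim r'_lim True ab rb by (intro cadlag_seq_right[OF f]; simp)+
    then show ?thesis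
      using \<rho> u_lim nh by (intro exI[of _ \<rho>] exI[of _ "f a"]) (auto simp: hits_def)
  next
    case False
    then have "0 < s" and s': "s \<in> {a<..b}"
      using s ab by auto
    obtain \<rho>1 v where 1: "strict_mono \<rho>1" "v \<in> {left_limit f s, f s}" "(\<lambda>k. f (?r (\<rho> (\<rho>1 k)))) \<longlonglongrightarrow> v"
      using cadlag_seq_cluster[OF f \<open>0 < s\<close> r_lim] by blast
    have "(\<lambda>k. ?r' (\<rho> (\<rho>1 k))) \<longlonglongrightarrow> s"
      using LIMSEQ_subseq_LIMSEQ[OF r'_lim 1(1)] by (simp add: comp_def)
    from cadlag_seq_cluster[OF f \<open>0 < s\<close> this]
    obtain \<rho>2 w where 2: "strict_mono \<rho>2" "w \<in> {left_limit f s, f s}" "(\<lambda>k. f (?r' (\<rho> (\<rho>1 (\<rho>2 k))))) \<longlonglongrightarrow> w"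
      by blast
    have 3: "(\<lambda>k. f (?r (\<rho> (\<rho>1 (\<rho>2 k))))) \<longlonglongrightarrow> v"
      using LIMSEQ_subseq_LIMSEQ[OF 1(3) 2(1)] by (simp add: comp_def)
    have 4: "strict_mono (\<rho>1 \<circ> \<rho>2)"
      using 1(1) 2(1) by (simp add: strict_mono_o)
    have 5: "(\<lambda>k. u (\<rho> (\<rho>1 (\<rho>2 k)))) \<longlonglongrightarrow> u0"
      using LIMSEQ_subseq_LIMSEQ[OF u_lim 4] by (simp add: comp_def)
    have "closed_segment v w \<subseteq> closed_segment (left_limit f s) (f s)"
      using 1(2) 2(2) by (intro closed_segment_subset) auto
    also have "\<dots> \<subseteq> D"
      using nh s' by (auto simp: hits_def)
    finally show ?thesis
      using 2(3) 3 5 strict_mono_o[OF \<rho> 4]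
      by (intro exI[of _ "\<rho> \<circ> (\<rho>1 \<circ> \<rho>2)"] exI[of _ v] exI[of _ w]) (auto simp: comp_def)
  qed
  then obtain \<rho>' v w where \<rho>': "strict_mono \<rho>'" and v: "(\<lambda>k. f (?r (\<rho>' k))) \<longlonglongrightarrow> v"
    and w: "(\<lambda>k. f (?r' (\<rho>' k))) \<longlonglongrightarrow> w" and u': "(\<lambda>k. u (\<rho>' k)) \<longlonglongrightarrow> u0" and sub: "closed_segment v w \<subseteq> D"
    by blast
  let ?z = "(1 - u0) *\<^sub>R v + u0 *\<^sub>R w"
  let ?zk = "\<lambda>k. (1 - u (\<rho>' k)) *\<^sub>R f (?r (\<rho>' k)) + u (\<rho>' k) *\<^sub>R f (?r' (\<rho>' k))"
  have z: "?zk \<longlonglongrightarrow> ?z"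
    by (intro tendsto_intros u' v w)
  have dz: "(\<lambda>k. dist (c (\<rho>' k)) (?zk k)) \<longlonglongrightarrow> 0"
  proof (rule tendsto_sandwich[of "\<lambda>_. 0"])
    have "dist (c (\<rho>' k)) (?zk k) \<le> 1 / Suc k" for k
    proof -
      have "dist (c (\<rho>' k)) (?zk k) < 1 / Suc (\<rho>' k)"
        by (rule d)
      also have "\<dots> \<le> 1 / Suc k"
        using seq_suble[OF \<rho>', of k] by (intro divide_left_mono) auto
      finally show ?thesis by simp
    qed
    then show "\<forall>\<^sub>F k in sequentially. dist (c (\<rho>' k)) (?zk k) \<le> 1 / Suc k"
      by simp
    show "(\<lambda>k. 1 / real (Suc k)) \<longlonglongrightarrow> 0"
      by (rule LIMSEQ_Suc[OF lim_const_over_n])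
  qed auto
  have "(\<lambda>k. c (\<rho>' k) - ?zk k) \<longlonglongrightarrow> 0"
    by (rule tendsto_norm_zero_cancel) (use dz in \<open>simp add: dist_norm\<close>)
  from Lim_transform[OF z this] have cz: "(\<lambda>k. c (\<rho>' k)) \<longlonglongrightarrow> ?z" .
  \<comment> \<open>The points \<open>c\<close> of \<open>- D\<close> get arbitrarily close to the
    segments, so closedness puts the limit \<open>?z\<close> outside \<open>D\<close>, although it
    lies on a segment contained in \<open>D\<close>.\<close>
  have "closed (- D)"
    using D by (rule closed_Compl)
  from closed_sequentially[OF this c cz] have "?z \<in> - D" .
  moreover have "?z \<in> closed_segment v w"
    using u0 by (auto simp: closed_segment_def)
  ultimately show False
    using sub by auto
qed

text \<open>The segment over the grid cell containing the hit time \<open>s\<close> converges to the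
  jump segment at \<open>s\<close>, so it enters the \<open>\<epsilon>\<close>-ball around a point
  of \<open>- D\<close> on it. A start outside \<open>D\<close> is itself the first vertex.\<close>

lemma eventually_polyline_near:
  assumes f: "cadlag f" and ab: "0 < a" "a < b" and h: "hits D f a b" and \<epsilon>: "0 < \<epsilon>"
  shows "\<forall>\<^sub>F n in sequentially. \<exists>i\<le>n. polyline_near D \<epsilon> (f (grid a b n i)) (f (grid a b n (Suc i)))"
proof (cases "f a \<in> D")
  case False
  then have "polyline_near D \<epsilon> (f (grid a b n 0)) (f (grid a b n (Suc 0)))" for n
    using \<epsilon> False by (auto simp: polyline_near_iff intro!: bexI[of _ "0::real"] bexI[of _ "f a"])
  then show ?thesis
    by (intro always_eventually allI) blast
next
  case True
  then obtain s where s: "s \<in> {a<..b}" and hs: "closed_segment (left_limit f s) (f s) \<inter> - D \<noteq> {}"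
    using h unfolding hits_def by blast
  then obtain u where u: "u \<in> {0..1}" and uD: "(1 - u) *\<^sub>R left_limit f s + u *\<^sub>R f s \<in> - D"
    unfolding closed_segment_image_interval by blast
  \<comment> \<open>Ceiling minus one selects the cell with \<open>grid a b n (j n) < s\<close> and
    \<open>s \<le> grid a b n (Suc (j n))\<close>. Only strictly earlier times lead to the left
    limit; on the right, equality is harmless.\<close>
  define j where "j n = nat \<lceil>(s - a) / ((b - a) / Suc n)\<rceil> - 1" for n
  define h where "h n = (b - a) / Suc n" for n
  have hpos: "0 < h n" for n
    using ab by (simp add: h_def)
  have j: "real (j n) < (s - a) / h n" "(s - a) / h n \<le> real (j n) + 1" for n
  proof -
    have "0 < (s - a) / h n"
      using s hpos[of n] by simp
    then have "0 < \<lceil>(s - a) / h n\<rceil>"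
      by simp
    then have "real (j n) = real_of_int \<lceil>(s - a) / h n\<rceil> - 1"
      unfolding j_def h_def[symmetric] by (cases "\<lceil>(s - a) / h n\<rceil>" rule: int_cases) (auto simp: of_nat_diff)
    then show "real (j n) < (s - a) / h n" "(s - a) / h n \<le> real (j n) + 1"
      using ceiling_correct[of "(s - a) / h n"] by linarith+
  qed
  have jn: "j n \<le> n" for n
  proof -
    have "(s - a) / h n \<le> (b - a) / h n"
      using s hpos[of n] by (intro divide_right_mono) auto
    also have "\<dots> = Suc n"
      using ab by (simp add: h_def)
    finally show ?thesis
      using j(1)[of n] by linarith
  qed
  have lt: "grid a b n (j n) < s" and ge: "s \<le> grid a b n (Suc (j n))" for n
    using j[of n] hpos[of n] unfolding grid_Suc unfolding grid_def h_def[symmetric]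
    by (simp_all add: field_simps)
  have h0: "h \<longlonglongrightarrow> 0"
    unfolding h_def by (rule LIMSEQ_Suc[OF lim_const_over_n])
  have l1: "(\<lambda>n. grid a b n (j n)) \<longlonglongrightarrow> s"
  proof (rule tendsto_sandwich)
    show "\<forall>\<^sub>F n in sequentially. s - h n \<le> grid a b n (j n)"
      using ge by (simp add: grid_Suc h_def algebra_simps)
    show "\<forall>\<^sub>F n in sequentially. grid a b n (j n) \<le> s"
      using lt by (simp add: less_imp_le)
    show "(\<lambda>n. s - h n) \<longlonglongrightarrow> s"
      using tendsto_diff[OF tendsto_const[of s] h0] by simp
  qed simp
  have l2: "(\<lambda>n. grid a b n (Suc (j n))) \<longlonglongrightarrow> s"
    using tendsto_add[OF l1 h0] by (simp add: grid_Suc h_def)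
  have "(\<lambda>n. (1 - u) *\<^sub>R f (grid a b n (j n)) + u *\<^sub>R f (grid a b n (Suc (j n))))
      \<longlonglongrightarrow> (1 - u) *\<^sub>R left_limit f s + u *\<^sub>R f s"
    using s ab lt ge by (intro tendsto_intros cadlag_seq_left[OF f] cadlag_seq_right[OF f] l1 l2) auto
  then have "\<forall>\<^sub>F n in sequentially. (1 - u) *\<^sub>R f (grid a b n (j n)) + u *\<^sub>R f (grid a b n (Suc (j n)))
      \<in> ball ((1 - u) *\<^sub>R left_limit f s + u *\<^sub>R f s) \<epsilon>"
    using \<epsilon> by (intro topological_tendstoD) auto
  then show ?thesis
  proof eventually_elim
    case (elim n)
    moreover have "(1 - u) *\<^sub>R f (grid a b n (j n)) + u *\<^sub>R f (grid a b n (Suc (j n)))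
        \<in> closed_segment (f (grid a b n (j n))) (f (grid a b n (Suc (j n))))"
      using u by (auto simp: closed_segment_def)
    ultimately have "polyline_near D \<epsilon> (f (grid a b n (j n))) (f (grid a b n (Suc (j n))))"
      unfolding polyline_near_def using uD by blast
    then show ?case
      using jn by blast
  qed
qed

section \<open>The stable density and the Markov property\<close>

context
  fixes \<alpha> :: real
  assumes \<alpha>: "0 < \<alpha>"
begin

lemma stable_density_eq_fourier_inversion:
  "stable_density \<alpha> t = fourier_inversion (\<lambda>\<xi>. complex_of_real (exp (- t * norm \<xi> powr \<alpha>)))"
  by (rule ext) (simp only: stable_density_def fourier_inversion_def)

lemma integrable_stable_char:
  assumes "0 < t"
  shows "integrable lborel (\<lambda>\<xi>::'a::euclidean_space. complex_of_real (exp (- t * norm \<xi> powr \<alpha>)))"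
  using integrable_exp_norm_powr[OF assms \<alpha>] by (rule integrable_of_real)

lemma stable_density_uminus:
  fixes x :: "'a::euclidean_space"
  shows "stable_density \<alpha> t (- x) = stable_density \<alpha> t x"
proof -
  define g where "g \<xi> = cis (- (x \<bullet> \<xi>)) * complex_of_real (exp (- t * norm \<xi> powr \<alpha>))" for \<xi> :: 'a
  have [measurable]: "g \<in> borel_measurable borel"
    unfolding g_def by measurable
  have "integral\<^sup>L lborel g = integral\<^sup>L (distr lborel borel uminus) g"
    by (simp only: lborel_distr_uminus_euclidean)
  also have "\<dots> = (\<integral>\<xi>. g (- \<xi>) \<partial>lborel)"
  proof (rule integral_distr)
    have "continuous_on UNIV (uminus :: 'a \<Rightarrow> 'a)"
      by (rule continuous_on_minus[OF continuous_on_id])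
    then show "uminus \<in> lborel \<rightarrow>\<^sub>M (borel :: 'a measure)"
      by (simp add: borel_measurable_continuous_onI)
  qed fact
  finally show ?thesis
    unfolding stable_density_def g_def by (simp only: inner_minus_left inner_minus_right norm_minus_cancel)
qed

text \<open>This is the value of the density at time \<open>s\<close> at the origin. The
  \<open>itself\<close> argument fixes the dimension, which \<open>s\<close> does not
  determine.\<close>

definition stable_bound :: "real \<Rightarrow> 'a::euclidean_space itself \<Rightarrow> real" where
  "stable_bound s _ = (\<integral>\<xi>. exp (- s * norm (\<xi>::'a) powr \<alpha>) \<partial>lborel) / (2 * pi) ^ DIM('a)"

lemma abs_stable_density_le:
  fixes x :: "'a::euclidean_space"
  assumes "0 < s" "s \<le> t"
  shows "\<bar>stable_density \<alpha> t x\<bar> \<le> stable_bound s TYPE('a)"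
proof -
  have "\<bar>stable_density \<alpha> t x\<bar> \<le>
      norm ((\<integral>\<xi>. cis (- (x \<bullet> \<xi>)) * complex_of_real (exp (- t * norm \<xi> powr \<alpha>)) \<partial>lborel) / (2 * pi) ^ DIM('a))"
    unfolding stable_density_def by (rule abs_Re_le_cmod)
  also have "\<dots> = norm (\<integral>\<xi>. cis (- (x \<bullet> \<xi>)) * complex_of_real (exp (- t * norm \<xi> powr \<alpha>)) \<partial>lborel) / (2 * pi) ^ DIM('a)"
    by (simp add: norm_divide norm_mult norm_power)
  also have "\<dots> \<le> stable_bound s TYPE('a)"
    unfolding stable_bound_def
  proof (rule divide_right_mono)
    have "norm (\<integral>\<xi>. cis (- (x \<bullet> \<xi>)) * complex_of_real (exp (- t * norm \<xi> powr \<alpha>)) \<partial>lborel)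
      \<le> (\<integral>\<xi>. norm (cis (- (x \<bullet> \<xi>)) * complex_of_real (exp (- t * norm \<xi> powr \<alpha>))) \<partial>lborel)"
      by (rule integral_norm_bound)
    also have "\<dots> \<le> (\<integral>\<xi>. exp (- s * norm (\<xi>::'a) powr \<alpha>) \<partial>lborel)"
      using assms by (intro integral_mono' integrable_exp_norm_powr \<alpha>)
        (auto simp: norm_mult intro!: mult_right_mono)
    finally show "norm (\<integral>\<xi>. cis (- (x \<bullet> \<xi>)) * complex_of_real (exp (- t * norm \<xi> powr \<alpha>)) \<partial>lborel)
      \<le> (\<integral>\<xi>. exp (- s * norm (\<xi>::'a) powr \<alpha>) \<partial>lborel)" .
  qed simp
  finally show ?thesis .
qed

text \<open>Time and place vary together because rounding the shot-down time moves both arguments of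
  the density.\<close>

lemma stable_density_tendsto:
  fixes x :: "'a::euclidean_space"
  assumes s: "s \<longlonglongrightarrow> t" and t: "0 < t" and z: "z \<longlonglongrightarrow> x"
  shows "(\<lambda>n. stable_density \<alpha> (s n) (z n)) \<longlonglongrightarrow> stable_density \<alpha> t x"
proof -
  have "\<forall>\<^sub>F n in sequentially. t / 2 < s n"
    using s t by (intro order_tendstoD) auto
  \<comment> \<open>From \<open>N\<close> on, the integrand at time \<open>t / 2\<close> dominates;
    the initial terms are shifted away.\<close>
  then obtain N where N: "\<And>n. N \<le> n \<Longrightarrow> t / 2 \<le> s n"
    by (auto simp: eventually_sequentially intro: less_imp_le)
  have "(\<lambda>n. \<integral>\<xi>. cis (- (z (n + N) \<bullet> \<xi>)) * complex_of_real (exp (- s (n + N) * norm \<xi> powr \<alpha>)) \<partial>lborel)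
    \<longlonglongrightarrow> (\<integral>\<xi>. cis (- (x \<bullet> \<xi>)) * complex_of_real (exp (- t * norm \<xi> powr \<alpha>)) \<partial>lborel)"
  proof (rule integral_dominated_convergence[where w = "\<lambda>\<xi>. exp (- (t / 2) * norm \<xi> powr \<alpha>)"])
    show "AE \<xi> in lborel. (\<lambda>n. cis (- (z (n + N) \<bullet> \<xi>)) * complex_of_real (exp (- s (n + N) * norm \<xi> powr \<alpha>)))
       \<longlonglongrightarrow> cis (- (x \<bullet> \<xi>)) * complex_of_real (exp (- t * norm \<xi> powr \<alpha>))"
    proof (rule AE_I2)
      fix \<xi> :: 'a
      have "continuous_on UNIV cis"
        by (intro continuous_intros)
      then have "isCont cis u" for u
        by (simp add: continuous_on_eq_continuous_at)
      then show "(\<lambda>n. cis (- (z (n + N) \<bullet> \<xi>)) * complex_of_real (exp (- s (n + N) * norm \<xi> powr \<alpha>)))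
       \<longlonglongrightarrow> cis (- (x \<bullet> \<xi>)) * complex_of_real (exp (- t * norm \<xi> powr \<alpha>))"
        by (intro tendsto_intros isCont_tendsto_compose[of _ cis] LIMSEQ_ignore_initial_segment s z)
    qed
    show "AE \<xi> in lborel. norm (cis (- (z (n + N) \<bullet> \<xi>)) * complex_of_real (exp (- s (n + N) * norm \<xi> powr \<alpha>)))
        \<le> exp (- (t / 2) * norm \<xi> powr \<alpha>)" for n
    proof (rule AE_I2)
      fix \<xi> :: 'a
      have "t / 2 * norm \<xi> powr \<alpha> \<le> s (n + N) * norm \<xi> powr \<alpha>"
        using N[of "n + N"] by (intro mult_right_mono) auto
      then show "norm (cis (- (z (n + N) \<bullet> \<xi>)) * complex_of_real (exp (- s (n + N) * norm \<xi> powr \<alpha>)))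
        \<le> exp (- (t / 2) * norm \<xi> powr \<alpha>)"
        by (simp add: norm_mult)
    qed
    show "integrable lborel (\<lambda>\<xi>::'a. exp (- (t / 2) * norm \<xi> powr \<alpha>))"
      using t by (intro integrable_exp_norm_powr \<alpha>) auto
  qed measurable
  then have "(\<lambda>n. stable_density \<alpha> (s (n + N)) (z (n + N))) \<longlonglongrightarrow> stable_density \<alpha> t x"
    unfolding stable_density_def by (intro tendsto_intros) auto
  then show ?thesis
    by (rule LIMSEQ_offset)
qed

lemma stable_density_measurable [measurable]:
  assumes "0 < t"
  shows "stable_density \<alpha> t \<in> borel_measurable borel"
proof (intro borel_measurable_continuous_onI)
  show "continuous_on UNIV (stable_density \<alpha> t)"
    using stable_density_tendsto[OF tendsto_const assms]
    by (auto simp: continuous_on_sequentially comp_def)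
qed

end

section \<open>The Markov property at deterministic times\<close>

context levy_process
begin

text \<open>Positions relative to \<open>X 0\<close> are partial sums of increments, so independence
  of the increments carries over to the whole past and the next increment.\<close>

lemma indep_var_past_increment:
  assumes T: "0 \<le> T 0" "mono_on {..Suc n} T"
  shows "indep_var (\<Pi>\<^sub>M i\<in>{..n}. borel) (\<lambda>\<omega>. \<lambda>i\<in>{..n}. X (T i) \<omega> - X 0 \<omega>)
    (\<Pi>\<^sub>M i\<in>{Suc n}. borel) (\<lambda>\<omega>. \<lambda>i\<in>{Suc n}. X (T (Suc n)) \<omega> - X (T n) \<omega>)"
proof -
  \<comment> \<open>Time 0 is put in front so that the partial sums telescope to
    \<open>X (T i) - X 0\<close>. Increment \<open>i\<close> of \<open>S\<close> ends at
    \<open>T i\<close>, hence the index \<open>Suc n\<close> of the last one.\<close>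
  define S where "S j = (case j of 0 \<Rightarrow> 0 | Suc i \<Rightarrow> T i)" for j
  have S0: "0 \<le> S 0"
    by (simp add: S_def)
  have S_mono: "mono_on {..Suc (Suc n)} S"
  proof (rule mono_onI)
    fix i j assume ij: "i \<in> {..Suc (Suc n)}" "j \<in> {..Suc (Suc n)}" "i \<le> j"
    show "S i \<le> S j"
    proof (cases i)
      case 0
      show ?thesis
      proof (cases j)
        case (Suc j')
        have "T 0 \<le> T j'"
          using ij Suc by (intro mono_onD[OF T(2)]) auto
        then show ?thesis
          using 0 Suc T(1) by (simp add: S_def)
      qed (simp add: 0)
    next
      case (Suc i')
      then obtain j' where "j = Suc j'"
        using ij by (cases j) auto
      then show ?thesis
        using ij Suc by (auto simp: S_def intro!: mono_onD[OF T(2)])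
    qed
  qed
  have ind: "indep_vars (\<lambda>_. borel) (\<lambda>i \<omega>. X (S (Suc i)) \<omega> - X (S i) \<omega>) {..<Suc (Suc n)}"
    by (rule independent_increments[OF S0 S_mono])
  have 1: "indep_var
     (\<Pi>\<^sub>M i\<in>{..n}. borel) (\<lambda>\<omega>. \<lambda>i\<in>{..n}. X (S (Suc i)) \<omega> - X (S i) \<omega>)
     (\<Pi>\<^sub>M i\<in>{Suc n}. borel) (\<lambda>\<omega>. \<lambda>i\<in>{Suc n}. X (S (Suc i)) \<omega> - X (S i) \<omega>)"
    by (rule indep_var_restrict[OF ind]) auto
  let ?Y1 = "\<lambda>g. \<lambda>i\<in>{..n}. \<Sum>j\<in>{..i}. g j :: 'a"
  let ?Y2 = "\<lambda>g. g :: nat \<Rightarrow> 'a"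
  have "indep_var (\<Pi>\<^sub>M i\<in>{..n}. borel) (?Y1 \<circ> (\<lambda>\<omega>. \<lambda>i\<in>{..n}. X (S (Suc i)) \<omega> - X (S i) \<omega>))
     (\<Pi>\<^sub>M i\<in>{Suc n}. borel) (?Y2 \<circ> (\<lambda>\<omega>. \<lambda>i\<in>{Suc n}. X (S (Suc i)) \<omega> - X (S i) \<omega>))"
  proof (rule indep_var_compose[OF 1])
    show "?Y1 \<in> (\<Pi>\<^sub>M i\<in>{..n}. borel) \<rightarrow>\<^sub>M (\<Pi>\<^sub>M i\<in>{..n}. borel)"
      by (intro measurable_restrict borel_measurable_sum measurable_component_singleton) auto
  qed measurable
  also have "?Y1 \<circ> (\<lambda>\<omega>. \<lambda>i\<in>{..n}. X (S (Suc i)) \<omega> - X (S i) \<omega>) = (\<lambda>\<omega>. \<lambda>i\<in>{..n}. X (T i) \<omega> - X 0 \<omega>)"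
  proof (intro ext)
    fix \<omega> i
    have "(\<Sum>j\<in>{..i}. (\<lambda>i\<in>{..n}. X (S (Suc i)) \<omega> - X (S i) \<omega>) j) = X (T i) \<omega> - X 0 \<omega>" if "i \<le> n"
    proof -
      have "(\<Sum>j\<in>{..i}. (\<lambda>i\<in>{..n}. X (S (Suc i)) \<omega> - X (S i) \<omega>) j) = (\<Sum>j<Suc i. X (S (Suc j)) \<omega> - X (S j) \<omega>)"
        using that by (intro sum.cong) auto
      also have "\<dots> = X (S (Suc i)) \<omega> - X (S 0) \<omega>"
        by (rule sum_lessThan_telescope)
      finally show ?thesis
        by (simp add: S_def)
    qed
    then show "(?Y1 \<circ> (\<lambda>\<omega>. \<lambda>i\<in>{..n}. X (S (Suc i)) \<omega> - X (S i) \<omega>)) \<omega> i = (\<lambda>i\<in>{..n}. X (T i) \<omega> - X 0 \<omega>) i"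
      by simp
  qed
  also have "?Y2 \<circ> (\<lambda>\<omega>. \<lambda>i\<in>{Suc n}. X (S (Suc i)) \<omega> - X (S i) \<omega>) = (\<lambda>\<omega>. \<lambda>i\<in>{Suc n}. X (T (Suc n)) \<omega> - X (T n) \<omega>)"
    by (simp add: fun_eq_iff S_def restrict_def)
  finally show ?thesis .
qed

text \<open>Independence turns the joint law into a product, and stationarity gives the increment
  the law of \<open>X\<close> at the time difference; the second sample point acts as an independent
  copy.\<close>

lemma nn_integral_markov:
  assumes T: "0 \<le> T 0" "mono_on {..Suc n} T"
    and \<Phi> [measurable]: "\<Phi> \<in> borel_measurable ((\<Pi>\<^sub>M i\<in>{..n}. borel) \<Otimes>\<^sub>M borel)"
  shows "(\<integral>\<^sup>+\<omega>. \<Phi> (\<lambda>i\<in>{..n}. X (T i) \<omega>, X (T (Suc n)) \<omega> - X (T n) \<omega>) \<partial>M)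
    = (\<integral>\<^sup>+\<omega>. \<integral>\<^sup>+\<omega>'. \<Phi> (\<lambda>i\<in>{..n}. X (T i) \<omega>, X (T (Suc n) - T n) \<omega>') \<partial>M \<partial>M)"
proof -
  let ?P = "\<Pi>\<^sub>M i\<in>{..n}. borel :: 'a measure"
  let ?U = "\<lambda>\<omega>. \<lambda>i\<in>{..n}. X (T i) \<omega>" and ?U' = "\<lambda>\<omega>. \<lambda>i\<in>{..n}. X (T i) \<omega> - X 0 \<omega>"
  let ?I = "\<lambda>\<omega>. X (T (Suc n)) \<omega> - X (T n) \<omega>" and ?h = "T (Suc n) - T n"
  have T_ge: "0 \<le> T i" if "i \<le> Suc n" for i
    using T(1) mono_onD[OF T(2), of 0 i] that by auto
  have h: "0 \<le> ?h"
    using mono_onD[OF T(2), of n "Suc n"] by auto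
  let ?P' = "\<Pi>\<^sub>M i\<in>{Suc n}. borel :: 'a measure" and ?V = "\<lambda>\<omega>. \<lambda>i\<in>{Suc n}. ?I \<omega>"
  note ind = indep_var_past_increment[OF T]
  have rv [measurable]: "?U' \<in> M \<rightarrow>\<^sub>M ?P" "?V \<in> M \<rightarrow>\<^sub>M ?P'"
    using indep_var_rv1[OF ind] indep_var_rv2[OF ind] by auto
  have [measurable]: "X (T (Suc n)) \<in> borel_measurable M" "X (T n) \<in> borel_measurable M"
    "X ?h \<in> borel_measurable M"
    using T_ge h by (auto intro: measurable_process)
  have prod: "distr M ?P ?U' \<Otimes>\<^sub>M distr M ?P' ?V = distr M (?P \<Otimes>\<^sub>M ?P') (\<lambda>\<omega>. (?U' \<omega>, ?V \<omega>))"
    using ind by (simp add: indep_var_distribution_eq)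
  interpret V: prob_space "distr M ?P' ?V"
    by (rule prob_space_distr) measurable
  let ?\<Psi> = "\<lambda>(u, v). \<Phi> (u, v (Suc n))"
  have [measurable]: "?\<Psi> \<in> borel_measurable (?P \<Otimes>\<^sub>M ?P')"
    by measurable
  have dI: "distr M borel ?I = distr M borel (X ?h)"
    using stationary_increments[of "T n" ?h] T_ge h by simp
  \<comment> \<open>\<open>X\<close> starts at 0 only almost surely, so positions and positions
    relative to \<open>X 0\<close> are exchanged under the integral only.\<close>
  have AE_eq: "AE \<omega> in M. ?U \<omega> = ?U' \<omega>"
    using start_zero by eventually_elim simp
  have "(\<integral>\<^sup>+\<omega>. \<Phi> (?U \<omega>, ?I \<omega>) \<partial>M) = (\<integral>\<^sup>+\<omega>. \<Phi> (?U' \<omega>, ?I \<omega>) \<partial>M)"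
  proof (rule nn_integral_cong_AE)
    show "AE \<omega> in M. \<Phi> (?U \<omega>, ?I \<omega>) = \<Phi> (?U' \<omega>, ?I \<omega>)"
      using AE_eq by eventually_elim (simp only:)
  qed
  also have "\<dots> = (\<integral>\<^sup>+\<omega>. ?\<Psi> (?U' \<omega>, ?V \<omega>) \<partial>M)"
    by simp
  also have "\<dots> = (\<integral>\<^sup>+z. ?\<Psi> z \<partial>distr M (?P \<Otimes>\<^sub>M ?P') (\<lambda>\<omega>. (?U' \<omega>, ?V \<omega>)))"
    by (rule nn_integral_distr[symmetric]) measurable
  also have "\<dots> = (\<integral>\<^sup>+u. \<integral>\<^sup>+v. ?\<Psi> (u, v) \<partial>distr M ?P' ?V \<partial>distr M ?P ?U')"
    unfolding prod[symmetric] by (rule V.nn_integral_fst[symmetric]) measurable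
  also have "\<dots> = (\<integral>\<^sup>+\<omega>. \<integral>\<^sup>+v. ?\<Psi> (?U' \<omega>, v) \<partial>distr M ?P' ?V \<partial>M)"
    by (rule nn_integral_distr) measurable
  also have "\<dots> = (\<integral>\<^sup>+\<omega>. \<integral>\<^sup>+\<omega>'. \<Phi> (?U' \<omega>, X ?h \<omega>') \<partial>M \<partial>M)"
  proof (rule nn_integral_cong)
    fix \<omega> assume "\<omega> \<in> space M"
    then have [measurable]: "?U' \<omega> \<in> space ?P"
      using measurable_space[OF rv(1)] by blast
    have "(\<integral>\<^sup>+v. ?\<Psi> (?U' \<omega>, v) \<partial>distr M ?P' ?V) = (\<integral>\<^sup>+\<omega>'. ?\<Psi> (?U' \<omega>, ?V \<omega>') \<partial>M)"
      by (rule nn_integral_distr) measurable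
    also have "\<dots> = (\<integral>\<^sup>+\<omega>'. \<Phi> (?U' \<omega>, ?I \<omega>') \<partial>M)"
      by simp
    also have "\<dots> = (\<integral>\<^sup>+w. \<Phi> (?U' \<omega>, w) \<partial>distr M borel ?I)"
      by (rule nn_integral_distr[symmetric]) measurable
    also have "\<dots> = (\<integral>\<^sup>+\<omega>'. \<Phi> (?U' \<omega>, X ?h \<omega>') \<partial>M)"
      unfolding dI by (rule nn_integral_distr) measurable
    finally show "(\<integral>\<^sup>+v. ?\<Psi> (?U' \<omega>, v) \<partial>distr M ?P' ?V) = (\<integral>\<^sup>+\<omega>'. \<Phi> (?U' \<omega>, X ?h \<omega>') \<partial>M)" .
  qed
  also have "\<dots> = (\<integral>\<^sup>+\<omega>. \<integral>\<^sup>+\<omega>'. \<Phi> (?U \<omega>, X ?h \<omega>') \<partial>M \<partial>M)"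
  proof (rule nn_integral_cong_AE)
    show "AE \<omega> in M. (\<integral>\<^sup>+\<omega>'. \<Phi> (?U' \<omega>, X ?h \<omega>') \<partial>M) = (\<integral>\<^sup>+\<omega>'. \<Phi> (?U \<omega>, X ?h \<omega>') \<partial>M)"
      using AE_eq by eventually_elim (simp only:)
  qed
  finally show ?thesis .
qed

end

section \<open>Time reversal\<close>

lemma nn_integral_lborel_uminus:
  fixes f :: "'a::euclidean_space \<Rightarrow> ennreal"
  assumes "f \<in> borel_measurable borel"
  shows "(\<integral>\<^sup>+z. f (- z) \<partial>lborel) = (\<integral>\<^sup>+z. f z \<partial>lborel)"
proof -
  have "continuous_on UNIV (uminus :: 'a \<Rightarrow> 'a)"
    by (rule continuous_on_minus[OF continuous_on_id])
  then have "uminus \<in> lborel \<rightarrow>\<^sub>M (borel :: 'a measure)"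
    by (simp add: borel_measurable_continuous_onI)
  then have "(\<integral>\<^sup>+z. f z \<partial>distr lborel borel uminus) = (\<integral>\<^sup>+z. f (- z) \<partial>lborel)"
    by (rule nn_integral_distr) (use assms in simp)
  then show ?thesis
    by (simp only: lborel_distr_uminus_euclidean)
qed

text \<open>Values in \<open>ennreal\<close> let these weights be multiplied along a polyline and
  integrated without integrability conditions.\<close>

definition avoids :: "'a::euclidean_space set \<Rightarrow> nat \<Rightarrow> 'a \<times> 'a \<Rightarrow> ennreal" where
  "avoids D k z = (if polyline_near D (1 / Suc k) (fst z) (snd z) then 0 else 1)"

lemma avoids_measurable [measurable]: "avoids D k \<in> borel_measurable (borel \<Otimes>\<^sub>M borel)"
proof -
  have [measurable]: "Measurable.pred (borel \<Otimes>\<^sub>M borel) (\<lambda>z. polyline_near D (1 / Suc k) (fst z) (snd z))"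
    using polyline_near_measurable[of D "1 / Suc k"] by (simp only: case_prod_unfold)
  show ?thesis
    unfolding avoids_def [abs_def] by measurable
qed

lemma avoids_commute: "avoids D k (v, w) = avoids D k (w, v)"
  by (simp add: avoids_def polyline_near_commute)

definition polyline_avoids :: "'a::euclidean_space set \<Rightarrow> nat \<Rightarrow> real \<Rightarrow> real \<Rightarrow> nat \<Rightarrow> (real \<Rightarrow> 'a) \<Rightarrow> ennreal" where
  "polyline_avoids D k a b n f = (\<Prod>i<Suc n. avoids D k (f (grid a b n i), f (grid a b n (Suc i))))"

lemma polyline_avoids_eq:
  "polyline_avoids D k a b n f =
    (if \<exists>i\<le>n. polyline_near D (1 / Suc k) (f (grid a b n i)) (f (grid a b n (Suc i))) then 0 else 1)"
proof (cases "\<exists>i\<le>n. polyline_near D (1 / Suc k) (f (grid a b n i)) (f (grid a b n (Suc i)))")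
  case True
  then obtain i where i: "i \<le> n" "polyline_near D (1 / Suc k) (f (grid a b n i)) (f (grid a b n (Suc i)))"
    by blast
  have "polyline_avoids D k a b n f = 0"
    unfolding polyline_avoids_def
    by (rule prod_zero) (use i in \<open>auto simp: avoids_def intro!: bexI[of _ i]\<close>)
  then show ?thesis
    using True by simp
next
  case False
  then have "polyline_avoids D k a b n f = 1"
    unfolding polyline_avoids_def by (intro prod.neutral) (auto simp: avoids_def)
  then show ?thesis
    using False by simp
qed

lemma polyline_avoids_mult_le: "polyline_avoids D k a b n f * c \<le> c"
  by (simp add: polyline_avoids_eq)

lemma limsup_polyline_avoids_le:
  assumes "cadlag f" "0 < a" "a < b"
  shows "limsup (\<lambda>n. polyline_avoids D k a b n f * c) \<le> of_bool (\<not> hits D f a b) * c"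
proof (cases "hits D f a b")
  case True
  have "\<forall>\<^sub>F n in sequentially. \<exists>i\<le>n. polyline_near D (1 / Suc k) (f (grid a b n i)) (f (grid a b n (Suc i)))"
    by (rule eventually_polyline_near[OF assms True]) simp
  then have "\<forall>\<^sub>F n in sequentially. polyline_avoids D k a b n f * c \<le> 0"
    by eventually_elim (simp only: polyline_avoids_eq if_True mult_zero_left order_refl)
  then have "limsup (\<lambda>n. polyline_avoids D k a b n f * c) \<le> 0"
    by (rule Limsup_bounded)
  then show ?thesis
    using True by simp
next
  case False
  have "limsup (\<lambda>n. polyline_avoids D k a b n f * c) \<le> c"
    by (intro Limsup_bounded polyline_avoids_mult_le always_eventually allI)
  then show ?thesis
    using False by simp
qed

text \<open>The bound on \<open>limsup\<close> holds for every \<open>k\<close>. Conversely, a path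
  without hits keeps some distance from \<open>- D\<close>, but the suitable \<open>k\<close>
  depends on the path; a fixed \<open>k\<close> could discard paths passing close by. Hence the
  supremum outside the \<open>liminf\<close>.\<close>

lemma SUP_liminf_polyline_avoids:
  assumes "cadlag f" "open D" "0 < a" "a < b"
  shows "(SUP k. liminf (\<lambda>n. polyline_avoids D k a b n f * c)) = of_bool (\<not> hits D f a b) * c"
proof (rule antisym)
  show "(SUP k. liminf (\<lambda>n. polyline_avoids D k a b n f * c)) \<le> of_bool (\<not> hits D f a b) * c"
    by (intro SUP_least order_trans[OF Liminf_le_Limsup limsup_polyline_avoids_le[OF assms(1,3,4)]]) simp
  show "of_bool (\<not> hits D f a b) * c \<le> (SUP k. liminf (\<lambda>n. polyline_avoids D k a b n f * c))"
  proof (cases "hits D f a b")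
    case False
    from eventually_not_polyline_near[OF assms False] obtain k where
      "\<forall>\<^sub>F n in sequentially. \<forall>i\<le>n.
        \<not> polyline_near D (1 / Suc k) (f (grid a b n i)) (f (grid a b n (Suc i)))" ..
    then have "\<forall>\<^sub>F n in sequentially. c \<le> polyline_avoids D k a b n f * c"
      by eventually_elim (auto simp: polyline_avoids_eq)
    then have "c \<le> liminf (\<lambda>n. polyline_avoids D k a b n f * c)"
      by (rule Liminf_bounded)
    then show ?thesis
      using False by (auto intro: SUP_upper2)
  qed simp
qed

lemma polyline_avoids_mono: "k \<le> k' \<Longrightarrow> polyline_avoids D k a b n f \<le> polyline_avoids D k' a b n f"
proof -
  assume "k \<le> k'"
  then have "1 / real (Suc k') \<le> 1 / Suc k"
    by (intro divide_left_mono) auto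
  then show ?thesis
    unfolding polyline_avoids_eq using polyline_near_mono by fastforce
qed

section \<open>Measurability and expectations of the event without hits\<close>

context isotropic_stable_process
begin

lemma cadlag_translate:
  assumes "\<omega> \<in> space M"
  shows "cadlag (\<lambda>s. x + X s \<omega>)"
  unfolding cadlag_def
proof (intro conjI allI impI)
  fix t :: real assume "0 \<le> t"
  then have "continuous (at_right t) (\<lambda>s. X s \<omega>)"
    using cadlag_paths[OF assms] by (simp add: cadlag_def)
  then show "continuous (at_right t) (\<lambda>s. x + X s \<omega>)"
    by (intro continuous_intros)
next
  fix t :: real assume "0 < t"
  then obtain l where "((\<lambda>s. X s \<omega>) \<longlongrightarrow> l) (at_left t)"
    using cadlag_paths[OF assms] by (auto simp: cadlag_def)
  then have "((\<lambda>s. x + X s \<omega>) \<longlongrightarrow> x + l) (at_left t)"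
    by (intro tendsto_intros)
  then show "\<exists>l. ((\<lambda>s. x + X s \<omega>) \<longlongrightarrow> l) (at_left t)" ..
qed

lemma polyline_avoids_measurable [measurable]:
  assumes "0 < a" "a < b"
  shows "(\<lambda>\<omega>. polyline_avoids D k a b n (\<lambda>s. x + X s \<omega>)) \<in> borel_measurable M"
  unfolding polyline_avoids_def
proof (rule borel_measurable_prod_ennreal)
  fix i assume "i \<in> {..<Suc n}"
  then have i: "0 \<le> grid a b n i" "0 \<le> grid a b n (Suc i)"
    using grid_bounds[of a b i n] grid_bounds[of a b "Suc i" n] assms by auto
  have [measurable]: "X (grid a b n i) \<in> borel_measurable M" "X (grid a b n (Suc i)) \<in> borel_measurable M"
    using i by (auto intro: measurable_process)
  show "(\<lambda>\<omega>. avoids D k (x + X (grid a b n i) \<omega>, x + X (grid a b n (Suc i)) \<omega>)) \<in> borel_measurable M"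
    by measurable
qed

definition no_hit :: "'a set \<Rightarrow> 'a \<Rightarrow> real \<Rightarrow> real \<Rightarrow> 'w set" where
  "no_hit D x a b = {\<omega> \<in> space M. \<not> hits D (\<lambda>s. x + X s \<omega>) a b}"

context
  fixes D :: "'a set" and x :: 'a and a b :: real
  assumes D: "open D" and ab: "0 < a" "a < b"
begin

lemma indicator_no_hit:
  "\<omega> \<in> space M \<Longrightarrow> indicator (no_hit D x a b) \<omega> * c
    = (SUP k. liminf (\<lambda>n. polyline_avoids D k a b n (\<lambda>s. x + X s \<omega>) * c))"
  by (subst SUP_liminf_polyline_avoids[OF cadlag_translate D ab]) (auto simp: no_hit_def)

text \<open>The event speaks of uncountably many jump segments, but for every single path its
  indicator is a limit formed from countably many polyline weights.\<close>

lemma sets_no_hit: "no_hit D x a b \<in> sets M"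
proof -
  have [measurable]: "(\<lambda>\<omega>. polyline_avoids D k a b n (\<lambda>s. x + X s \<omega>)) \<in> borel_measurable M" for n k
    using ab by measurable
  let ?S = "\<lambda>\<omega>. SUP k. liminf (\<lambda>n. polyline_avoids D k a b n (\<lambda>s. x + X s \<omega>) * 1)"
  have "?S \<in> borel_measurable M"
    by measurable
  then have "{\<omega> \<in> space M. ?S \<omega> = 1} \<in> sets M"
    by measurable
  also have "{\<omega> \<in> space M. ?S \<omega> = 1} = no_hit D x a b"
    using indicator_no_hit[of _ 1, symmetric] by (auto simp: no_hit_def indicator_def split: if_splits)
  finally show ?thesis .
qed

text \<open>One inequality is Fatou in \<open>n\<close> with monotone convergence in
  \<open>k\<close>, the other is reverse Fatou with majorant \<open>G\<close>, whence
  \<open>fin\<close>. Two separate estimates are made because the weights need not converge in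
  \<open>n\<close> for fixed \<open>k\<close>.\<close>

lemma nn_integral_no_hit:
  assumes [measurable]: "G \<in> borel_measurable M" and fin: "(\<integral>\<^sup>+\<omega>. G \<omega> \<partial>M) < \<infinity>"
  shows "(\<integral>\<^sup>+\<omega>. indicator (no_hit D x a b) \<omega> * G \<omega> \<partial>M)
    = (SUP k. liminf (\<lambda>n. \<integral>\<^sup>+\<omega>. polyline_avoids D k a b n (\<lambda>s. x + X s \<omega>) * G \<omega> \<partial>M))"
proof (rule antisym)
  let ?P = "\<lambda>k n \<omega>. polyline_avoids D k a b n (\<lambda>s. x + X s \<omega>)"
  have [measurable]: "?P k n \<in> borel_measurable M" for n k
    using ab by measurable
  have inc: "incseq (\<lambda>k \<omega>. liminf (\<lambda>n. ?P k n \<omega> * G \<omega>))"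
    by (intro incseq_SucI le_funI Liminf_mono always_eventually allI mult_right_mono polyline_avoids_mono) auto
  have "(\<integral>\<^sup>+\<omega>. indicator (no_hit D x a b) \<omega> * G \<omega> \<partial>M) = (\<integral>\<^sup>+\<omega>. (SUP k. liminf (\<lambda>n. ?P k n \<omega> * G \<omega>)) \<partial>M)"
    by (intro nn_integral_cong indicator_no_hit)
  also have "\<dots> = (SUP k. \<integral>\<^sup>+\<omega>. liminf (\<lambda>n. ?P k n \<omega> * G \<omega>) \<partial>M)"
    by (rule nn_integral_monotone_convergence_SUP[OF inc]) measurable
  also have "\<dots> \<le> (SUP k. liminf (\<lambda>n. \<integral>\<^sup>+\<omega>. ?P k n \<omega> * G \<omega> \<partial>M))"
    by (intro SUP_mono' nn_integral_liminf) measurable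
  finally show "(\<integral>\<^sup>+\<omega>. indicator (no_hit D x a b) \<omega> * G \<omega> \<partial>M)
    \<le> (SUP k. liminf (\<lambda>n. \<integral>\<^sup>+\<omega>. ?P k n \<omega> * G \<omega> \<partial>M))" .
  show "(SUP k. liminf (\<lambda>n. \<integral>\<^sup>+\<omega>. ?P k n \<omega> * G \<omega> \<partial>M))
      \<le> (\<integral>\<^sup>+\<omega>. indicator (no_hit D x a b) \<omega> * G \<omega> \<partial>M)"
  proof (rule SUP_least)
    fix k
    have "liminf (\<lambda>n. \<integral>\<^sup>+\<omega>. ?P k n \<omega> * G \<omega> \<partial>M) \<le> limsup (\<lambda>n. \<integral>\<^sup>+\<omega>. ?P k n \<omega> * G \<omega> \<partial>M)"
      by (rule Liminf_le_Limsup) simp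
    also have "\<dots> \<le> (\<integral>\<^sup>+\<omega>. limsup (\<lambda>n. ?P k n \<omega> * G \<omega>) \<partial>M)"
      by (rule nn_integral_limsup[where w = G]) (use fin in \<open>auto intro: AE_I2 polyline_avoids_mult_le\<close>)
    also have "\<dots> \<le> (\<integral>\<^sup>+\<omega>. indicator (no_hit D x a b) \<omega> * G \<omega> \<partial>M)"
    proof (rule nn_integral_mono)
      fix \<omega> assume \<omega>: "\<omega> \<in> space M"
      have "of_bool (\<not> hits D (\<lambda>s. x + X s \<omega>) a b) = (indicator (no_hit D x a b) \<omega> :: ennreal)"
        using \<omega> by (simp add: no_hit_def)
      then show "limsup (\<lambda>n. ?P k n \<omega> * G \<omega>) \<le> indicator (no_hit D x a b) \<omega> * G \<omega>"
        using limsup_polyline_avoids_le[OF cadlag_translate[OF \<omega>] ab, of D k x "G \<omega>"] by simp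
    qed
    finally show "liminf (\<lambda>n. \<integral>\<^sup>+\<omega>. ?P k n \<omega> * G \<omega> \<partial>M)
      \<le> (\<integral>\<^sup>+\<omega>. indicator (no_hit D x a b) \<omega> * G \<omega> \<partial>M)" .
  qed
qed

end

end

section \<open>Densities of the process and symmetric transition operators\<close>

locale isotropic_stable_process_pos = isotropic_stable_process M X \<alpha>
  for M :: "'w measure" and X :: "real \<Rightarrow> 'w \<Rightarrow> 'a::euclidean_space" and \<alpha> +
  assumes \<alpha>: "0 < \<alpha>"
begin

abbreviation p :: "real \<Rightarrow> 'a \<Rightarrow> real" where
  "p \<equiv> stable_density \<alpha>"

lemma p_measurable: "0 < t \<Longrightarrow> p t \<in> borel_measurable borel"
  by (rule stable_density_measurable[OF \<alpha>])

lemma p_minus_commute: "p t (u - v) = p t (v - u)"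
  using stable_density_uminus[OF \<alpha>, of t "u - v"] by simp

lemma distr_X_eq_density:
  assumes "0 < t"
  shows "distr M borel (X t) = density lborel (p t)"
  unfolding stable_density_eq_fourier_inversion[OF \<alpha>]
  by (rule distr_eq_density_inversion[OF measurable_process characteristic_function
        integrable_stable_char[OF \<alpha> assms]]) (use assms in auto)

lemma p_nonneg:
  assumes "0 < t"
  shows "0 \<le> p t x"
  unfolding stable_density_eq_fourier_inversion[OF \<alpha>]
  by (rule inversion_nonneg[OF measurable_process characteristic_function
        integrable_stable_char[OF \<alpha> assms]]) (use assms in auto)

lemma nn_integral_X:
  fixes f :: "'a \<Rightarrow> ennreal"
  assumes t: "0 < t" and [measurable]: "f \<in> borel_measurable borel"
  shows "(\<integral>\<^sup>+\<omega>. f (X t \<omega>) \<partial>M) = (\<integral>\<^sup>+z. p t z * f z \<partial>lborel)"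
proof -
  have [measurable]: "X t \<in> borel_measurable M" "p t \<in> borel_measurable borel"
    using t by (auto intro: measurable_process p_measurable)
  have "(\<integral>\<^sup>+\<omega>. f (X t \<omega>) \<partial>M) = (\<integral>\<^sup>+z. f z \<partial>distr M borel (X t))"
    by (rule nn_integral_distr[symmetric]) measurable
  also have "\<dots> = (\<integral>\<^sup>+z. p t z * f z \<partial>lborel)"
    unfolding distr_X_eq_density[OF t] by (rule nn_integral_density) measurable
  finally show ?thesis .
qed

lemma nn_integral_X_uminus:
  fixes f :: "'a \<Rightarrow> ennreal"
  assumes t: "0 < t" and [measurable]: "f \<in> borel_measurable borel"
  shows "(\<integral>\<^sup>+\<omega>. f (- X t \<omega>) \<partial>M) = (\<integral>\<^sup>+\<omega>. f (X t \<omega>) \<partial>M)"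
proof -
  have [measurable]: "p t \<in> borel_measurable borel"
    using t by (rule p_measurable)
  have "(\<integral>\<^sup>+\<omega>. f (- X t \<omega>) \<partial>M) = (\<integral>\<^sup>+z. p t z * f (- z) \<partial>lborel)"
    by (rule nn_integral_X[OF t, of "\<lambda>z. f (- z)"]) measurable
  also have "\<dots> = (\<integral>\<^sup>+z. p t (- z) * f (- z) \<partial>lborel)"
    by (simp only: stable_density_uminus[OF \<alpha>])
  also have "\<dots> = (\<integral>\<^sup>+z. p t z * f z \<partial>lborel)"
    by (rule nn_integral_lborel_uminus[of "\<lambda>z. ennreal (p t z) * f z"]) measurable
  finally show ?thesis
    using nn_integral_X[OF t, of f] by simp
qed

lemma p_bounded:
  assumes "0 < s"
  shows "\<exists>C. \<forall>t\<ge>s. \<forall>z. \<bar>p t z\<bar> \<le> C"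
  using abs_stable_density_le[OF \<alpha> assms] by blast

text \<open>Chapman-Kolmogorov, computed on the Fourier side, where the exponents add. Convolving
  laws would give it for almost every \<open>z\<close>; the Fourier integral gives it at every
  \<open>z\<close>.\<close>

lemma integral_p_convolution:
  assumes r: "0 < r" and h: "0 \<le> h"
  shows "(\<integral>\<omega>. p r (z - X h \<omega>) \<partial>M) = p (r + h) z"
proof -
  interpret P: pair_sigma_finite lborel M ..
  have [measurable]: "X h \<in> borel_measurable M"
    using h by (rule measurable_process)
  let ?e = "\<lambda>t \<xi>::'a. complex_of_real (exp (- t * norm \<xi> powr \<alpha>))"
  let ?F = "\<lambda>\<xi> \<omega>. cis (- ((z - X h \<omega>) \<bullet> \<xi>)) * ?e r \<xi>"
  let ?c = "complex_of_real ((2 * pi) ^ DIM('a))"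
  have F: "integrable (lborel \<Otimes>\<^sub>M M) (case_prod ?F)"
  proof (rule P.Fubini_integrable)
    show "integrable lborel (\<lambda>\<xi>. \<integral>\<omega>. norm (case (\<xi>, \<omega>) of (\<xi>, \<omega>) \<Rightarrow> ?F \<xi> \<omega>) \<partial>M)"
      using integrable_exp_norm_powr[OF r \<alpha>] by (simp add: norm_mult prob_space)
    show "AE \<xi> in lborel. integrable M (\<lambda>\<omega>. case (\<xi>, \<omega>) of (\<xi>, \<omega>) \<Rightarrow> ?F \<xi> \<omega>)"
    proof (rule AE_I2)
      fix \<xi> :: 'a
      have "norm (?F \<xi> \<omega>) \<le> 1" for \<omega>
        using r by (simp add: norm_mult)
      then show "integrable M (\<lambda>\<omega>. case (\<xi>, \<omega>) of (\<xi>, \<omega>) \<Rightarrow> ?F \<xi> \<omega>)"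
        by (intro integrable_const_bound[of _ 1]) auto
    qed
  qed measurable
  have "(\<integral>\<omega>. \<integral>\<xi>. ?F \<xi> \<omega> \<partial>lborel \<partial>M) = (\<integral>\<xi>. \<integral>\<omega>. ?F \<xi> \<omega> \<partial>M \<partial>lborel)"
    by (rule P.Fubini_integral[OF F])
  also have "\<dots> = (\<integral>\<xi>. cis (- (z \<bullet> \<xi>)) * ?e (r + h) \<xi> \<partial>lborel)"
  proof (rule Bochner_Integration.integral_cong[OF refl])
    fix \<xi> :: 'a
    have "?F \<xi> \<omega> = (cis (- (z \<bullet> \<xi>)) * ?e r \<xi>) * cis (\<xi> \<bullet> X h \<omega>)" for \<omega>
      by (simp add: cis_mult inner_diff_left inner_commute algebra_simps)
    then have "(\<integral>\<omega>. ?F \<xi> \<omega> \<partial>M) = (cis (- (z \<bullet> \<xi>)) * ?e r \<xi>) * ?e h \<xi>"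
      by (simp add: characteristic_function[OF h])
    moreover have "?e (r + h) \<xi> = ?e r \<xi> * ?e h \<xi>"
      unfolding of_real_mult[symmetric] exp_add[symmetric] by (simp add: algebra_simps)
    ultimately show "(\<integral>\<omega>. ?F \<xi> \<omega> \<partial>M) = cis (- (z \<bullet> \<xi>)) * ?e (r + h) \<xi>"
      by (simp only: mult.assoc)
  qed
  finally have eq: "(\<integral>\<omega>. \<integral>\<xi>. ?F \<xi> \<omega> \<partial>lborel \<partial>M) = (\<integral>\<xi>. cis (- (z \<bullet> \<xi>)) * ?e (r + h) \<xi> \<partial>lborel)" .
  have int: "integrable M (\<lambda>\<omega>. (\<integral>\<xi>. ?F \<xi> \<omega> \<partial>lborel) / ?c)"
    by (intro integrable_divide P.integrable_snd F)
  have "(\<integral>\<omega>. p r (z - X h \<omega>) \<partial>M) = (\<integral>\<omega>. Re ((\<integral>\<xi>. ?F \<xi> \<omega> \<partial>lborel) / ?c) \<partial>M)"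
    by (simp add: stable_density_def)
  also have "\<dots> = Re (\<integral>\<omega>. (\<integral>\<xi>. ?F \<xi> \<omega> \<partial>lborel) / ?c \<partial>M)"
    by (rule integral_Re[OF int])
  also have "\<dots> = p (r + h) z"
    unfolding integral_divide_zero eq stable_density_def by simp
  finally show ?thesis .
qed

lemma nn_integral_p_convolution:
  assumes r: "0 < r" and h: "0 \<le> h"
  shows "(\<integral>\<^sup>+\<omega>. p r (z - X h \<omega>) \<partial>M) = p (r + h) z"
proof -
  have [measurable]: "X h \<in> borel_measurable M" "p r \<in> borel_measurable borel"
    using h r by (auto intro: measurable_process p_measurable)
  obtain C where "\<forall>t\<ge>r. \<forall>z. \<bar>p t z\<bar> \<le> C"
    using p_bounded[OF r] by blast
  then have "integrable M (\<lambda>\<omega>. p r (z - X h \<omega>))"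
    by (intro integrable_const_bound[of _ C]) auto
  then show ?thesis
    by (subst nn_integral_eq_integral) (auto simp: p_nonneg r integral_p_convolution h)
qed

text \<open>A Feynman-Kac step: the heat semigroup over time \<open>h\<close>, weighted by
  \<open>q\<close> at the two ends of the step. With \<open>avoids D k\<close> as the weight, its
  powers describe polylines.\<close>

definition transfer :: "('a \<times> 'a \<Rightarrow> ennreal) \<Rightarrow> real \<Rightarrow> ('a \<Rightarrow> ennreal) \<Rightarrow> 'a \<Rightarrow> ennreal" where
  "transfer q h f z = (\<integral>\<^sup>+\<omega>. q (z, z + X h \<omega>) * f (z + X h \<omega>) \<partial>M)"

context
  fixes q :: "'a \<times> 'a \<Rightarrow> ennreal" and h :: real
  assumes q [measurable]: "q \<in> borel_measurable (borel \<Otimes>\<^sub>M borel)"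
    and h: "0 < h"
begin

lemma X_h_measurable [measurable]: "X h \<in> borel_measurable M"
  using h by (intro measurable_process) simp

lemma transfer_measurable [measurable]:
  assumes [measurable]: "f \<in> borel_measurable borel"
  shows "transfer q h f \<in> borel_measurable borel"
  unfolding transfer_def by measurable

lemma transfer_funpow_measurable [measurable]:
  assumes "f \<in> borel_measurable borel"
  shows "(transfer q h ^^ n) f \<in> borel_measurable borel"
  using assms by (induction n) auto

text \<open>The last step is removed first: the Markov property integrates out its increment and
  replaces \<open>F\<close> by \<open>transfer q h F\<close>, so \<open>F\<close> has to stay
  arbitrary in the induction.\<close>

lemma nn_integral_chain:
  assumes a: "0 \<le> a" and "F \<in> borel_measurable borel"
  shows "(\<integral>\<^sup>+\<omega>. (\<Prod>i<n. q (x + X (a + i * h) \<omega>, x + X (a + Suc i * h) \<omega>)) * F (x + X (a + n * h) \<omega>) \<partial>M)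
    = (\<integral>\<^sup>+\<omega>. (transfer q h ^^ n) F (x + X a \<omega>) \<partial>M)"
  using assms(2)
proof (induction n arbitrary: F)
  case (Suc n)
  note [measurable] = Suc.prems
  define T where "T i = a + real i * h" for i :: nat
  have T0: "0 \<le> T 0" and T: "mono_on {..Suc n} T"
    using a h by (auto simp: T_def intro!: mono_onI mult_right_mono)
  have T_step: "T (Suc n) - T n = h"
    by (simp add: T_def algebra_simps)
  \<comment> \<open>The positions at the grid times and the last increment are separate arguments,
    the form in which \<open>nn_integral_markov\<close> applies.\<close>
  define \<Phi> where "\<Phi> = (\<lambda>(g, w). (\<Prod>i<n. q (x + g i, x + g (Suc i)))
    * (q (x + g n, x + g n + w) * F (x + g n + w)))"
  have \<Phi>: "\<Phi> \<in> borel_measurable ((\<Pi>\<^sub>M i\<in>{..n}. borel) \<Otimes>\<^sub>M borel)"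
  proof -
    have [measurable]: "(\<lambda>v. fst v i) \<in> borel_measurable ((\<Pi>\<^sub>M i\<in>{..n}. borel :: 'a measure) \<Otimes>\<^sub>M (borel :: 'a measure))"
      if "i \<le> n" for i
      using that by (intro measurable_compose[OF measurable_fst measurable_component_singleton]) simp
    have [measurable]: "(\<lambda>v. \<Prod>i<n. q (x + fst v i, x + fst v (Suc i)))
      \<in> borel_measurable ((\<Pi>\<^sub>M i\<in>{..n}. borel :: 'a measure) \<Otimes>\<^sub>M (borel :: 'a measure))"
      by (rule borel_measurable_prod_ennreal) (measurable; simp)
    show ?thesis
      unfolding \<Phi>_def case_prod_unfold by (measurable; simp)
  qed
  have "(\<integral>\<^sup>+\<omega>. (\<Prod>i<Suc n. q (x + X (a + i * h) \<omega>, x + X (a + Suc i * h) \<omega>)) * F (x + X (a + Suc n * h) \<omega>) \<partial>M)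
    = (\<integral>\<^sup>+\<omega>. \<Phi> (\<lambda>i\<in>{..n}. X (T i) \<omega>, X (T (Suc n)) \<omega> - X (T n) \<omega>) \<partial>M)"
    unfolding \<Phi>_def by (intro nn_integral_cong) (simp add: T_def mult.assoc del: of_nat_Suc)
  also have "\<dots> = (\<integral>\<^sup>+\<omega>. \<integral>\<^sup>+\<omega>'. \<Phi> (\<lambda>i\<in>{..n}. X (T i) \<omega>, X (T (Suc n) - T n) \<omega>') \<partial>M \<partial>M)"
    by (rule nn_integral_markov[OF T0 T \<Phi>])
  also have "\<dots> = (\<integral>\<^sup>+\<omega>. (\<Prod>i<n. q (x + X (a + i * h) \<omega>, x + X (a + Suc i * h) \<omega>))
      * transfer q h F (x + X (a + n * h) \<omega>) \<partial>M)"
    unfolding T_step transfer_def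
    by (intro nn_integral_cong, subst nn_integral_cmult[symmetric])
      (auto simp: \<Phi>_def T_def simp del: of_nat_Suc)
  also have "\<dots> = (\<integral>\<^sup>+\<omega>. (transfer q h ^^ n) (transfer q h F) (x + X a \<omega>) \<partial>M)"
    by (rule Suc.IH) measurable
  finally show ?case
    by (simp only: funpow_Suc_right comp_apply)
qed simp

text \<open>For fixed \<open>\<omega>\<close>, translating \<open>z\<close> by
  \<open>X h \<omega>\<close> moves the increment from \<open>g\<close> to \<open>f\<close> with the
  opposite sign. Lebesgue measure is invariant, the law of \<open>X h\<close> is symmetric, and
  \<open>sym\<close> turns the weight around.\<close>

lemma transfer_symmetric:
  assumes sym: "\<And>v w. q (v, w) = q (w, v)"
    and [measurable]: "f \<in> borel_measurable borel" "g \<in> borel_measurable borel"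
  shows "(\<integral>\<^sup>+z. f z * transfer q h g z \<partial>lborel) = (\<integral>\<^sup>+z. transfer q h f z * g z \<partial>lborel)"
proof -
  interpret P: pair_sigma_finite lborel M ..
  have "(\<integral>\<^sup>+z. f z * transfer q h g z \<partial>lborel)
      = (\<integral>\<^sup>+z. \<integral>\<^sup>+\<omega>. f z * (q (z, z + X h \<omega>) * g (z + X h \<omega>)) \<partial>M \<partial>lborel)"
    unfolding transfer_def by (intro nn_integral_cong nn_integral_cmult[symmetric]) measurable
  also have "\<dots> = (\<integral>\<^sup>+\<omega>. \<integral>\<^sup>+z. f z * (q (z, z + X h \<omega>) * g (z + X h \<omega>)) \<partial>lborel \<partial>M)"
    by (rule P.Fubini'[symmetric]) measurable
  also have "\<dots> = (\<integral>\<^sup>+\<omega>. \<integral>\<^sup>+z. f (z - X h \<omega>) * (q (z - X h \<omega>, z) * g z) \<partial>lborel \<partial>M)"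
  proof (rule nn_integral_cong)
    fix \<omega>
    show "(\<integral>\<^sup>+z. f z * (q (z, z + X h \<omega>) * g (z + X h \<omega>)) \<partial>lborel)
      = (\<integral>\<^sup>+z. f (z - X h \<omega>) * (q (z - X h \<omega>, z) * g z) \<partial>lborel)"
      using nn_integral_lborel_shift[of "\<lambda>z. f (z - X h \<omega>) * (q (z - X h \<omega>, z) * g z)" "X h \<omega>"]
      by simp
  qed
  also have "\<dots> = (\<integral>\<^sup>+z. \<integral>\<^sup>+\<omega>. f (z - X h \<omega>) * (q (z - X h \<omega>, z) * g z) \<partial>M \<partial>lborel)"
    by (rule P.Fubini') measurable
  also have "\<dots> = (\<integral>\<^sup>+z. transfer q h f z * g z \<partial>lborel)"
  proof (rule nn_integral_cong)
    fix z
    have "(\<integral>\<^sup>+\<omega>. f (z - X h \<omega>) * (q (z - X h \<omega>, z) * g z) \<partial>M)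
      = (\<integral>\<^sup>+\<omega>. q (z, z + - X h \<omega>) * f (z + - X h \<omega>) * g z \<partial>M)"
      by (simp add: sym[of z] mult_ac)
    also have "\<dots> = (\<integral>\<^sup>+\<omega>. q (z, z + - X h \<omega>) * f (z + - X h \<omega>) \<partial>M) * g z"
      by (rule nn_integral_multc) measurable
    also have "(\<integral>\<^sup>+\<omega>. q (z, z + - X h \<omega>) * f (z + - X h \<omega>) \<partial>M) = transfer q h f z"
      unfolding transfer_def
      by (rule nn_integral_X_uminus[OF h, of "\<lambda>u. q (z, z + u) * f (z + u)"]) measurable
    finally show "(\<integral>\<^sup>+\<omega>. f (z - X h \<omega>) * (q (z - X h \<omega>, z) * g z) \<partial>M) = transfer q h f z * g z" .
  qed
  finally show ?thesis .
qed

lemma transfer_funpow_symmetric: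
  assumes sym: "\<And>v w. q (v, w) = q (w, v)"
    and "f \<in> borel_measurable borel" "g \<in> borel_measurable borel"
  shows "(\<integral>\<^sup>+z. f z * (transfer q h ^^ n) g z \<partial>lborel) = (\<integral>\<^sup>+z. (transfer q h ^^ n) f z * g z \<partial>lborel)"
  using assms(2,3)
proof (induction n arbitrary: g)
  case (Suc n)
  note [measurable] = Suc.prems
  have "(\<integral>\<^sup>+z. f z * (transfer q h ^^ Suc n) g z \<partial>lborel)
      = (\<integral>\<^sup>+z. f z * (transfer q h ^^ n) (transfer q h g) z \<partial>lborel)"
    by (simp only: funpow_Suc_right comp_apply)
  also have "\<dots> = (\<integral>\<^sup>+z. (transfer q h ^^ n) f z * transfer q h g z \<partial>lborel)"
    by (rule Suc.IH) measurable
  also have "\<dots> = (\<integral>\<^sup>+z. transfer q h ((transfer q h ^^ n) f) z * g z \<partial>lborel)"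
    by (rule transfer_symmetric[OF sym]) measurable
  finally show ?case
    by simp
qed simp

end

text \<open>The martingale property of \<open>p (t - s) (y - x - X s \<omega>)\<close> between
  \<open>c\<close> and \<open>b\<close>, tested on polylines up to \<open>c\<close>:
  Chapman-Kolmogorov averages the increment after \<open>c\<close>.\<close>

lemma nn_integral_polyline_markov:
  assumes "0 < a" "a < c" "c \<le> b" "b < t"
  shows "(\<integral>\<^sup>+\<omega>. polyline_avoids D k a c n (\<lambda>s. x + X s \<omega>) * ennreal (p (t - b) (y - x - X b \<omega>)) \<partial>M)
    = (\<integral>\<^sup>+\<omega>. polyline_avoids D k a c n (\<lambda>s. x + X s \<omega>) * ennreal (p (t - c) (y - x - X c \<omega>)) \<partial>M)"
proof -
  \<comment> \<open>The time \<open>b\<close> is appended to the grid as index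
    \<open>Suc (Suc n)\<close>, so that the last increment leads from \<open>c\<close> to
    \<open>b\<close>.\<close>
  define T where "T i = (if i \<le> Suc n then grid a c n i else b)" for i
  have T0: "0 \<le> T 0"
    using assms by (simp add: T_def)
  have T: "mono_on {..Suc (Suc n)} T"
  proof (rule mono_onI)
    fix i j :: nat assume "i \<le> j"
    then show "T i \<le> T j"
      using assms grid_bounds[of a c i n] grid_mono[of a c i j n] by (auto simp: T_def)
  qed
  define A where "A g = (\<Prod>i<Suc n. avoids D k (x + g i, x + g (Suc i)))" for g :: "nat \<Rightarrow> 'a"
  define \<Phi> where "\<Phi> = (\<lambda>(g, w). A g * ennreal (p (t - b) (y - x - (g (Suc n) + w))))"
  have pm [measurable]: "p (t - b) \<in> borel_measurable borel"
    using assms by (intro p_measurable) auto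
  have \<Phi>: "\<Phi> \<in> borel_measurable ((\<Pi>\<^sub>M i\<in>{..Suc n}. borel) \<Otimes>\<^sub>M borel)"
  proof -
    have [measurable]: "(\<lambda>v. fst v i) \<in> borel_measurable ((\<Pi>\<^sub>M i\<in>{..Suc n}. borel :: 'a measure) \<Otimes>\<^sub>M (borel :: 'a measure))"
      if "i \<le> Suc n" for i
      using that by (intro measurable_compose[OF measurable_fst measurable_component_singleton]) simp
    have [measurable]: "(\<lambda>v. A (fst v))
      \<in> borel_measurable ((\<Pi>\<^sub>M i\<in>{..Suc n}. borel :: 'a measure) \<Otimes>\<^sub>M (borel :: 'a measure))"
      unfolding A_def by (rule borel_measurable_prod_ennreal) (measurable; simp)
    show ?thesis
      unfolding \<Phi>_def case_prod_unfold by (measurable; simp)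
  qed
  have A: "A (\<lambda>i\<in>{..Suc n}. X (T i) \<omega>) = polyline_avoids D k a c n (\<lambda>s. x + X s \<omega>)" for \<omega>
    unfolding A_def polyline_avoids_def by (intro prod.cong) (auto simp: T_def)
  have T_end: "T (Suc n) = c" "T (Suc (Suc n)) = b"
    by (simp_all add: T_def)
  have "(\<integral>\<^sup>+\<omega>. polyline_avoids D k a c n (\<lambda>s. x + X s \<omega>) * ennreal (p (t - b) (y - x - X b \<omega>)) \<partial>M)
    = (\<integral>\<^sup>+\<omega>. \<Phi> (\<lambda>i\<in>{..Suc n}. X (T i) \<omega>, X (T (Suc (Suc n))) \<omega> - X (T (Suc n)) \<omega>) \<partial>M)"
    unfolding \<Phi>_def prod.case A by (simp add: T_end)
  also have "\<dots> = (\<integral>\<^sup>+\<omega>. \<integral>\<^sup>+\<omega>'. \<Phi> (\<lambda>i\<in>{..Suc n}. X (T i) \<omega>, X (T (Suc (Suc n)) - T (Suc n)) \<omega>') \<partial>M \<partial>M)"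
    by (rule nn_integral_markov[OF T0 T \<Phi>])
  also have "\<dots> = (\<integral>\<^sup>+\<omega>. polyline_avoids D k a c n (\<lambda>s. x + X s \<omega>) * ennreal (p (t - c) (y - x - X c \<omega>)) \<partial>M)"
  proof (rule nn_integral_cong)
    fix \<omega>
    have Xm: "X (b - c) \<in> borel_measurable M"
      using assms by (intro measurable_process) auto
    have "(\<integral>\<^sup>+\<omega>'. \<Phi> (\<lambda>i\<in>{..Suc n}. X (T i) \<omega>, X (T (Suc (Suc n)) - T (Suc n)) \<omega>') \<partial>M)
      = (\<integral>\<^sup>+\<omega>'. polyline_avoids D k a c n (\<lambda>s. x + X s \<omega>) * ennreal (p (t - b) (y - x - X c \<omega> - X (b - c) \<omega>')) \<partial>M)"
      unfolding \<Phi>_def prod.case A by (simp only: T_end diff_diff_eq add.assoc restrict_apply atMost_iff order_refl if_True)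
    also have "\<dots> = polyline_avoids D k a c n (\<lambda>s. x + X s \<omega>)
        * (\<integral>\<^sup>+\<omega>'. ennreal (p (t - b) (y - x - X c \<omega> - X (b - c) \<omega>')) \<partial>M)"
      by (intro nn_integral_cmult measurable_compose[OF _ measurable_ennreal] measurable_compose[OF _ pm]
          borel_measurable_diff borel_measurable_const Xm)
    also have "(\<integral>\<^sup>+\<omega>'. ennreal (p (t - b) (y - x - X c \<omega> - X (b - c) \<omega>')) \<partial>M) = p (t - c) (y - x - X c \<omega>)"
      using assms by (subst nn_integral_p_convolution) auto
    finally show "(\<integral>\<^sup>+\<omega>'. \<Phi> (\<lambda>i\<in>{..Suc n}. X (T i) \<omega>, X (T (Suc (Suc n)) - T (Suc n)) \<omega>') \<partial>M)
      = polyline_avoids D k a c n (\<lambda>s. x + X s \<omega>) * ennreal (p (t - c) (y - x - X c \<omega>))" .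
  qed
  finally show ?thesis .
qed

text \<open>Integrating over the law of \<open>x + X a\<close> turns the starting point into the
  weight \<open>p a (z - x)\<close>, of the same form as the final weight
  \<open>p (t - b) (z - y)\<close>. In this form \<open>x\<close> and \<open>y\<close> can change
  places.\<close>

lemma nn_integral_polyline_eq_transfer:
  assumes "0 < a" "a < b" "b < t"
  shows "(\<integral>\<^sup>+\<omega>. polyline_avoids D k a b n (\<lambda>s. x + X s \<omega>) * ennreal (p (t - b) (y - x - X b \<omega>)) \<partial>M)
    = (\<integral>\<^sup>+z. ennreal (p a (z - x))
        * (transfer (avoids D k) ((b - a) / Suc n) ^^ Suc n) (\<lambda>z. ennreal (p (t - b) (z - y))) z \<partial>lborel)"
proof -
  let ?h = "(b - a) / Suc n" and ?F = "\<lambda>z. ennreal (p (t - b) (z - y))"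
  let ?T = "(transfer (avoids D k) ?h ^^ Suc n) ?F"
  have h: "0 < ?h"
    using assms by simp
  have [measurable]: "p (t - b) \<in> borel_measurable borel" "p a \<in> borel_measurable borel"
    using assms by (auto intro!: p_measurable)
  have F: "?F \<in> borel_measurable borel"
    by measurable
  have [measurable]: "?T \<in> borel_measurable borel"
    by (rule transfer_funpow_measurable[OF avoids_measurable h F])
  have b_eq: "a + real (Suc n) * ?h = b"
    by (simp del: of_nat_Suc)
  have "polyline_avoids D k a b n (\<lambda>s. x + X s \<omega>) * ennreal (p (t - b) (y - x - X b \<omega>))
    = (\<Prod>i<Suc n. avoids D k (x + X (a + i * ?h) \<omega>, x + X (a + Suc i * ?h) \<omega>)) * ?F (x + X (a + Suc n * ?h) \<omega>)" for \<omega>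
    unfolding polyline_avoids_def grid_def b_eq p_minus_commute[of _ "x + X b \<omega>"] by (simp only: diff_diff_eq)
  then have "(\<integral>\<^sup>+\<omega>. polyline_avoids D k a b n (\<lambda>s. x + X s \<omega>) * ennreal (p (t - b) (y - x - X b \<omega>)) \<partial>M)
    = (\<integral>\<^sup>+\<omega>. ?T (x + X a \<omega>) \<partial>M)"
    using assms by (simp only: nn_integral_chain[OF avoids_measurable h _ F] less_imp_le)
  also have "\<dots> = (\<integral>\<^sup>+z. ennreal (p a z) * ?T (x + z) \<partial>lborel)"
    by (rule nn_integral_X[OF \<open>0 < a\<close>, of "\<lambda>z. ?T (x + z)"]) measurable
  also have "\<dots> = (\<integral>\<^sup>+z. ennreal (p a (z + x - x)) * ?T (z + x) \<partial>lborel)"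
    by (simp only: add_diff_cancel_right' add.commute[of x])
  also have "\<dots> = (\<integral>\<^sup>+z. ennreal (p a (z - x)) * ?T z \<partial>lborel)"
    by (rule nn_integral_lborel_shift[of "\<lambda>z. ennreal (p a (z - x)) * ?T z" x]) measurable
  finally show ?thesis .
qed

text \<open>Symmetry moves the power of \<open>transfer\<close> onto the other weight. Both windows
  have the same mesh, since \<open>(t - a) - (t - b) = b - a\<close>.\<close>

lemma nn_integral_polyline_reversal:
  assumes "0 < a" "a < b" "b < t"
  shows "(\<integral>\<^sup>+\<omega>. polyline_avoids D k a b n (\<lambda>s. x + X s \<omega>) * ennreal (p (t - b) (y - x - X b \<omega>)) \<partial>M)
    = (\<integral>\<^sup>+\<omega>. polyline_avoids D k (t - b) (t - a) n (\<lambda>s. y + X s \<omega>) * ennreal (p a (x - y - X (t - a) \<omega>)) \<partial>M)"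
proof -
  let ?h = "(b - a) / Suc n"
  let ?T = "transfer (avoids D k) ?h ^^ Suc n"
  let ?F = "\<lambda>z. ennreal (p (t - b) (z - y))" and ?G = "\<lambda>z. ennreal (p a (z - x))"
  have h: "0 < ?h"
    using assms by simp
  have [measurable]: "p (t - b) \<in> borel_measurable borel" "p a \<in> borel_measurable borel"
    using assms by (auto intro!: p_measurable)
  have FG: "?F \<in> borel_measurable borel" "?G \<in> borel_measurable borel"
    by measurable
  have "(\<integral>\<^sup>+\<omega>. polyline_avoids D k a b n (\<lambda>s. x + X s \<omega>) * ennreal (p (t - b) (y - x - X b \<omega>)) \<partial>M)
    = (\<integral>\<^sup>+z. ?G z * ?T ?F z \<partial>lborel)"
    using assms by (rule nn_integral_polyline_eq_transfer)
  also have "\<dots> = (\<integral>\<^sup>+z. ?T ?G z * ?F z \<partial>lborel)"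
    by (rule transfer_funpow_symmetric[OF avoids_measurable h avoids_commute FG(2,1)])
  also have "\<dots> = (\<integral>\<^sup>+z. ?F z * ?T ?G z \<partial>lborel)"
    by (simp only: mult.commute)
  also have "\<dots> = (\<integral>\<^sup>+\<omega>. polyline_avoids D k (t - b) (t - a) n (\<lambda>s. y + X s \<omega>) * ennreal (p a (x - y - X (t - a) \<omega>)) \<partial>M)"
    using nn_integral_polyline_eq_transfer[of "t - b" "t - a" t D k n y x] assms by simp
  finally show ?thesis .
qed

section \<open>Expectations over time windows and their reversal\<close>

lemma p_X_measurable: "0 \<le> b \<Longrightarrow> b < t \<Longrightarrow> (\<lambda>\<omega>. p (t - b) (z - X b \<omega>)) \<in> borel_measurable M"
  by (intro measurable_compose[OF _ p_measurable] borel_measurable_diff measurable_process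
      borel_measurable_const) auto

lemma integrable_p_X: "0 \<le> b \<Longrightarrow> b < t \<Longrightarrow> integrable M (\<lambda>\<omega>. p (t - b) (z - X b \<omega>))"
proof -
  assume b: "0 \<le> b" "b < t"
  obtain C where "\<forall>s\<ge>t - b. \<forall>z. \<bar>p s z\<bar> \<le> C"
    using p_bounded[of "t - b"] b by auto
  then show ?thesis
    using b by (intro integrable_const_bound[of _ C] p_X_measurable) auto
qed

lemma nn_integral_p_X_finite:
  "0 \<le> b \<Longrightarrow> b < t \<Longrightarrow> (\<integral>\<^sup>+\<omega>. ennreal (p (t - b) (z - X b \<omega>)) \<partial>M) < \<infinity>"
  by (subst nn_integral_p_convolution) auto

definition avoidance :: "'a set \<Rightarrow> real \<Rightarrow> 'a \<Rightarrow> 'a \<Rightarrow> real \<Rightarrow> real \<Rightarrow> real" where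
  "avoidance D t x y a b = (\<integral>\<omega>. indicator (no_hit D x a b) \<omega> * p (t - b) (y - x - X b \<omega>) \<partial>M)"

lemma integral_indicator_p_X:
  assumes "0 \<le> b" "b < t" and A: "A \<in> sets M"
  shows "(\<integral>\<omega>. indicator A \<omega> * p (t - b) (z - X b \<omega>) \<partial>M)
    = enn2real (\<integral>\<^sup>+\<omega>. indicator A \<omega> * ennreal (p (t - b) (z - X b \<omega>)) \<partial>M)"
proof -
  have [measurable]: "(\<lambda>\<omega>. p (t - b) (z - X b \<omega>)) \<in> borel_measurable M" "A \<in> sets M"
    using assms by (auto intro: p_X_measurable)
  have "(\<integral>\<omega>. indicator A \<omega> * p (t - b) (z - X b \<omega>) \<partial>M)
    = enn2real (\<integral>\<^sup>+\<omega>. ennreal (indicator A \<omega> * p (t - b) (z - X b \<omega>)) \<partial>M)"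
    using assms by (intro integral_eq_nn_integral) (auto simp: p_nonneg)
  also have "(\<integral>\<^sup>+\<omega>. ennreal (indicator A \<omega> * p (t - b) (z - X b \<omega>)) \<partial>M)
    = (\<integral>\<^sup>+\<omega>. indicator A \<omega> * ennreal (p (t - b) (z - X b \<omega>)) \<partial>M)"
    by (intro nn_integral_cong) (simp add: indicator_def)
  finally show ?thesis .
qed

text \<open>Inherited from the polyline identity through the limits in \<open>n\<close> and
  \<open>k\<close>, in place of a Markov property relative to a sigma-algebra of the past.\<close>

lemma avoidance_markov:
  assumes "open D" "0 < a" "a < c" "c \<le> b" "b < t"
  shows "(\<integral>\<omega>. indicator (no_hit D x a c) \<omega> * p (t - b) (y - x - X b \<omega>) \<partial>M) = avoidance D t x y a c"
proof -
  have "(\<integral>\<^sup>+\<omega>. indicator (no_hit D x a c) \<omega> * ennreal (p (t - b) (y - x - X b \<omega>)) \<partial>M)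
    = (\<integral>\<^sup>+\<omega>. indicator (no_hit D x a c) \<omega> * ennreal (p (t - c) (y - x - X c \<omega>)) \<partial>M)"
  proof -
    have eq: "(\<integral>\<^sup>+\<omega>. indicator (no_hit D x a c) \<omega> * ennreal (p (t - s) (y - x - X s \<omega>)) \<partial>M)
      = (SUP k. liminf (\<lambda>n. \<integral>\<^sup>+\<omega>. polyline_avoids D k a c n (\<lambda>s. x + X s \<omega>) * ennreal (p (t - s) (y - x - X s \<omega>)) \<partial>M))"
      if "0 \<le> s" "s < t" for s
      using assms that
      by (intro nn_integral_no_hit nn_integral_p_X_finite measurable_compose[OF p_X_measurable measurable_ennreal])
    have "0 \<le> b" "0 \<le> c" "c < t"
      using assms by auto
    then show ?thesis
      using assms(5) by (simp only: eq nn_integral_polyline_markov[OF assms(2-5)])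
  qed
  moreover have "(\<integral>\<omega>. indicator (no_hit D x a c) \<omega> * p (t - s) (y - x - X s \<omega>) \<partial>M)
    = enn2real (\<integral>\<^sup>+\<omega>. indicator (no_hit D x a c) \<omega> * ennreal (p (t - s) (y - x - X s \<omega>)) \<partial>M)"
    if "0 \<le> s" "s < t" for s
    using that by (rule integral_indicator_p_X[OF _ _ sets_no_hit]) (use assms in auto)
  ultimately show ?thesis
    using assms by (simp only: avoidance_def)
qed

text \<open>\<open>no_hit\<close> takes account of the jump at the end of the window but not of the
  one at its start, so reversal does not match the two events path by path. The expectations agree
  all the same, being limits of the same numbers.\<close>

lemma avoidance_reversal:
  assumes "open D" "0 < a" "a < b" "b < t"
  shows "avoidance D t x y a b = avoidance D t y x (t - b) (t - a)"
proof -
  have G: "(\<lambda>\<omega>. p a (x - y - X (t - a) \<omega>)) \<in> borel_measurable M"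
      "(\<integral>\<^sup>+\<omega>. ennreal (p a (x - y - X (t - a) \<omega>)) \<partial>M) < \<infinity>"
    using p_X_measurable[of "t - a" t "x - y"] nn_integral_p_X_finite[of "t - a" t "x - y"] assms by auto
  have "(\<integral>\<^sup>+\<omega>. indicator (no_hit D x a b) \<omega> * ennreal (p (t - b) (y - x - X b \<omega>)) \<partial>M)
    = (SUP k. liminf (\<lambda>n. \<integral>\<^sup>+\<omega>. polyline_avoids D k a b n (\<lambda>s. x + X s \<omega>) * ennreal (p (t - b) (y - x - X b \<omega>)) \<partial>M))"
    using assms by (intro nn_integral_no_hit nn_integral_p_X_finite measurable_compose[OF p_X_measurable measurable_ennreal]) auto
  also have "\<dots> = (SUP k. liminf (\<lambda>n. \<integral>\<^sup>+\<omega>. polyline_avoids D k (t - b) (t - a) n (\<lambda>s. y + X s \<omega>)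
      * ennreal (p a (x - y - X (t - a) \<omega>)) \<partial>M))"
    by (simp only: nn_integral_polyline_reversal[OF assms(2-4)])
  also have "\<dots> = (\<integral>\<^sup>+\<omega>. indicator (no_hit D y (t - b) (t - a)) \<omega> * ennreal (p a (x - y - X (t - a) \<omega>)) \<partial>M)"
    using assms G by (intro nn_integral_no_hit[symmetric]) auto
  finally have "enn2real (\<integral>\<^sup>+\<omega>. indicator (no_hit D x a b) \<omega> * ennreal (p (t - b) (y - x - X b \<omega>)) \<partial>M)
    = enn2real (\<integral>\<^sup>+\<omega>. indicator (no_hit D y (t - b) (t - a)) \<omega> * ennreal (p (t - (t - a)) (x - y - X (t - a) \<omega>)) \<partial>M)"
    by simp
  moreover have "avoidance D t x y a b
    = enn2real (\<integral>\<^sup>+\<omega>. indicator (no_hit D x a b) \<omega> * ennreal (p (t - b) (y - x - X b \<omega>)) \<partial>M)"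
    unfolding avoidance_def
    by (rule integral_indicator_p_X[OF _ _ sets_no_hit]) (use assms in auto)
  moreover have "avoidance D t y x (t - b) (t - a)
    = enn2real (\<integral>\<^sup>+\<omega>. indicator (no_hit D y (t - b) (t - a)) \<omega>
        * ennreal (p (t - (t - a)) (x - y - X (t - a) \<omega>)) \<partial>M)"
    unfolding avoidance_def
    by (rule integral_indicator_p_X[OF _ _ sets_no_hit]) (use assms in auto)
  ultimately show ?thesis
    by simp
qed

section \<open>Optional stopping at the shot-down time\<close>

context
  fixes D :: "'a set" and t :: real and x y :: 'a
  assumes D: "open D" and t: "0 < t"
begin

definition \<sigma> :: "'w \<Rightarrow> ereal" where
  "\<sigma> \<omega> = shot_down_time D (\<lambda>s. x + X s \<omega>)"

text \<open>\<open>\<sigma> \<omega> = b\<close> still counts as alive. This matches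
  \<open>\<sigma> < t\<close> in the kernel and lets \<open>alive b\<close> depend only on windows
  strictly between 0 and \<open>b\<close>.\<close>

definition alive :: "real \<Rightarrow> 'w set" where
  "alive b = {\<omega> \<in> space M. ereal b \<le> \<sigma> \<omega>}"

definition g :: "real \<Rightarrow> 'w \<Rightarrow> real" where
  "g b \<omega> = p (t - b) (y - x - X b \<omega>)"

text \<open>For \<open>\<sigma> \<omega> = \<infinity>\<close> the conversion to \<open>real\<close>
  yields 0. Such paths are alive at all times, so the factor
  \<open>1 - indicator (alive b) \<omega>\<close> removes this default value.\<close>

definition stopped :: "'w \<Rightarrow> real" where
  "stopped \<omega> = p (t - real_of_ereal (\<sigma> \<omega>)) (y - x - X (real_of_ereal (\<sigma> \<omega>)) \<omega>)"

lemma g_measurable: "0 \<le> b \<Longrightarrow> b < t \<Longrightarrow> g b \<in> borel_measurable M"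
  unfolding g_def by (rule p_X_measurable)

lemma g_nonneg: "b < t \<Longrightarrow> 0 \<le> g b \<omega>"
  by (simp add: g_def p_nonneg)

lemma integrable_g: "0 \<le> b \<Longrightarrow> b < t \<Longrightarrow> integrable M (g b)"
  unfolding g_def by (rule integrable_p_X)

lemma integral_g: "0 \<le> b \<Longrightarrow> b < t \<Longrightarrow> (\<integral>\<omega>. g b \<omega> \<partial>M) = p t (y - x)"
  using integral_p_convolution[of "t - b" b "y - x"] by (simp add: g_def)

lemma \<sigma>_nonneg: "0 \<le> \<sigma> \<omega>"
  unfolding \<sigma>_def by (rule shot_down_time_nonneg)

lemma alive_0: "alive 0 = space M"
  using \<sigma>_nonneg by (simp add: alive_def flip: zero_ereal_def)

lemma alive_antimono:
  assumes "b \<le> b'"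
  shows "alive b' \<subseteq> alive b"
proof
  fix \<omega> assume "\<omega> \<in> alive b'"
  then have "\<omega> \<in> space M" "ereal b' \<le> \<sigma> \<omega>"
    by (simp_all add: alive_def)
  moreover have "ereal b \<le> ereal b'"
    using assms by simp
  ultimately show "\<omega> \<in> alive b"
    unfolding alive_def using order_trans[of "ereal b" "ereal b'" "\<sigma> \<omega>"] by simp
qed

lemma window_bounds: "0 < b \<Longrightarrow> 0 < b / (real m + 3) \<and> b / (real m + 3) < b - b / (real m + 3)"
proof -
  assume b: "0 < b"
  then have "b / (real m + 3) \<le> b / 3"
    by (intro divide_left_mono) auto
  moreover have "0 < b / (real m + 3)"
    using b by simp
  ultimately show ?thesis
    using b by (intro conjI) linarith+
qed

lemma alive_eq_INT:
  assumes "0 < b"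
  shows "alive b = (\<Inter>m::nat. no_hit D x (b / (real m + 3)) (b - b / (real m + 3)))"
proof -
  have "ereal b \<le> \<sigma> \<omega> \<longleftrightarrow> (\<forall>m::nat. \<not> hits D (\<lambda>s. x + X s \<omega>) (b / (real m + 3)) (b - b / (real m + 3)))" for \<omega>
    unfolding \<sigma>_def not_less[symmetric] shot_down_time_less_iff_seq[OF assms] by blast
  then show ?thesis
    unfolding alive_def no_hit_def by blast
qed

lemma decseq_no_hit: "0 < b \<Longrightarrow> decseq (\<lambda>m::nat. no_hit D x (b / (real m + 3)) (b - b / (real m + 3)))"
proof (rule decseq_SucI)
  fix m :: nat assume b: "0 < b"
  have le: "b / (real (Suc m) + 3) \<le> b / (real m + 3)"
    using b by (intro divide_left_mono) auto
  have ge: "b - b / (real m + 3) \<le> b - b / (real (Suc m) + 3)"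
    using le by simp
  have "hits D f (b / (real m + 3)) (b - b / (real m + 3)) \<Longrightarrow>
      hits D f (b / (real (Suc m) + 3)) (b - b / (real (Suc m) + 3))" for f
    using window_bounds[OF b, of m] by (intro hits_mono[OF _ le _ ge]) auto
  then show "no_hit D x (b / (real (Suc m) + 3)) (b - b / (real (Suc m) + 3))
      \<subseteq> no_hit D x (b / (real m + 3)) (b - b / (real m + 3))"
    unfolding no_hit_def by blast
qed

lemma sets_alive: "0 \<le> b \<Longrightarrow> alive b \<in> sets M"
proof (cases "b = 0")
  case False
  assume "0 \<le> b"
  with False have b: "0 < b" by simp
  show ?thesis
    unfolding alive_eq_INT[OF b] using window_bounds[OF b] by (intro sets.countable_INT) (auto intro!: sets_no_hit D)
qed (simp add: alive_0)

lemma integrable_indicator_g: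
  assumes "0 \<le> b" "b < t" "A \<in> sets M"
  shows "integrable M (\<lambda>\<omega>. indicator A \<omega> * g b \<omega>)"
  using integrable_mult_indicator[OF assms(3) integrable_g[OF assms(1,2)]]
  by (simp only: real_scaleR_def)

lemma tendsto_integral_alive:
  assumes b: "0 < b" and b': "0 \<le> b'" "b' < t"
  shows "(\<lambda>m::nat. \<integral>\<omega>. indicator (no_hit D x (b / (real m + 3)) (b - b / (real m + 3))) \<omega> * g b' \<omega> \<partial>M)
    \<longlonglongrightarrow> (\<integral>\<omega>. indicator (alive b) \<omega> * g b' \<omega> \<partial>M)"
proof (rule integral_dominated_convergence[where w = "g b'"])
  have [measurable]: "g b' \<in> borel_measurable M" "alive b \<in> sets M"
    using b b' by (auto intro: g_measurable sets_alive)
  show "(\<lambda>\<omega>. indicator (alive b) \<omega> * g b' \<omega>) \<in> borel_measurable M"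
    by measurable
  have [measurable]: "no_hit D x (b / (real m + 3)) (b - b / (real m + 3)) \<in> sets M" for m :: nat
    using window_bounds[OF b] by (intro sets_no_hit D) auto
  show "(\<lambda>\<omega>. indicator (no_hit D x (b / (real m + 3)) (b - b / (real m + 3))) \<omega> * g b' \<omega>) \<in> borel_measurable M" for m :: nat
    by measurable
  show "integrable M (g b')"
    by (rule integrable_g[OF b'])
  show "AE \<omega> in M. (\<lambda>m::nat. indicator (no_hit D x (b / (real m + 3)) (b - b / (real m + 3))) \<omega> * g b' \<omega>)
      \<longlonglongrightarrow> indicator (alive b) \<omega> * g b' \<omega>"
    unfolding alive_eq_INT[OF b]
    by (intro AE_I2 tendsto_mult_right LIMSEQ_indicator_decseq decseq_no_hit b)
  show "AE \<omega> in M. norm (indicator (no_hit D x (b / (real m + 3)) (b - b / (real m + 3))) \<omega> * g b' \<omega>) \<le> g b' \<omega>" for m :: nat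
    using g_nonneg[OF b'(2)] by (intro AE_I2) (auto simp: indicator_def)
qed

lemma integral_no_hit_g:
  assumes "0 < a" "a < c" "c \<le> b" "b < t"
  shows "(\<integral>\<omega>. indicator (no_hit D x a c) \<omega> * g b \<omega> \<partial>M) = avoidance D t x y a c"
  unfolding g_def by (rule avoidance_markov[OF D assms])

text \<open>\<open>alive b\<close> is the limit of windows ending before \<open>b\<close>. On each
  of them \<open>integral_no_hit_g\<close> gives both integrals the same value, and dominated
  convergence passes to the limit. At \<open>b = 0\<close> both are
  \<open>p t (y - x)\<close>.\<close>

lemma integral_alive_g:
  assumes b: "0 \<le> b" "b \<le> b'" "b' < t"
  shows "(\<integral>\<omega>. indicator (alive b) \<omega> * g b' \<omega> \<partial>M) = (\<integral>\<omega>. indicator (alive b) \<omega> * g b \<omega> \<partial>M)"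
proof (cases "b = 0")
  case True
  have "(\<integral>\<omega>. indicator (alive 0) \<omega> * g s \<omega> \<partial>M) = (\<integral>\<omega>. g s \<omega> \<partial>M)" for s
    by (intro Bochner_Integration.integral_cong) (auto simp: alive_0)
  then show ?thesis
    using True b t by (simp add: integral_g)
next
  case False
  with b have pos: "0 < b" by simp
  have "(\<integral>\<omega>. indicator (no_hit D x (b / (real m + 3)) (b - b / (real m + 3))) \<omega> * g b' \<omega> \<partial>M)
    = (\<integral>\<omega>. indicator (no_hit D x (b / (real m + 3)) (b - b / (real m + 3))) \<omega> * g b \<omega> \<partial>M)" for m :: nat
  proof -
    have w: "0 < b / (real m + 3)" "b / (real m + 3) < b - b / (real m + 3)"
      "b - b / (real m + 3) \<le> b" "b - b / (real m + 3) \<le> b'" "b < t"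
      using window_bounds[OF pos, of m] b by auto
    show ?thesis
      by (simp only: integral_no_hit_g[OF w(1,2,3,5)] integral_no_hit_g[OF w(1,2,4) b(3)])
  qed
  then show ?thesis
    using tendsto_integral_alive[OF pos, of b'] tendsto_integral_alive[OF pos, of b] b
    by (auto intro: LIMSEQ_unique)
qed

section \<open>Optional stopping up to a time before \<open>t\<close>\<close>

definition \<rho> :: "real \<Rightarrow> real" where
  "\<rho> b = (\<integral>\<omega>. indicator (alive b) \<omega> * g b \<omega> \<partial>M)"

lemma \<rho>_0: "\<rho> 0 = p t (y - x)"
proof -
  have "\<rho> 0 = (\<integral>\<omega>. g 0 \<omega> \<partial>M)"
    unfolding \<rho>_def by (intro Bochner_Integration.integral_cong) (auto simp: alive_0)
  then show ?thesis
    using t by (simp add: integral_g)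
qed

text \<open>\<open>\<sigma>\<close> is rounded up to the grid of mesh \<open>b / Suc n\<close>, so that the Markov property is only
  needed for the events \<open>alive s\<close> at grid times \<open>s\<close>.\<close>

definition approx :: "real \<Rightarrow> nat \<Rightarrow> 'w \<Rightarrow> real" where
  "approx b n \<omega> = (\<Sum>k<Suc n. (indicator (alive (k * (b / Suc n))) \<omega> - indicator (alive (Suc k * (b / Suc n))) \<omega>)
      * g (Suc k * (b / Suc n)) \<omega>)"

lemma step_bounds:
  assumes "0 < b" "k < Suc n"
  shows "0 \<le> real k * (b / Suc n)" "real k * (b / Suc n) \<le> real (Suc k) * (b / Suc n)"
    "0 \<le> real (Suc k) * (b / Suc n)" "real (Suc k) * (b / Suc n) \<le> b"
proof -
  have "real (Suc k) * (b / Suc n) \<le> real (Suc n) * (b / Suc n)"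
    using assms by (intro mult_right_mono) auto
  then show "real (Suc k) * (b / Suc n) \<le> b"
    by (simp del: of_nat_Suc)
  show "real k * (b / Suc n) \<le> real (Suc k) * (b / Suc n)"
    by (rule mult_right_mono) (use assms in auto)
qed (use assms in \<open>auto simp del: of_nat_Suc\<close>)

text \<open>On the paths alive at the left end of a cell, \<open>integral_alive_g\<close> replaces
  \<open>g\<close> at the right end by \<open>g\<close> at the left end. Each summand becomes a
  difference of values of \<open>\<rho>\<close>, and the sum telescopes.\<close>

lemma integral_approx:
  assumes b: "0 < b" "b < t"
  shows "(\<integral>\<omega>. approx b n \<omega> \<partial>M) = p t (y - x) - \<rho> b"
proof -
  define s where "s k = real k * (b / Suc n)" for k
  have s: "0 \<le> s k" "s k \<le> s (Suc k)" "0 \<le> s (Suc k)" "s (Suc k) < t" if "k < Suc n" for k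
    using step_bounds[OF b(1) that] b(2) unfolding s_def by auto
  have "(\<integral>\<omega>. approx b n \<omega> \<partial>M)
    = (\<Sum>k<Suc n. \<integral>\<omega>. (indicator (alive (s k)) \<omega> - indicator (alive (s (Suc k))) \<omega>) * g (s (Suc k)) \<omega> \<partial>M)"
    unfolding approx_def s_def[symmetric]
    by (rule Bochner_Integration.integral_sum)
      (use s in \<open>auto simp: left_diff_distrib intro!: Bochner_Integration.integrable_diff integrable_indicator_g sets_alive\<close>)
  also have "\<dots> = (\<Sum>k<Suc n. \<rho> (s k) - \<rho> (s (Suc k)))"
  proof (rule sum.cong[OF refl])
    fix k assume "k \<in> {..<Suc n}"
    then have k: "k < Suc n" by simp
    have "(\<integral>\<omega>. (indicator (alive (s k)) \<omega> - indicator (alive (s (Suc k))) \<omega>) * g (s (Suc k)) \<omega> \<partial>M)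
      = (\<integral>\<omega>. indicator (alive (s k)) \<omega> * g (s (Suc k)) \<omega> \<partial>M)
        - (\<integral>\<omega>. indicator (alive (s (Suc k))) \<omega> * g (s (Suc k)) \<omega> \<partial>M)"
      unfolding left_diff_distrib using s[OF k]
      by (intro Bochner_Integration.integral_diff integrable_indicator_g sets_alive)
    then show "(\<integral>\<omega>. (indicator (alive (s k)) \<omega> - indicator (alive (s (Suc k))) \<omega>) * g (s (Suc k)) \<omega> \<partial>M)
      = \<rho> (s k) - \<rho> (s (Suc k))"
      using s[OF k] by (simp add: \<rho>_def integral_alive_g[of "s k" "s (Suc k)"])
  qed
  also have "\<dots> = \<rho> (s 0) - \<rho> (s (Suc n))"
    by (rule sum_lessThan_telescope')
  also have "\<dots> = p t (y - x) - \<rho> b"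
    by (simp add: s_def \<rho>_0 del: of_nat_Suc)
  finally show ?thesis .
qed

lemma approx_measurable:
  assumes b: "0 < b" "b < t"
  shows "approx b n \<in> borel_measurable M"
  unfolding approx_def [abs_def]
proof (intro borel_measurable_sum borel_measurable_times borel_measurable_diff borel_measurable_indicator)
  fix k assume "k \<in> {..<Suc n}"
  then have k: "k < Suc n" by simp
  note s = step_bounds[OF b(1) k]
  show "alive (real k * (b / Suc n)) \<in> sets M" "alive (real (Suc k) * (b / Suc n)) \<in> sets M"
    by (rule sets_alive; fact s)+
  show "g (real (Suc k) * (b / Suc n)) \<in> borel_measurable M"
    using s(3,4) b(2) by (intro g_measurable) linarith+
qed

lemma approx_alive:
  assumes b: "0 < b" and \<omega>: "\<omega> \<in> alive b"
  shows "approx b n \<omega> = 0"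
proof -
  have alive: "\<omega> \<in> alive s" if "s \<le> b" for s
    using \<omega> alive_antimono[OF that] by blast
  show ?thesis
    unfolding approx_def
  proof (intro sum.neutral ballI)
    fix k assume "k \<in> {..<Suc n}"
    then have k: "k < Suc n" by simp
    have "\<omega> \<in> alive (real k * (b / Suc n))" "\<omega> \<in> alive (real (Suc k) * (b / Suc n))"
      using step_bounds[OF b k] by (intro alive; linarith)+
    then show "(indicator (alive (real k * (b / Suc n))) \<omega> - indicator (alive (real (Suc k) * (b / Suc n))) \<omega>)
      * g (real (Suc k) * (b / Suc n)) \<omega> = 0"
      by (simp del: of_nat_Suc)
  qed
qed

lemma approx_dead:
  assumes b: "0 < b" and \<omega>: "\<omega> \<in> space M" and s: "\<sigma> \<omega> = ereal s" "0 \<le> s" "s < b"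
  shows "approx b n \<omega> = g ((of_int \<lfloor>s / (b / Suc n)\<rfloor> + 1) * (b / Suc n)) \<omega>"
proof -
  define h where "h = b / Suc n"
  have h: "0 < h"
    using b by (simp add: h_def)
  \<comment> \<open>\<open>j\<close> is the cell with \<open>j * h \<le> s < Suc j * h\<close>. A
    path shot exactly at a grid time is alive at that time, so rounding goes to the next grid time;
    this is the \<open>+ 1\<close> after the floor.\<close>
  define j where "j = nat \<lfloor>s / h\<rfloor>"
  have j: "real j = of_int \<lfloor>s / h\<rfloor>"
    using s h by (simp add: j_def)
  then have "real j \<le> s / h" "s / h < real j + 1"
    by (simp_all add: floor_correct)
  then have jh: "real j * h \<le> s" "s < real (Suc j) * h"
    using h by (simp_all add: field_simps)
  have "real j * h < real (Suc n) * h"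
    using jh s by (simp add: h_def del: of_nat_Suc)
  then have jn: "j < Suc n"
    using h by (simp only: mult_less_cancel_right_pos of_nat_less_iff)
  have alive_iff: "\<omega> \<in> alive (real k * h) \<longleftrightarrow> k \<le> j" for k
  proof -
    have "\<omega> \<in> alive (real k * h) \<longleftrightarrow> real k * h \<le> s"
      using \<omega> s by (simp add: alive_def)
    also have "\<dots> \<longleftrightarrow> k \<le> j"
    proof
      assume "real k * h \<le> s"
      with jh have "real k * h < real (Suc j) * h"
        by linarith
      then have "k < Suc j"
        using h by (simp only: mult_less_cancel_right_pos of_nat_less_iff)
      then show "k \<le> j" by simp
    next
      assume "k \<le> j"
      then have "real k * h \<le> real j * h"
        using h by (intro mult_right_mono) auto
      with jh show "real k * h \<le> s" by simp
    qed
    finally show ?thesis .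
  qed
  have "approx b n \<omega> = (\<Sum>k<Suc n. if k = j then g (real (Suc k) * h) \<omega> else 0)"
    unfolding approx_def h_def[symmetric]
    by (intro sum.cong refl) (auto simp: indicator_def alive_iff simp del: of_nat_Suc)
  also have "\<dots> = g (real (Suc j) * h) \<omega>"
    using jn by (subst sum.delta) auto
  also have "real (Suc j) * h = (of_int \<lfloor>s / (b / Suc n)\<rfloor> + 1) * (b / Suc n)"
    using j by (simp add: h_def)
  finally show ?thesis .
qed

text \<open>Rounding upwards lets the rounded times approach \<open>\<sigma> \<omega>\<close> from
  the right, where the path is continuous. The remaining time stays positive as
  \<open>\<sigma> \<omega> < b < t\<close>, so the density is continuous there.\<close>

lemma approx_tendsto:
  assumes b: "0 < b" "b < t" and \<omega>: "\<omega> \<in> space M"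
  shows "(\<lambda>n. approx b n \<omega>) \<longlonglongrightarrow> (1 - indicator (alive b) \<omega>) * stopped \<omega>"
proof (cases "\<omega> \<in> alive b")
  case True
  then show ?thesis
    by (simp add: approx_alive[OF b(1)])
next
  case False
  then have lt: "\<sigma> \<omega> < ereal b"
    using \<omega> by (simp add: alive_def not_le)
  moreover have "0 \<le> \<sigma> \<omega>"
    by (rule \<sigma>_nonneg)
  ultimately obtain s where s: "\<sigma> \<omega> = ereal s" "0 \<le> s" "s < b"
    by (cases "\<sigma> \<omega>") auto
  define h where "h n = b / Suc n" for n
  have h: "0 < h n" for n
    using b by (simp add: h_def)
  define r where "r n = (of_int \<lfloor>s / h n\<rfloor> + 1) * h n" for n
  have r: "s \<le> r n" "r n \<le> s + h n" for n
  proof -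
    have "s / h n * h n \<le> r n" "of_int \<lfloor>s / h n\<rfloor> * h n \<le> s / h n * h n"
      unfolding r_def using h[of n] by (intro mult_right_mono; linarith)+
    then show "s \<le> r n" "r n \<le> s + h n"
      using h[of n] by (simp_all add: r_def distrib_right)
  qed
  have "h \<longlonglongrightarrow> 0"
    unfolding h_def by (rule LIMSEQ_Suc[OF lim_const_over_n])
  then have "(\<lambda>n. s + h n) \<longlonglongrightarrow> s"
    using tendsto_add[OF tendsto_const[of s]] by fastforce
  then have r_lim: "r \<longlonglongrightarrow> s"
    using r by (intro tendsto_sandwich[of "\<lambda>_. s" r sequentially "\<lambda>n. s + h n"]) auto
  have "(\<lambda>n. X (r n) \<omega>) \<longlonglongrightarrow> X s \<omega>"
    by (rule cadlag_seq_right[OF cadlag_paths[OF \<omega>] s(2) r_lim r(1)])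
  then have "(\<lambda>n. p (t - r n) (y - x - X (r n) \<omega>)) \<longlonglongrightarrow> p (t - s) (y - x - X s \<omega>)"
    using s b r_lim by (intro stable_density_tendsto[OF \<alpha>] tendsto_intros) auto
  moreover have "approx b n \<omega> = p (t - r n) (y - x - X (r n) \<omega>)" for n
    unfolding approx_dead[OF b(1) \<omega> s] by (simp only: g_def r_def h_def)
  ultimately show ?thesis
    using False s by (simp add: stopped_def)
qed

text \<open>Rounded times do not exceed \<open>b\<close>, so only densities at times at least
  \<open>t - b\<close> occur.\<close>

lemma approx_bounded:
  assumes b: "0 < b" "b < t"
  shows "\<exists>C. \<forall>n. \<forall>\<omega>\<in>space M. \<bar>approx b n \<omega>\<bar> \<le> C"
proof -
  obtain C where C: "\<forall>s\<ge>t - b. \<forall>z. \<bar>p s z\<bar> \<le> C"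
    using p_bounded[of "t - b"] b by auto
  then have "0 \<le> C"
    by (meson abs_ge_zero order_refl order_trans)
  have "\<bar>approx b n \<omega>\<bar> \<le> C" if \<omega>: "\<omega> \<in> space M" for n \<omega>
  proof (cases "\<omega> \<in> alive b")
    case True
    then show ?thesis
      using \<open>0 \<le> C\<close> by (simp add: approx_alive[OF b(1)])
  next
    case False
    then have "\<sigma> \<omega> < ereal b"
      using \<omega> by (simp add: alive_def not_le)
    moreover have "0 \<le> \<sigma> \<omega>"
      by (rule \<sigma>_nonneg)
    ultimately obtain s where s: "\<sigma> \<omega> = ereal s" "0 \<le> s" "s < b"
      by (cases "\<sigma> \<omega>") auto
    define h where "h = b / Suc n"
    have h: "0 < h" and b_eq: "b = of_int (int (Suc n)) * h"
      using b by (simp_all add: h_def del: of_nat_Suc)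
    have "s / h < of_int (int (Suc n))"
      using s h by (simp add: b_eq pos_divide_less_eq del: of_nat_Suc)
    then have "\<lfloor>s / h\<rfloor> < int (Suc n)"
      by (simp only: floor_less_iff)
    then have "of_int \<lfloor>s / h\<rfloor> + 1 \<le> (of_int (int (Suc n)) :: real)"
      by linarith
    then have "(of_int \<lfloor>s / h\<rfloor> + 1) * h \<le> b"
      unfolding b_eq using h by (intro mult_right_mono) auto
    then show ?thesis
      unfolding approx_dead[OF b(1) \<omega> s] g_def h_def[symmetric] using C by simp
  qed
  then show ?thesis
    by blast
qed

text \<open>Optional stopping at the smaller of \<open>\<sigma>\<close> and \<open>b\<close>, by
  dominated convergence from the rounded times; the constant majorant exists because
  \<open>b < t\<close>.\<close>

lemma
  assumes b: "0 < b" "b < t"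
  shows integrable_stopped: "integrable M (\<lambda>\<omega>. (1 - indicator (alive b) \<omega>) * stopped \<omega>)"
    and integral_stopped: "(\<integral>\<omega>. (1 - indicator (alive b) \<omega>) * stopped \<omega> \<partial>M) = p t (y - x) - \<rho> b"
proof -
  obtain C where C: "\<forall>n. \<forall>\<omega>\<in>space M. \<bar>approx b n \<omega>\<bar> \<le> C"
    using approx_bounded[OF b] ..
  have lim: "AE \<omega> in M. (\<lambda>n. approx b n \<omega>) \<longlonglongrightarrow> (1 - indicator (alive b) \<omega>) * stopped \<omega>"
    using approx_tendsto[OF b] by (rule AE_I2)
  have m: "(\<lambda>\<omega>. (1 - indicator (alive b) \<omega>) * stopped \<omega>) \<in> borel_measurable M"
    by (rule borel_measurable_LIMSEQ_real[OF approx_tendsto[OF b] approx_measurable[OF b]])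
  have bd: "AE \<omega> in M. norm (approx b n \<omega>) \<le> C" for n
    using C by (intro AE_I2) simp
  note dc = m approx_measurable[OF b] integrable_const[of C] lim bd
  show "integrable M (\<lambda>\<omega>. (1 - indicator (alive b) \<omega>) * stopped \<omega>)"
    by (rule integrable_dominated_convergence[OF dc])
  have "(\<lambda>n. \<integral>\<omega>. approx b n \<omega> \<partial>M) \<longlonglongrightarrow> (\<integral>\<omega>. (1 - indicator (alive b) \<omega>) * stopped \<omega> \<partial>M)"
    by (rule integral_dominated_convergence[OF dc])
  then show "(\<integral>\<omega>. (1 - indicator (alive b) \<omega>) * stopped \<omega> \<partial>M) = p t (y - x) - \<rho> b"
    by (simp add: integral_approx[OF b] LIMSEQ_const_iff)
qed

lemma stopped_nonneg: "\<sigma> \<omega> < ereal t \<Longrightarrow> 0 \<le> stopped \<omega>"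
proof -
  assume "\<sigma> \<omega> < ereal t"
  moreover have "0 \<le> \<sigma> \<omega>"
    by (rule \<sigma>_nonneg)
  ultimately show ?thesis
    by (cases "\<sigma> \<omega>") (auto simp: stopped_def p_nonneg)
qed

section \<open>Passage to the terminal time\<close>

definition cutoff :: "nat \<Rightarrow> real" where
  "cutoff m = t - t / (real m + 2)"

lemma cutoff: "0 < cutoff m" "cutoff m < t" "cutoff m \<le> cutoff (Suc m)"
proof -
  \<comment> \<open>The summand 2 makes the first cutoff time \<open>t / 2\<close>, which is
    positive.\<close>
  have "t / (real m + 2) \<le> t / 2" "t / (real (Suc m) + 2) \<le> t / (real m + 2)"
    using t by (intro divide_left_mono; simp)+
  moreover have "0 < t / (real m + 2)"
    using t by simp
  ultimately show "0 < cutoff m" "cutoff m < t" "cutoff m \<le> cutoff (Suc m)"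
    using t unfolding cutoff_def by linarith+
qed

lemma cutoff_tendsto: "cutoff \<longlonglongrightarrow> t"
proof -
  have "(\<lambda>m. t / real (m + 2)) \<longlonglongrightarrow> 0"
    by (rule LIMSEQ_ignore_initial_segment[OF lim_const_over_n])
  from tendsto_diff[OF tendsto_const[of t] this] show ?thesis
    by (simp add: cutoff_def [abs_def] add.commute)
qed

lemma cutoff_mono: "m \<le> n \<Longrightarrow> cutoff m \<le> cutoff n"
  by (rule lift_Suc_mono_le[of cutoff, OF cutoff(3)])

lemma shot_down_kernel_eq: "shot_down_kernel M X \<alpha> D t x y
    = p t (y - x) - (\<integral>\<omega>. (1 - indicator (alive t) \<omega>) * stopped \<omega> \<partial>M)"
proof -
  have "indicator {\<omega> \<in> space M. \<sigma> \<omega> < ereal t} \<omega> *\<^sub>R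
      p (t - real_of_ereal (\<sigma> \<omega>)) (y - (x + X (real_of_ereal (\<sigma> \<omega>)) \<omega>))
    = (1 - indicator (alive t) \<omega>) * stopped \<omega>" if "\<omega> \<in> space M" for \<omega>
    using that by (auto simp: indicator_def alive_def stopped_def not_le diff_diff_eq)
  then show ?thesis
    unfolding shot_down_kernel_def Let_def transition_density_def started_from_def
      set_lebesgue_integral_def \<sigma>_def[symmetric]
    by (simp cong: Bochner_Integration.integral_cong)
qed

text \<open>By \<open>integral_stopped\<close>, \<open>p t (y - x) - \<rho> b\<close> is the
  expectation of \<open>stopped\<close> over the paths shot before \<open>b\<close>; the integrand
  is nonnegative there, and this set grows with \<open>b\<close>.\<close>

lemma \<rho>_bounds: "0 \<le> \<rho> (cutoff m)" "\<rho> (cutoff (Suc m)) \<le> \<rho> (cutoff m)"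
proof -
  have ge: "(1 - indicator (alive (cutoff m)) \<omega>) * stopped \<omega> \<le> (1 - indicator (alive (cutoff (Suc m))) \<omega>) * stopped \<omega>"
    if "\<omega> \<in> space M" for \<omega>
  proof -
    have "\<sigma> \<omega> < ereal t" if "\<sigma> \<omega> < ereal (cutoff (Suc m))"
      using that cutoff(2)[of "Suc m"] by (meson ereal_less_eq(3) less_imp_le order_less_le_trans)
    then have "\<omega> \<notin> alive (cutoff (Suc m)) \<Longrightarrow> 0 \<le> stopped \<omega>"
      using that stopped_nonneg by (auto simp: alive_def not_le)
    moreover have "alive (cutoff (Suc m)) \<subseteq> alive (cutoff m)"
      by (rule alive_antimono[OF cutoff(3)])
    ultimately show ?thesis
      by (auto simp: indicator_def)
  qed
  show "0 \<le> \<rho> (cutoff m)"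
    unfolding \<rho>_def using g_nonneg[OF cutoff(2)] by (intro Bochner_Integration.integral_nonneg) auto
  have "p t (y - x) - \<rho> (cutoff m) \<le> p t (y - x) - \<rho> (cutoff (Suc m))"
    unfolding integral_stopped[OF cutoff(1,2), symmetric]
    by (intro integral_mono integrable_stopped cutoff ge)
  then show "\<rho> (cutoff (Suc m)) \<le> \<rho> (cutoff m)"
    by simp
qed

text \<open>The function \<open>p (t - s)\<close> is unbounded as \<open>s \<rightarrow> t\<close>, hence the limit of the cutoff times
  and monotone convergence.\<close>

lemma \<rho>_tendsto: "(\<lambda>m. \<rho> (cutoff m)) \<longlonglongrightarrow> shot_down_kernel M X \<alpha> D t x y"
proof -
  have dec: "decseq (\<lambda>m. \<rho> (cutoff m))"
    by (rule decseq_SucI) (rule \<rho>_bounds)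
  obtain L where L: "(\<lambda>m. \<rho> (cutoff m)) \<longlonglongrightarrow> L"
    by (rule decseq_convergent[OF dec, of 0]) (use \<rho>_bounds(1) in auto)
  let ?f = "\<lambda>m \<omega>. (1 - indicator (alive (cutoff m)) \<omega>) * stopped \<omega>"
  have st: "\<omega> \<in> space M \<Longrightarrow> \<omega> \<notin> alive t \<Longrightarrow> \<exists>s. \<sigma> \<omega> = ereal s \<and> 0 \<le> s \<and> s < t" for \<omega>
    using \<sigma>_nonneg[of \<omega>] by (cases "\<sigma> \<omega>") (auto simp: alive_def not_le)
  have ev: "\<forall>\<^sub>F m in sequentially. ?f m \<omega> = (1 - indicator (alive t) \<omega>) * stopped \<omega>" if \<omega>: "\<omega> \<in> space M" for \<omega>
  proof (cases "\<omega> \<in> alive t")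
    case True
    then have "\<omega> \<in> alive (cutoff m)" for m
      using alive_antimono[of "cutoff m" t] cutoff(2)[of m] by auto
    then show ?thesis
      using True by simp
  next
    case False
    then obtain s where s: "\<sigma> \<omega> = ereal s" "s < t"
      using st[OF \<omega>] by blast
    have "\<forall>\<^sub>F m in sequentially. s < cutoff m"
      using cutoff_tendsto s by (intro order_tendstoD) auto
    then show ?thesis
    proof eventually_elim
      case (elim m)
      then have "\<omega> \<notin> alive (cutoff m)"
        using s by (simp add: alive_def)
      then show ?case
        using False by simp
    qed
  qed
  have lim: "(\<lambda>m. ?f m \<omega>) \<longlonglongrightarrow> (1 - indicator (alive t) \<omega>) * stopped \<omega>" if "\<omega> \<in> space M" for \<omega>
    using ev[OF that] by (rule tendsto_eventually)
  have mono: "mono (\<lambda>m. ?f m \<omega>)" if \<omega>: "\<omega> \<in> space M" for \<omega>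
  proof (cases "\<omega> \<in> alive t")
    case True
    then have "\<omega> \<in> alive (cutoff m)" for m
      using alive_antimono[of "cutoff m" t] cutoff(2)[of m] by auto
    then show ?thesis
      by (simp add: mono_def)
  next
    case False
    then have "0 \<le> stopped \<omega>"
      using st[OF \<omega>] stopped_nonneg by auto
    then show ?thesis
      using alive_antimono[OF cutoff_mono]
      by (auto simp: mono_def indicator_def)
  qed
  have m: "(\<lambda>\<omega>. (1 - indicator (alive t) \<omega>) * stopped \<omega>) \<in> borel_measurable M"
    by (rule borel_measurable_LIMSEQ_real[OF lim]) (auto intro: borel_measurable_integrable integrable_stopped cutoff)
  have "(\<lambda>m. \<integral>\<omega>. ?f m \<omega> \<partial>M) \<longlonglongrightarrow> p t (y - x) - L"
    unfolding integral_stopped[OF cutoff(1,2)] by (intro tendsto_intros L)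
  then have "(\<integral>\<omega>. (1 - indicator (alive t) \<omega>) * stopped \<omega> \<partial>M) = p t (y - x) - L"
    using mono lim by (intro integral_monotone_convergence[of M ?f] integrable_stopped cutoff m AE_I2)
  then show ?thesis
    using L by (simp add: shot_down_kernel_eq)
qed

text \<open>For \<open>b < cutoff m\<close>, survival up to \<open>cutoff m\<close> excludes hits in
  the window. The resulting bound on \<open>\<rho> (cutoff m)\<close> has its weight at time
  \<open>cutoff m\<close>, and the Markov property takes this weight back to
  \<open>b\<close>.\<close>

lemma shot_down_kernel_le_avoidance:
  assumes ab: "0 < a" "a < b" "b < t"
  shows "shot_down_kernel M X \<alpha> D t x y \<le> avoidance D t x y a b"
proof (rule tendsto_upperbound[OF \<rho>_tendsto])
  have "\<forall>\<^sub>F m in sequentially. b < cutoff m"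
    using cutoff_tendsto ab by (intro order_tendstoD) auto
  then show "\<forall>\<^sub>F m in sequentially. \<rho> (cutoff m) \<le> avoidance D t x y a b"
  proof eventually_elim
    case (elim m)
    have sub: "alive (cutoff m) \<subseteq> no_hit D x a b"
    proof
      fix \<omega> assume "\<omega> \<in> alive (cutoff m)"
      then show "\<omega> \<in> no_hit D x a b"
        using ab elim shot_down_time_less_iff[of D "\<lambda>s. x + X s \<omega>" "cutoff m"]
        by (auto simp: alive_def no_hit_def \<sigma>_def not_less[symmetric])
    qed
    have "\<rho> (cutoff m) \<le> (\<integral>\<omega>. indicator (no_hit D x a b) \<omega> * g (cutoff m) \<omega> \<partial>M)"
      unfolding \<rho>_def
    proof (rule integral_mono)
      show "integrable M (\<lambda>\<omega>. indicator (alive (cutoff m)) \<omega> * g (cutoff m) \<omega>)"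
        "integrable M (\<lambda>\<omega>. indicator (no_hit D x a b) \<omega> * g (cutoff m) \<omega>)"
        using cutoff[of m] ab by (auto intro!: integrable_indicator_g sets_alive sets_no_hit D)
      show "indicator (alive (cutoff m)) \<omega> * g (cutoff m) \<omega> \<le> indicator (no_hit D x a b) \<omega> * g (cutoff m) \<omega>" for \<omega>
        using sub g_nonneg[OF cutoff(2), of m \<omega>] by (auto simp: indicator_def)
    qed
    also have "\<dots> = avoidance D t x y a b"
      using ab elim cutoff by (intro integral_no_hit_g) auto
    finally show ?case .
  qed
qed simp

text \<open>Two successive choices: \<open>m\<close> with \<open>\<rho> (cutoff m) < e\<close>, then
  a window nearly exhausting the times up to \<open>cutoff m\<close>. The weight sits at
  \<open>cutoff m\<close>, beyond the window, and is moved to the end of the window.\<close>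

lemma avoidance_approximates_shot_down_kernel:
  assumes "shot_down_kernel M X \<alpha> D t x y < e"
  shows "\<exists>a b. 0 < a \<and> a < b \<and> b < t \<and> avoidance D t x y a b < e"
proof -
  have "\<forall>\<^sub>F m in sequentially. \<rho> (cutoff m) < e"
    using \<rho>_tendsto assms by (rule order_tendstoD)
  then obtain m where m: "\<rho> (cutoff m) < e"
    by (auto simp: eventually_sequentially)
  let ?b = "cutoff m"
  have "\<forall>\<^sub>F k in sequentially.
      (\<integral>\<omega>. indicator (no_hit D x (?b / (real k + 3)) (?b - ?b / (real k + 3))) \<omega> * g ?b \<omega> \<partial>M) < e"
    using tendsto_integral_alive[OF cutoff(1), of ?b] cutoff[of m] m
    by (intro order_tendstoD(2)[of _ "\<rho> ?b"]) (auto simp: \<rho>_def)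
  then obtain k :: nat where
    k: "(\<integral>\<omega>. indicator (no_hit D x (?b / (real k + 3)) (?b - ?b / (real k + 3))) \<omega> * g ?b \<omega> \<partial>M) < e"
    by (auto simp: eventually_sequentially)
  have w: "0 < ?b / (real k + 3)" "?b / (real k + 3) < ?b - ?b / (real k + 3)"
    using window_bounds[OF cutoff(1)] by auto
  then have "avoidance D t x y (?b / (real k + 3)) (?b - ?b / (real k + 3)) < e"
    using k integral_no_hit_g[OF w, of ?b] cutoff[of m] by simp
  then show ?thesis
    using w cutoff(2)[of m] by (intro exI[of _ "?b / (real k + 3)"] exI[of _ "?b - ?b / (real k + 3)"]) auto
qed

end

text \<open>The kernel is the infimum of \<open>avoidance\<close> over all windows, and reversal
  maps windows to windows while exchanging \<open>x\<close> and \<open>y\<close>. The opposite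
  inequality is the same statement with \<open>x\<close> and \<open>y\<close> exchanged.\<close>

lemma shot_down_kernel_le:
  assumes "open D" "0 < t"
  shows "shot_down_kernel M X \<alpha> D t x y \<le> shot_down_kernel M X \<alpha> D t y x"
proof (rule ccontr)
  assume "\<not> ?thesis"
  then obtain a b where ab: "0 < a" "a < b" "b < t"
    and less: "avoidance D t y x a b < shot_down_kernel M X \<alpha> D t x y"
    using avoidance_approximates_shot_down_kernel[OF assms, of y x "shot_down_kernel M X \<alpha> D t x y"] by auto
  have "shot_down_kernel M X \<alpha> D t x y \<le> avoidance D t x y (t - b) (t - a)"
    using ab by (intro shot_down_kernel_le_avoidance assms) auto
  also have "\<dots> = avoidance D t y x a b"
    using avoidance_reversal[OF assms(1) ab] by simp
  finally show False
    using less by simp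
qed

end

theorem theorem2p11:
  fixes M :: "'w measure"
    and X :: "real \<Rightarrow> 'w \<Rightarrow> 'a::euclidean_space"
    and \<alpha> t :: real
    and D :: "'a set"
    and x y :: 'a
  assumes "0 < \<alpha>" and "\<alpha> < 2"
    and "isotropic_stable_process M X \<alpha>"
    and "open D"
    and "0 < t"
  shows "shot_down_kernel M X \<alpha> D t x y = shot_down_kernel M X \<alpha> D t y x"
proof -
  interpret isotropic_stable_process_pos M X \<alpha>
    using assms by (simp add: isotropic_stable_process_pos_def isotropic_stable_process_pos_axioms_def)
  show ?thesis
    using assms by (intro antisym shot_down_kernel_le)
qed

end
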